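(* Let $g:S^1\to SU(2)$ be measurable and assume that $g$ has a triangular factorization. Then $g$ and $g^{-1}$ have root subgroup factorizations $$g=k_1^*\begin{pmatrix}e^{\chi}&0\\0&e^{-\chi}\end{pmatrix}k_2,\qquad g^{-1}=(k_1')^*\begin{pmatrix}e^{\chi'}&0\\0&e^{-\chi'}\end{pmatrix}k_2',$$ where $k_1,k_1'$ are of the form (I.1), $k_2,k_2'$ are of the form (II.1), and $\exp(-\chi_+),\exp(-\chi_+')\in L^2(S^1)$.
   Context: $\Delta$ is the open unit disk, $\Delta^*=\{|z|>1\}\cup\{\infty\}$, $H^0(U)$ denotes holomorphic functions on $U$, and $f^*$ denotes the complex conjugate of $f$ on $S^1$ ($f^*(z)=\sum\overline{f_{-n}}z^n$ for $f=\sum f_nz^n$). For loops into $SU(2)$, $k^*=k^{-1}$. Triangular factorization of $g$: $g=l\,m\,a\,u$ a.e. on $S^1$, where $l\in H^0(\Delta^*,SL(2,\mathbb C))$ with $l(\infty)$ lower triangular unipotent, $u\in H^0(\Delta,SL(2,\mathbb C))$ with $u(0)$ upper triangular unipotent, $l,u$ have $L^2$ radial limits on $S^1$, $m=\mathrm{diag}(m_0,m_0^{-1})$ with $m_0\in S^1$, $a=\mathrm{diag}(a_0,a_0^{-1})$ with $a_0>0$. (I.1): $k_1:S^1\to SU(2)$ is measurable of the form $k_1=\begin{pmatrix}a_1&b_1\\-b_1^*&a_1^*\end{pmatrix}$ on $S^1$, where $a_1,b_1\in H^0(\Delta)$ (with radial boundary values) do not simultaneously vanish in $\Delta$ and $a_1(0)>0$.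 (II.1): $k_2:S^1\to SU(2)$ is measurable of the form $k_2=\begin{pmatrix}d_2^*&-c_2^*\\c_2&d_2\end{pmatrix}$ on $S^1$, where $c_2,d_2\in H^0(\Delta)$ (with radial boundary values) do not simultaneously vanish in $\Delta$, $c_2(0)=0$ and $d_2(0)>0$. $\chi:S^1\to i\mathbb R$ is of the form $\chi=\chi_-+\chi_0+\chi_+$ with $\chi_0\in i\mathbb R$, $\chi_+$ (boundary values of) a holomorphic function in $\Delta$ with $\chi_+(0)=0$, and $\chi_-=-\chi_+^*$; $\exp(-\chi_+)\in L^2$ means that $\exp(-\chi_+)$ is a holomorphic function with $L^2$ radial boundary values (in $H^2$). Similarly for $\chi'$. *)

theory Defs
  imports "HOL-Analysis.Analysis"
begin

type_synonym mat22 = "complex^2^2"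

definition mat2 :: "complex \<Rightarrow> complex \<Rightarrow> complex \<Rightarrow> complex \<Rightarrow> mat22" where
  "mat2 p q r s = vector [vector [p, q], vector [r, s]]"

definition diag2 :: "complex \<Rightarrow> mat22" where
  "diag2 x = mat2 x 0 0 (inverse x)"

definition adj :: "mat22 \<Rightarrow> mat22" where
  "adj A = (\<chi> i j. cnj (A $ j $ i))"

definition SU2 :: "mat22 set" where
  "SU2 = {A. adj A ** A = mat 1 \<and> det A = 1}"

text \<open>Arc length on the unit circle (total mass \<open>2 * pi\<close>), completed, so that measurability with
  respect to it is Lebesgue measurability.\<close>

definition circle :: "complex measure" where
  "circle = completion
     (distr (restrict_space lborel {0..<2*pi}) (restrict_space borel (sphere 0 1)) cis)"

lemma space_circle [simp]: "space circle = sphere 0 1"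
  by (simp add: circle_def space_restrict_space)

definition SU2_loop :: "(complex \<Rightarrow> mat22) \<Rightarrow> bool" where
  "SU2_loop k \<longleftrightarrow> k \<in> borel_measurable circle \<and> (\<forall>z\<in>sphere 0 1. k z \<in> SU2)"

definition L2_circle :: "(complex \<Rightarrow> complex) \<Rightarrow> bool" where
  "L2_circle F \<longleftrightarrow> F \<in> borel_measurable circle \<and> integrable circle (\<lambda>z. (norm (F z))\<^sup>2)"

definition inner_radial_limit :: "(complex \<Rightarrow> complex) \<Rightarrow> (complex \<Rightarrow> complex) \<Rightarrow> bool" where
  "inner_radial_limit f F \<longleftrightarrow>
     (AE z in circle. ((\<lambda>r. f (complex_of_real r * z)) \<longlongrightarrow> F z) (at_left 1))"

definition outer_radial_limit :: "(complex \<Rightarrow> complex) \<Rightarrow> (complex \<Rightarrow> complex) \<Rightarrow> bool" where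
  "outer_radial_limit f F \<longleftrightarrow>
     (AE z in circle. ((\<lambda>r. f (complex_of_real r * z)) \<longlongrightarrow> F z) (at_right 1))"

text \<open>
  Functions on the circle with only nonnegative Fourier modes are identified with holomorphic
  functions in the disk, so a holomorphic function with square integrable boundary values means an
  element of the Hardy space \<open>H\<^sup>2\<close>.  The bound on the circle means cannot be dropped: without it
  \<open>exp ((1 + z) / (1 - z))\<close>, whose radial limits are unimodular a.e., would be admitted,
  and the boundary function would not determine the holomorphic function.
\<close>

definition H2_disk :: "(complex \<Rightarrow> complex) \<Rightarrow> (complex \<Rightarrow> complex) \<Rightarrow> bool" where
  "H2_disk f F \<longleftrightarrow>
     f holomorphic_on ball 0 1 \<and>
     (\<exists>C::real. \<forall>r::real. 0 < r \<and> r < 1 \<longrightarrow>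
        (\<integral>\<^sup>+ z. ennreal ((norm (f (complex_of_real r * z)))\<^sup>2) \<partial>circle) \<le> ennreal C) \<and>
     L2_circle F \<and> inner_radial_limit f F"

text \<open>A function on \<open>{z. 1 < norm z} \<union> {\<infinity>}\<close> is given by a function \<open>f\<close> together with its value
  \<open>c\<close> at infinity; holomorphy at infinity is expressed in the chart \<open>w = 1 / z\<close>.\<close>

definition holomorphic_exterior :: "(complex \<Rightarrow> complex) \<Rightarrow> complex \<Rightarrow> bool" where
  "holomorphic_exterior f c \<longleftrightarrow>
     f holomorphic_on {z. 1 < norm z} \<and>
     (\<lambda>w. if w = 0 then c else f (inverse w)) holomorphic_on ball 0 1"

definition H2_exterior ::
    "(complex \<Rightarrow> complex) \<Rightarrow> complex \<Rightarrow> (complex \<Rightarrow> complex) \<Rightarrow> bool" where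
  "H2_exterior f c F \<longleftrightarrow>
     holomorphic_exterior f c \<and>
     (\<exists>C::real. \<forall>r::real. 1 < r \<longrightarrow>
        (\<integral>\<^sup>+ z. ennreal ((norm (f (complex_of_real r * z)))\<^sup>2) \<partial>circle) \<le> ennreal C) \<and>
     L2_circle F \<and> outer_radial_limit f F"

text \<open>\<open>lb\<close> and \<open>ub\<close> are the boundary values of \<open>l\<close> and \<open>u\<close>, and \<open>linf\<close> is the value of \<open>l\<close> at
  infinity.\<close>

definition has_triangular_factorization :: "(complex \<Rightarrow> mat22) \<Rightarrow> bool" where
  "has_triangular_factorization g \<longleftrightarrow>
     (\<exists>(l :: complex \<Rightarrow> mat22) (linf :: mat22) (lb :: complex \<Rightarrow> mat22)
       (u :: complex \<Rightarrow> mat22) (ub :: complex \<Rightarrow> mat22) (m0 :: complex) (a0 :: real).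
        (\<forall>i j. H2_exterior (\<lambda>z. l z $ i $ j) (linf $ i $ j) (\<lambda>z. lb z $ i $ j)) \<and>
        (\<forall>z. 1 < norm z \<longrightarrow> det (l z) = 1) \<and>
        linf $ 1 $ 1 = 1 \<and> linf $ 2 $ 2 = 1 \<and> linf $ 1 $ 2 = 0 \<and>
        (\<forall>i j. H2_disk (\<lambda>z. u z $ i $ j) (\<lambda>z. ub z $ i $ j)) \<and>
        (\<forall>z\<in>ball 0 1. det (u z) = 1) \<and>
        u 0 $ 1 $ 1 = 1 \<and> u 0 $ 2 $ 2 = 1 \<and> u 0 $ 2 $ 1 = 0 \<and>
        norm m0 = 1 \<and> 0 < a0 \<and>
        (AE z in circle. g z = lb z ** diag2 m0 ** diag2 (complex_of_real a0) ** ub z))"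

text \<open>In the next two definitions capital letters are the boundary values of the holomorphic
  functions denoted by the corresponding small letters.  As the boundary values are bounded by 1,
  membership in \<open>H\<^sup>2\<close> here amounts to membership in \<open>H\<^sup>\<infinity>\<close>.\<close>

definition form_I1 :: "(complex \<Rightarrow> mat22) \<Rightarrow> bool" where
  "form_I1 k \<longleftrightarrow>
     SU2_loop k \<and>
     (\<exists>a b A B. H2_disk a A \<and> H2_disk b B \<and>
        (\<forall>z\<in>ball 0 1. \<not> (a z = 0 \<and> b z = 0)) \<and>
        a 0 \<in> \<real> \<and> 0 < Re (a 0) \<and>
        (AE z in circle. k z = mat2 (A z) (B z) (- cnj (B z)) (cnj (A z))))"

definition form_II1 :: "(complex \<Rightarrow> mat22) \<Rightarrow> bool" where
  "form_II1 k \<longleftrightarrow>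
     SU2_loop k \<and>
     (\<exists>c d C D. H2_disk c C \<and> H2_disk d D \<and>
        (\<forall>z\<in>ball 0 1. \<not> (c z = 0 \<and> d z = 0)) \<and>
        c 0 = 0 \<and> d 0 \<in> \<real> \<and> 0 < Re (d 0) \<and>
        (AE z in circle. k z = mat2 (cnj (D z)) (- cnj (C z)) (C z) (D z)))"

text \<open>The exponent \<open>h = h\<^sub>- + h\<^sub>0 + h\<^sub>+\<close> with \<open>exp (- h\<^sub>+)\<close> in \<open>H\<^sup>2\<close>: \<open>p\<close> is the holomorphic function
  \<open>h\<^sub>+\<close> in the disk, \<open>P\<close> its boundary function, and \<open>- cnj (P z)\<close> is \<open>h\<^sub>-\<close>.  The function \<open>p\<close> itself
  need not be in \<open>H\<^sup>2\<close>.\<close>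

definition torus_exponent :: "(complex \<Rightarrow> complex) \<Rightarrow> bool" where
  "torus_exponent h \<longleftrightarrow>
     h \<in> borel_measurable circle \<and> (\<forall>z\<in>sphere 0 1. Re (h z) = 0) \<and>
     (\<exists>h0 p P. Re h0 = 0 \<and>
        p holomorphic_on ball 0 1 \<and> p 0 = 0 \<and>
        P \<in> borel_measurable circle \<and> inner_radial_limit p P \<and>
        H2_disk (\<lambda>z. exp (- p z)) (\<lambda>z. exp (- P z)) \<and>
        (AE z in circle. h z = - cnj (P z) + h0 + P z))"

end

(* Write the factorization as g = v^* m a u with v(z) = l(1 / conj z)^*, so that both v and u have
   entries in the Hardy space of the disk.  Since g is unitary, the second row of u has on the circle
   a_0 times the length of the first row of v.  Let E be the outer function with this common modulus.
   Then a_1, b_1 are a_0 / E times the first row of v, and c_2, d_2 are 1 / E times the second row of u.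
   The loop k_1 g k_2^* is upper triangular and unitary, hence diagonal with entry m_0 conj E / E, and
   exp (- chi_+) = E / E(0).

   The row lies in H^2 together with a row completing it to determinant 1; this gives log integrability
   of its length, excludes a common singular inner factor, and makes |E| on the circle equal to the
   length of the row.  Radial limits of E come from the L^2 radial maximal theorem, and they give those
   of chi_+ by continuity of the logarithm along a radius. *)

theory Submission
  imports Defs "HOL-Complex_Analysis.Complex_Analysis"
begin

text \<open>Boundary values are radial limits almost everywhere, while \<open>E\<close> is produced
  only inside the disk, as the exponential of a Herglotz integral. Its boundary function has to be
  constructed and then identified, and a square integrable maximal function serves both ends. Limits
  exist because the remainders of a Taylor series have small maximal functions. Logarithms get
  majorants independent of the radius, because the completing row bounds the row length from below.
  The modulus of \<open>E\<close> on the circle is identified by comparing integrals: inside the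
  disk it dominates the row length, hence also on the circle, and the mean of its logarithm over
  concentric circles is constant, so two ordered logarithms with equal integrals agree almost
  everywhere. For the maximal theorem the supremum over radii is replaced by a measurable choice of
  one radius at each point. This gives a linear integral operator, and the task becomes a norm bound
  that is the same for all choices.\<close>

section \<open>Integration on the circle\<close>

text \<open>The Borel measure before completion. Integrals over \<open>circle\<close> reduce to it,
  and arguments with kernels in two variables run on it, where joint measurability follows from
  Borel measurability of the kernel.\<close>

definition circle0 :: "complex measure" where
  "circle0 = distr (restrict_space lborel {0..<2*pi}) (restrict_space borel (sphere 0 1)) cis"

lemma circle_eq: "circle = completion circle0"
  by (simp add: circle_def circle0_def)

lemma space_circle0 [simp]: "space circle0 = sphere 0 1"
  by (simp add: circle0_def space_restrict_space)

lemma sets_circle0 [measurable_cong]: "sets circle0 = sets (restrict_space borel (sphere 0 1))"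
  by (simp add: circle0_def)

lemma cis_measurable [measurable]:
  "cis \<in> measurable (restrict_space lborel {0..<2*pi}) (restrict_space borel (sphere 0 1))"
proof (rule measurable_restrict_space2)
  have "cis \<in> borel_measurable borel"
    by (intro borel_measurable_continuous_onI continuous_intros)
  then show "cis \<in> measurable (restrict_space lborel {0..<2*pi}) borel"
    by (intro measurable_restrict_space1) (simp add: measurable_lborel1)
qed (auto simp: space_restrict_space)

lemma emeasure_circle0: "emeasure circle0 (sphere 0 1) = ennreal (2 * pi)"
proof -
  have "sphere (0::complex) 1 \<in> sets (restrict_space borel (sphere 0 1))"
    by (simp add: sets_restrict_space_iff)
  moreover have "cis -` sphere 0 1 \<inter> {0..<2*pi} = {0..<2*pi}" by auto
  ultimately show ?thesis
    unfolding circle0_def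
    by (subst emeasure_distr)
       (auto simp: space_restrict_space emeasure_restrict_space)
qed

lemma finite_measure_circle0: "finite_measure circle0"
  by (rule finite_measureI) (simp add: emeasure_circle0)

lemma finite_measure_circle: "finite_measure circle"
proof (rule finite_measureI)
  have "sphere 0 1 \<in> sets circle0" using sets.top[of circle0] by simp
  then show "emeasure circle (space circle) \<noteq> \<infinity>"
    using emeasure_circle0 by (simp add: circle_eq)
qed

interpretation circle: finite_measure circle by (rule finite_measure_circle)

lemma measure_circle: "measure circle (sphere 0 1) = 2 * pi"
proof -
  have "sphere 0 1 \<in> sets circle0" using sets.top[of circle0] by simp
  then show ?thesis
    using emeasure_circle0 by (simp add: circle_eq measure_def)
qed

lemma continuous_measurable_circle0:
  "continuous_on (sphere 0 1) f \<Longrightarrow> f \<in> borel_measurable circle0"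
  by (subst measurable_cong_sets[OF sets_circle0 refl])
     (rule borel_measurable_continuous_on_restrict)

lemma circle0_measurable: "f \<in> measurable circle0 N \<Longrightarrow> f \<in> measurable circle N"
  by (simp add: circle_eq measurable_completion)

lemma continuous_measurable_circle:
  "continuous_on (sphere 0 1) f \<Longrightarrow> f \<in> borel_measurable circle"
  by (intro circle0_measurable continuous_measurable_circle0)

lemma integrable_circle_bounded:
  fixes f :: "complex \<Rightarrow> 'b :: {banach, second_countable_topology}"
  assumes "f \<in> borel_measurable circle" "\<And>z. norm z = 1 \<Longrightarrow> norm (f z) \<le> B"
  shows "integrable circle f"
  using assms by (intro circle.integrable_const_bound[where B=B]) auto

lemma integrable_circle_continuous:
  fixes f :: "complex \<Rightarrow> 'b :: {banach, second_countable_topology}"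
  assumes "continuous_on (sphere 0 1) f"
  shows "integrable circle f"
proof -
  have "bounded (f ` sphere 0 1)"
    by (intro compact_imp_bounded compact_continuous_image assms compact_sphere)
  then obtain B where B: "norm (f z) \<le> B" if "norm z = 1" for z
    unfolding bounded_iff by (metis (no_types) image_eqI mem_sphere_0)
  then show ?thesis
    by (intro integrable_circle_bounded[where B=B] continuous_measurable_circle assms B)
qed

lemma integral_circle_const [simp]: "(\<integral>z. (c::'b :: {banach, second_countable_topology}) \<partial>circle) = (2 * pi) *\<^sub>R c"
  using measure_circle by simp

lemma integral_circle_eq:
  fixes f :: "complex \<Rightarrow> complex"
  assumes "continuous_on (sphere 0 1) f"
  shows "(\<integral>z. f z \<partial>circle) = (\<integral>t. indicator {0..<2*pi} t *\<^sub>R f (cis t) \<partial>lborel)"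
proof -
  note [measurable] = continuous_measurable_circle0[OF assms]
  have f: "f \<in> borel_measurable (restrict_space borel (sphere 0 1))"
    using continuous_measurable_circle0[OF assms] measurable_cong_sets[OF sets_circle0 refl] by blast
  have "(\<integral>z. f z \<partial>circle) = (\<integral>z. f z \<partial>circle0)"
    by (simp add: circle_eq integral_completion)
  also have "\<dots> = (\<integral>t. f (cis t) \<partial>restrict_space lborel {0..<2*pi})"
    unfolding circle0_def by (rule integral_distr[OF cis_measurable f])
  also have "\<dots> = (\<integral>t. indicator {0..<2*pi} t *\<^sub>R f (cis t) \<partial>lborel)"
    by (rule integral_restrict_space) simp
  finally show ?thesis .
qed

section \<open>Fourier orthogonality and power series on the circle\<close>

lemma integral_circle_power:
  "(\<integral>z. z ^ n * cnj z ^ m \<partial>circle) = (if n = m then 2 * pi else 0)"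
proof (cases "n = m")
  case True
  have "(\<integral>z. z ^ n * cnj z ^ m \<partial>circle) = (\<integral>z. 1 \<partial>circle)"
    by (intro Bochner_Integration.integral_cong)
       (auto simp: True power_mult_distrib[symmetric] complex_norm_square[symmetric])
  also have "\<dots> = 2 * pi" by (subst integral_circle_const) (simp add: scaleR_conv_of_real)
  finally show ?thesis using True by simp
next
  case False
  define k where "k = real n - real m"
  have k: "k \<noteq> 0" using False by (simp add: k_def)
  have c: "cis t ^ n * cnj (cis t) ^ m = cis (k * t)" for t
    by (simp add: Complex.DeMoivre cis_cnj cis_mult k_def algebra_simps)
  \<comment> \<open>The endpoint is a null set; adding it gives the closed interval on which the
    fundamental theorem of calculus applies.\<close>
  have ae: "AE t in lborel. (t::real) \<noteq> 2*pi"
    by (rule AE_lborel_singleton)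
  have "(\<integral>z. z ^ n * cnj z ^ m \<partial>circle) = (\<integral>t. indicator {0..<2*pi} t *\<^sub>R cis (k * t) \<partial>lborel)"
    by (subst integral_circle_eq) (auto simp: c[symmetric] intro!: continuous_intros)
  also have "\<dots> = (\<integral>t. indicator {0..2*pi} t *\<^sub>R cis (k * t) \<partial>lborel)"
  proof (intro integral_cong_AE)
    have [measurable]: "(\<lambda>t. cis (k * t)) \<in> borel_measurable borel"
      by (intro borel_measurable_continuous_onI continuous_intros)
    show "(\<lambda>t. indicator {0..<2*pi} t *\<^sub>R cis (k * t)) \<in> borel_measurable lborel"
         "(\<lambda>t. indicator {0..2*pi} t *\<^sub>R cis (k * t)) \<in> borel_measurable lborel"
      by measurable
  qed (use ae in \<open>auto elim!: eventually_mono simp: indicator_def\<close>)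
  also have "\<dots> = cis (k * (2*pi)) / (\<i> * k) - cis (k * 0) / (\<i> * k)"
  proof (rule integral_FTC_Icc)
    show "((\<lambda>t. cis (k * t) / (\<i> * k)) has_vector_derivative cis (k * x)) (at x within {0..2*pi})" for x
    proof -
      have "((\<lambda>z. exp (\<i> * (k * z)) / (\<i> * k)) has_field_derivative exp (\<i> * (k * of_real x))) (at (of_real x))"
        using k by (auto intro!: derivative_eq_intros simp: mult_ac)
      from has_vector_derivative_real_field[OF this] show ?thesis by (simp add: cis_conv_exp)
    qed
  qed (auto intro!: continuous_intros)
  also have "cis (k * (2*pi)) = 1"
  proof -
    have "cis (k * (2*pi)) = cis (2 * pi * real n) / cis (2 * pi * real m)"
      by (simp add: cis_divide k_def algebra_simps)
    then show ?thesis by (simp add: cis_multiple_2pi)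
  qed
  finally show ?thesis using False by simp
qed

text \<open>The terms are dominated by summable multiples of \<open>norm (g z)\<close>, so sum and
  integral may be exchanged. With \<open>e n\<close> a power of \<open>z\<close> or of
  \<open>cnj z\<close> this is the common source of Fourier coefficients, the inner product formula
  and the power series of a Herglotz integral.\<close>

lemma integral_circle_sums:
  fixes g :: "complex \<Rightarrow> complex" and e :: "nat \<Rightarrow> complex \<Rightarrow> complex"
  assumes g: "integrable circle g" and e: "\<And>n. e n \<in> borel_measurable circle"
    and le: "\<And>n z. norm z = 1 \<Longrightarrow> norm (e n z) \<le> 1" and b: "summable (\<lambda>n. norm (b n))"
  shows "(\<lambda>n. b n * (\<integral>z. g z * e n z \<partial>circle)) sums (\<integral>z. g z * (\<Sum>n. b n * e n z) \<partial>circle)"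
proof -
  note [measurable] = e
  have [measurable]: "g \<in> borel_measurable circle" using g by auto
  have i1: "integrable circle (\<lambda>z. g z * e n z)" for n
  proof (rule Bochner_Integration.integrable_bound[OF g])
    show "AE x in circle. norm (g x * e n x) \<le> norm (g x)"
      using le by (auto intro!: AE_I2 mult_left_le simp: norm_mult)
  qed measurable
  have i3: "integrable circle (\<lambda>x. norm (g x) * norm (e n x))" for n
    using integrable_norm[OF i1[of n]] by (simp add: norm_mult)
  have i2: "(\<integral>z. norm (b n * (g z * e n z)) \<partial>circle) \<le> norm (b n) * (\<integral>z. norm (g z) \<partial>circle)" for n
    unfolding norm_mult[of "b n"] 
    by (subst Bochner_Integration.integral_mult_right_zero, rule mult_left_mono, rule integral_mono)
       (use le g i3 in \<open>auto intro!: mult_left_le simp: norm_mult\<close>)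
  have sb: "summable (\<lambda>n. norm (b n * e n z))" if "norm z = 1" for z
    by (rule summable_comparison_test'[OF b, of 0]) (use le that in \<open>auto intro!: mult_left_le simp: norm_mult\<close>)
  have sg: "summable (\<lambda>n. norm (b n * (g z * e n z)))" if "norm z = 1" for z
    using summable_mult[OF sb[OF that], of "norm (g z)"] by (simp add: norm_mult mult_ac)
  have "(\<lambda>n. \<integral>z. b n * (g z * e n z) \<partial>circle) sums (\<integral>z. (\<Sum>n. b n * (g z * e n z)) \<partial>circle)"
  proof (rule sums_integral)
    show "integrable circle (\<lambda>z. b n * (g z * e n z))" for n using i1 by simp
    show "AE z in circle. summable (\<lambda>n. norm (b n * (g z * e n z)))"
      using sg by (auto intro!: AE_I2)
    show "summable (\<lambda>n. \<integral>z. norm (b n * (g z * e n z)) \<partial>circle)"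
      by (rule summable_comparison_test'[OF summable_mult2[OF b], of 0])
         (use i2 in auto)
  qed
  moreover have "(\<Sum>n. b n * (g z * e n z)) = g z * (\<Sum>n. b n * e n z)" if "norm z = 1" for z
    by (subst suminf_mult[symmetric]) (auto simp: mult_ac intro: summable_norm_cancel[OF sb[OF that]])
  then have "(\<integral>z. (\<Sum>n. b n * (g z * e n z)) \<partial>circle) = (\<integral>z. g z * (\<Sum>n. b n * e n z) \<partial>circle)"
    by (intro Bochner_Integration.integral_cong) auto
  ultimately show ?thesis by simp
qed

abbreviation tcoeff :: "(complex \<Rightarrow> complex) \<Rightarrow> nat \<Rightarrow> complex" where
  "tcoeff f n \<equiv> (deriv ^^ n) f 0 / fact n"

text \<open>Absolute summability allows two termwise integrations: the series of \<open>f\<close>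
  against \<open>cnj z ^ n\<close> isolates \<open>a n\<close>, and the series of
  \<open>cnj (g z)\<close> then collects these coefficients. Parseval's identity and Cauchy's
  formula are both special cases.\<close>

lemma integral_circle_inner:
  assumes cont: "continuous_on (sphere 0 1) f"
    and a: "summable (\<lambda>n. norm (a n))" and b: "summable (\<lambda>n. norm (b n))"
    and f: "\<And>z. norm z = 1 \<Longrightarrow> (\<lambda>n. a n * z ^ n) sums f z"
    and g: "\<And>z. norm z = 1 \<Longrightarrow> (\<lambda>n. b n * z ^ n) sums g z"
  shows "(\<lambda>n. a n * cnj (b n)) sums ((\<integral>z. f z * cnj (g z) \<partial>circle) / (2 * pi))"
proof -
  have coeff: "(\<integral>z. f z * cnj z ^ n \<partial>circle) = 2 * pi * a n" for n
  proof -
    have "(\<lambda>m. a m * (\<integral>z. cnj z ^ n * z ^ m \<partial>circle)) sums (\<integral>z. cnj z ^ n * (\<Sum>m. a m * z ^ m) \<partial>circle)"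
      by (rule integral_circle_sums[OF _ _ _ a])
         (auto intro!: integrable_circle_continuous continuous_measurable_circle continuous_intros simp: norm_power)
    moreover have "(\<lambda>m. a m * (\<integral>z. cnj z ^ n * z ^ m \<partial>circle)) = (\<lambda>m. if m = n then 2 * pi * a m else 0)"
      by (auto simp: fun_eq_iff integral_circle_power mult.commute[of "cnj _ ^ n"])
    moreover have "(\<lambda>m. if m = n then 2 * pi * a m else 0) sums (2 * pi * a n)"
      using sums_single[of n "\<lambda>m. 2 * pi * a m"] by simp
    moreover have "(\<integral>z. cnj z ^ n * (\<Sum>m. a m * z ^ m) \<partial>circle) = (\<integral>z. f z * cnj z ^ n \<partial>circle)"
      by (intro Bochner_Integration.integral_cong) (auto simp: sums_unique[OF f, symmetric])
    ultimately show ?thesis by (metis sums_unique2)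
  qed
  have "(\<lambda>n. cnj (b n) * (\<integral>z. f z * cnj z ^ n \<partial>circle)) sums (\<integral>z. f z * (\<Sum>n. cnj (b n) * cnj z ^ n) \<partial>circle)"
    by (rule integral_circle_sums)
       (use b in \<open>auto intro!: integrable_circle_continuous continuous_measurable_circle continuous_intros cont simp: norm_power\<close>)
  moreover have "(\<Sum>n. cnj (b n) * cnj z ^ n) = cnj (g z)" if "norm z = 1" for z
    using sums_cnj[THEN iffD2, OF g[OF that]] by (simp add: sums_iff)
  then have "(\<integral>z. f z * (\<Sum>n. cnj (b n) * cnj z ^ n) \<partial>circle) = (\<integral>z. f z * cnj (g z) \<partial>circle)"
    by (intro Bochner_Integration.integral_cong) auto
  ultimately have "(\<lambda>n. (a n * cnj (b n)) * (2 * pi)) sums (\<integral>z. f z * cnj (g z) \<partial>circle)"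
    by (simp only: coeff mult_ac)
  then have "(\<lambda>n. (a n * cnj (b n)) * complex_of_real (2 * pi) / complex_of_real (2 * pi)) sums
      ((\<integral>z. f z * cnj (g z) \<partial>circle) / complex_of_real (2 * pi))"
    by (rule sums_divide)
  moreover have "x * complex_of_real (2 * pi) / complex_of_real (2 * pi) = x" for x
    by simp
  ultimately show ?thesis by (simp only:)
qed

lemma taylor_on_circle:
  assumes f: "f holomorphic_on ball 0 R" and r: "0 \<le> r" "r < R"
  shows "summable (\<lambda>n. norm (tcoeff f n * of_real r ^ n))"
    and "norm z = 1 \<Longrightarrow> (\<lambda>n. (tcoeff f n * of_real r ^ n) * z ^ n) sums f (of_real r * z)"
    and "continuous_on (sphere 0 1) (\<lambda>z. f (of_real r * z))"
proof -
  \<comment> \<open>Convergence of the Taylor series at a point beyond radius \<open>r\<close>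
    yields absolute convergence at radius \<open>r\<close>.\<close>
  define s where "s = (r + R) / 2"
  have s: "r < s" "s < R" "0 < s" using r by (auto simp: s_def)
  have "(\<lambda>n. tcoeff f n * (of_real s - 0) ^ n) sums f (of_real s)"
    by (rule holomorphic_power_series[OF f]) (use s in auto)
  then have "summable (\<lambda>n. tcoeff f n * (of_real s) ^ n)" by (auto simp: sums_iff)
  from powser_insidea[OF this, of "of_real r"] show "summable (\<lambda>n. norm (tcoeff f n * of_real r ^ n))"
    using s r by simp
  show "(\<lambda>n. (tcoeff f n * of_real r ^ n) * z ^ n) sums f (of_real r * z)" if "norm z = 1"
    using holomorphic_power_series[OF f, of "of_real r * z"] that r
    by (simp add: norm_mult power_mult_distrib mult.assoc)
  show "continuous_on (sphere 0 1) (\<lambda>z. f (of_real r * z))"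
    by (rule continuous_on_compose2[OF holomorphic_on_imp_continuous_on[OF f]])
       (use r in \<open>auto intro!: continuous_intros simp: norm_mult\<close>)
qed

section \<open>Poisson and Herglotz integrals\<close>

text \<open>The first argument is the point of the disk, the second the point of the circle. The
  kernel has mean 1, hence integral \<open>2 * pi\<close>, and every representation formula divides
  by that total mass.\<close>

definition poisson :: "complex \<Rightarrow> complex \<Rightarrow> real" where
  "poisson a w = (1 - (norm a)\<^sup>2) / (norm (1 - cnj a * w))\<^sup>2"

text \<open>On the circle this is the usual \<open>(w + a) / (w - a)\<close>; writing
  \<open>cnj w\<close> for the inverse of \<open>w\<close> displays it as a geometric series in
  \<open>a * cnj w\<close>, holomorphic in \<open>a\<close>.\<close>

definition herglotz_kernel :: "complex \<Rightarrow> complex \<Rightarrow> complex" where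
  "herglotz_kernel a w = (1 + a * cnj w) / (1 - a * cnj w)"

lemma one_minus_neq_0: "norm a < 1 \<Longrightarrow> norm w = 1 \<Longrightarrow> 1 - cnj a * w \<noteq> 0"
  using norm_mult[of "cnj a" w] by auto

lemma norm_one_minus: "norm (1 - a * cnj w) = norm (1 - cnj a * w)"
  by (metis complex_cnj_cnj complex_cnj_diff complex_cnj_mult complex_cnj_one complex_mod_cnj)

lemma Re_herglotz_kernel:
  assumes "norm w = 1"
  shows "Re (herglotz_kernel a w) = poisson a w"
proof -
  define x where "x = a * cnj w"
  have x: "norm x = norm a" using assms by (simp add: x_def norm_mult)
  have "Re ((1 + x) / (1 - x)) = (1 - (norm x)\<^sup>2) / (norm (1 - x))\<^sup>2"
    unfolding Re_divide cmod_power2 by (simp add: algebra_simps power2_eq_square)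
  then show ?thesis
    using norm_one_minus[of a w] by (simp add: herglotz_kernel_def poisson_def x x_def[symmetric])
qed

lemma poisson_pos: "norm a < 1 \<Longrightarrow> norm w = 1 \<Longrightarrow> 0 < poisson a w"
  using one_minus_neq_0[of a w] by (auto simp: poisson_def abs_square_less_1 intro!: divide_pos_pos)

lemma continuous_poisson: "norm a < 1 \<Longrightarrow> continuous_on (sphere 0 1) (poisson a)"
  using one_minus_neq_0[of a] unfolding poisson_def by (auto intro!: continuous_intros)

lemma continuous_herglotz_kernel: "norm a < 1 \<Longrightarrow> continuous_on (sphere 0 1) (herglotz_kernel a)"
  using norm_one_minus[of a] one_minus_neq_0[of a] unfolding herglotz_kernel_def
  by (auto intro!: continuous_intros) (metis norm_eq_zero right_minus_eq)

text \<open>The Szego kernel \<open>1 / (1 - cnj a * z)\<close> has Taylor coefficients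
  \<open>cnj a ^ n\<close>, so the inner product with it sums the Taylor series of \<open>f\<close>
  at \<open>a\<close>.\<close>

lemma cauchy_circle:
  fixes f :: "complex \<Rightarrow> complex"
  assumes f: "f holomorphic_on ball 0 R" and "1 < R" and a: "norm a < 1"
  shows "(\<integral>z. f z * cnj (1 / (1 - cnj a * z)) \<partial>circle) = 2 * pi * f a"
proof -
  have t: "continuous_on (sphere 0 1) f" "summable (\<lambda>n. norm (tcoeff f n))"
      "\<And>z. norm z = 1 \<Longrightarrow> (\<lambda>n. tcoeff f n * z ^ n) sums f z"
    using taylor_on_circle[OF f _ \<open>1 < R\<close>] by simp_all
  have "(\<lambda>n. tcoeff f n * cnj (cnj a ^ n)) sums ((\<integral>z. f z * cnj (1 / (1 - cnj a * z)) \<partial>circle) / (2 * pi))"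
  proof (rule integral_circle_inner[OF t(1,2) _ t(3)])
    show "summable (\<lambda>n. norm (cnj a ^ n))" using a by (simp add: norm_power summable_geometric)
    show "(\<lambda>n. cnj a ^ n * z ^ n) sums (1 / (1 - cnj a * z))" if "norm z = 1" for z
      using geometric_sums[of "cnj a * z"] a that by (simp add: norm_mult power_mult_distrib)
  qed
  moreover have "(\<lambda>n. tcoeff f n * a ^ n) sums f a"
    using holomorphic_power_series[OF f, of a] a \<open>1 < R\<close> by simp
  ultimately have "f a = (\<integral>z. f z * cnj (1 / (1 - cnj a * z)) \<partial>circle) / (2 * pi)"
    by (auto dest: sums_unique2)
  then show ?thesis by simp
qed

text \<open>The Cauchy formula for \<open>f w * (1 - (norm a)\<^sup>2) / (1 - cnj a * w)\<close>, whose value at \<open>a\<close> is \<open>f a\<close>.\<close>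

lemma poisson_circle:
  fixes f :: "complex \<Rightarrow> complex"
  assumes f: "f holomorphic_on ball 0 R" and "1 < R" and a: "norm a < 1"
  shows "(\<integral>z. f z * of_real (poisson a z) \<partial>circle) = 2 * pi * f a"
proof -
  \<comment> \<open>The quotient \<open>h\<close> has a pole at distance \<open>1 / norm a\<close>;
    \<open>S\<close> stops there and still exceeds 1. For \<open>a = 0\<close> there is no pole, and
    division by zero would give radius 0.\<close>
  define S where "S = (if a = 0 then R else min R (1 / norm a))"
  have S: "1 < S" "S \<le> R" using a \<open>1 < R\<close> by (auto simp: S_def)
  have nz: "1 - cnj a * z \<noteq> 0" if "norm z < S" for z
  proof
    assume "1 - cnj a * z = 0"
    then have "norm (cnj a * z) = 1" by simp
    with that show False by (auto simp: S_def norm_mult field_simps split: if_splits)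
  qed
  have sq: "complex_of_real ((norm a)\<^sup>2) = a * cnj a" by (rule complex_norm_square)
  define h where "h z = f z * (1 - a * cnj a) / (1 - cnj a * z)" for z
  have "h holomorphic_on ball 0 S"
    unfolding h_def using f S nz by (auto intro!: holomorphic_intros elim: holomorphic_on_subset)
  from cauchy_circle[OF this \<open>1 < S\<close> a]
  have "(\<integral>z. h z * cnj (1 / (1 - cnj a * z)) \<partial>circle) = 2 * pi * h a" .
  also have "h a = f a"
    using nz[of a] S a by (simp add: h_def mult.commute[of a])
  also have "(\<integral>z. h z * cnj (1 / (1 - cnj a * z)) \<partial>circle) = (\<integral>z. f z * of_real (poisson a z) \<partial>circle)"
  proof (rule Bochner_Integration.integral_cong[OF refl])
    fix z assume "z \<in> space circle"
    have "complex_of_real (poisson a z) = (1 - a * cnj a) / ((1 - cnj a * z) * cnj (1 - cnj a * z))"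
      by (simp only: poisson_def of_real_divide of_real_diff of_real_1 sq complex_norm_square)
    then show "h z * cnj (1 / (1 - cnj a * z)) = f z * of_real (poisson a z)"
      by (simp add: h_def)
  qed
  finally show ?thesis .
qed

lemma integral_poisson: "norm a < 1 \<Longrightarrow> (\<integral>z. poisson a z \<partial>circle) = 2 * pi"
proof -
  assume "norm a < 1"
  then have "(\<integral>z. complex_of_real (poisson a z) \<partial>circle) = complex_of_real (2 * pi)"
    using poisson_circle[of "\<lambda>_. 1" 2 a] by simp
  then show ?thesis by (simp only: integral_complex_of_real of_real_eq_iff)
qed

lemma mean_value_circle:
  fixes f :: "complex \<Rightarrow> complex"
  assumes "f holomorphic_on ball 0 R" "0 \<le> r" "r < R"
  shows "(\<integral>z. f (of_real r * z) \<partial>circle) = 2 * pi * f 0"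
proof -
  define S where "S = (if r = 0 then 2 else R / r)"
  have "1 < S" using assms by (auto simp: S_def)
  moreover have "(\<lambda>z. f (of_real r * z)) holomorphic_on ball 0 S"
    by (rule holomorphic_on_compose_gen[OF _ assms(1), unfolded o_def])
       (use assms in \<open>auto intro!: holomorphic_intros simp: norm_mult S_def field_simps\<close>)
  ultimately show ?thesis
    using poisson_circle[of "\<lambda>z. f (of_real r * z)" S 0] by (simp add: poisson_def)
qed

text \<open>Its real part is the Poisson integral of \<open>h\<close>, and the imaginary part is
  normalised to vanish at 0. This normalisation makes the outer function positive at 0, which gives
  the positive values at 0 required of the entries of the root subgroup factors.\<close>

definition herglotz :: "(complex \<Rightarrow> real) \<Rightarrow> complex \<Rightarrow> complex" where
  "herglotz h z = (\<integral>w. of_real (h w) * herglotz_kernel z w \<partial>circle) / (2 * pi)"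

lemma holomorphic_herglotz:
  assumes h: "integrable circle h"
  shows "herglotz h holomorphic_on ball 0 1"
proof -
  define c where "c n = (if n = 0 then 1 else 2) * (\<integral>w. of_real (h w) * cnj w ^ n \<partial>circle) / (2 * pi)" for n :: nat
  have "(\<lambda>n. c n * (z - 0) ^ n) sums herglotz h z" if "z \<in> ball 0 1" for z
  proof -
    have z: "norm z < 1" using that by simp
    \<comment> \<open>Coefficients of the kernel in powers of \<open>cnj w\<close>:
      \<open>(1 + x) / (1 - x) = 2 / (1 - x) - 1\<close> doubles all of them except the constant
      one. Integrating termwise leaves a power series in \<open>z\<close>.\<close>
    define b where "b n = (if n = 0 then 1 else 2) * z ^ n" for n
    have "(\<lambda>n. b n * (\<integral>w. of_real (h w) * cnj w ^ n \<partial>circle)) sums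
            (\<integral>w. of_real (h w) * (\<Sum>n. b n * cnj w ^ n) \<partial>circle)"
    proof (rule integral_circle_sums)
      show "summable (\<lambda>n. norm (b n))"
      proof (rule summable_comparison_test'[of "\<lambda>n. 2 * norm z ^ n" 0])
        show "summable (\<lambda>n. 2 * norm z ^ n)" using z by (intro summable_mult summable_geometric) auto
      qed (auto simp: b_def norm_mult norm_power)
    qed (use h in \<open>auto intro!: continuous_measurable_circle continuous_intros simp: norm_power\<close>)
    moreover have "(\<Sum>n. b n * cnj w ^ n) = herglotz_kernel z w" if w: "norm w = 1" for w
    proof -
      have n: "norm (z * cnj w) < 1" using z w by (simp add: norm_mult)
      then have nz: "1 - z * cnj w \<noteq> 0" by auto
      have "(\<lambda>n. 2 * (z * cnj w) ^ n - (if n = 0 then 1 else 0)) sums (2 * (1 / (1 - z * cnj w)) - 1)"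
        by (intro sums_diff sums_mult geometric_sums n sums_single[of 0 "\<lambda>_. 1", simplified])
      also have "(\<lambda>n. 2 * (z * cnj w) ^ n - (if n = 0 then 1 else 0)) = (\<lambda>n. b n * cnj w ^ n)"
        by (auto simp: fun_eq_iff b_def power_mult_distrib)
      also have "2 * (1 / (1 - z * cnj w)) - 1 = herglotz_kernel z w"
        using nz by (simp add: herglotz_kernel_def field_simps)
      finally show ?thesis by (simp add: sums_iff)
    qed
    then have "(\<integral>w. of_real (h w) * (\<Sum>n. b n * cnj w ^ n) \<partial>circle) = (\<integral>w. of_real (h w) * herglotz_kernel z w \<partial>circle)"
      by (intro Bochner_Integration.integral_cong) auto
    ultimately have "(\<lambda>n. b n * (\<integral>w. of_real (h w) * cnj w ^ n \<partial>circle) / (2 * pi)) sums herglotz h z"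
      unfolding herglotz_def by (intro sums_divide) simp
    then show ?thesis by (simp add: b_def c_def mult_ac)
  qed
  then show ?thesis by (rule power_series_holomorphic)
qed

lemma integrable_circle_mult_continuous:
  fixes g h :: "complex \<Rightarrow> 'b :: {banach, second_countable_topology, real_normed_field}"
  assumes g: "continuous_on (sphere 0 1) g" and h: "integrable circle h"
  shows "integrable circle (\<lambda>w. h w * g w)"
proof -
  have "bounded (g ` sphere 0 1)"
    by (intro compact_imp_bounded compact_continuous_image g compact_sphere)
  then obtain B where B: "norm (g z) \<le> B" if "norm z = 1" for z
    unfolding bounded_iff by (metis (no_types) image_eqI mem_sphere_0)
  note [measurable] = continuous_measurable_circle[OF g]
  have [measurable]: "h \<in> borel_measurable circle" using h by auto
  show ?thesis
  proof (rule Bochner_Integration.integrable_bound)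
    show "integrable circle (\<lambda>w. B *\<^sub>R h w)" using h by simp
    show "AE w in circle. norm (h w * g w) \<le> norm (B *\<^sub>R h w)"
    proof (rule AE_I2)
      fix w assume "w \<in> space circle"
      then have "norm (g w) \<le> \<bar>B\<bar>" using B[of w] by simp
      then show "norm (h w * g w) \<le> norm (B *\<^sub>R h w)"
        by (simp add: norm_mult mult.commute mult_right_mono)
    qed
  qed measurable
qed

lemma Re_herglotz:
  assumes h: "integrable circle h" and z: "norm z < 1"
  shows "Re (herglotz h z) = (\<integral>w. h w * poisson z w \<partial>circle) / (2 * pi)"
proof -
  have "integrable circle (\<lambda>w. of_real (h w) * herglotz_kernel z w)"
    using h z by (intro integrable_circle_mult_continuous continuous_herglotz_kernel) auto
  from integral_Re[OF this]
  have "Re (\<integral>w. of_real (h w) * herglotz_kernel z w \<partial>circle) = (\<integral>w. Re (of_real (h w) * herglotz_kernel z w) \<partial>circle)"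
    by simp
  also have "\<dots> = (\<integral>w. h w * poisson z w \<partial>circle)"
    by (intro Bochner_Integration.integral_cong) (auto simp: Re_herglotz_kernel)
  finally show ?thesis by (simp only: herglotz_def Re_divide_of_real)
qed

lemma herglotz_0: "herglotz h 0 = of_real ((\<integral>w. h w \<partial>circle) / (2 * pi))"
  by (simp add: herglotz_def herglotz_kernel_def)

text \<open>Both sides are a multiple of the value at 0. The independence of \<open>r\<close> later
  carries the integral of the logarithm of an outer function to the boundary.\<close>

lemma mean_value_herglotz:
  assumes h: "integrable circle h" and r: "0 \<le> r" "r < 1"
  shows "(\<integral>z. Re (herglotz h (of_real r * z)) \<partial>circle) = (\<integral>w. h w \<partial>circle)"
proof -
  have "integrable circle (\<lambda>z. herglotz h (of_real r * z))"
    by (intro integrable_circle_continuous taylor_on_circle(3)[OF holomorphic_herglotz[OF h] r])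
  from integral_Re[OF this] have "(\<integral>z. Re (herglotz h (of_real r * z)) \<partial>circle) = Re (2 * pi * herglotz h 0)"
    by (simp add: mean_value_circle[OF holomorphic_herglotz[OF h] r])
  then show ?thesis by (simp add: herglotz_0)
qed

section \<open>The radial maximal theorem\<close>

text \<open>The \<open>T T\<^sup>*\<close> argument: duality turns the almost reproducing inequality for the kernel into
  \<open>\<parallel>T\<parallel>\<^sup>2 \<le> 2 * c * \<parallel>T\<parallel>\<close>, where \<open>T\<close> is the integral operator with kernel \<open>k\<close>; the crude bound \<open>B\<close>
  only serves to make \<open>\<parallel>T\<parallel>\<close> finite and does not enter the conclusion.\<close>

lemma kernel_operator_L2_bound:
  fixes k :: "'a \<Rightarrow> 'a \<Rightarrow> ennreal" and B c :: real and T :: "('a \<Rightarrow> ennreal) \<Rightarrow> 'a \<Rightarrow> ennreal"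
  assumes M: "finite_measure M"
    and k[measurable]: "case_prod k \<in> borel_measurable (M \<Otimes>\<^sub>M M)"
    and B: "\<And>x y. x \<in> space M \<Longrightarrow> y \<in> space M \<Longrightarrow> k x y \<le> ennreal B"
    and c: "0 < c"
    and comp: "\<And>x y. x \<in> space M \<Longrightarrow> y \<in> space M \<Longrightarrow>
                 (\<integral>\<^sup>+w. k x w * k y w \<partial>M) \<le> ennreal c * (k x y + k y x)"
    and T: "\<And>G x. T G x = (\<integral>\<^sup>+y. k x y * G y \<partial>M)"
    and G[measurable]: "G \<in> borel_measurable M"
  shows "(\<integral>\<^sup>+x. (T G x)\<^sup>2 \<partial>M) \<le> ennreal (4 * c\<^sup>2 + 1) * (\<integral>\<^sup>+x. (G x)\<^sup>2 \<partial>M)"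
proof -
  interpret finite_measure M by (rule M)
  interpret pair_sigma_finite M M ..
  define Q where "Q G = (\<integral>\<^sup>+x. (G x)\<^sup>2 \<partial>M)" for G :: "'a \<Rightarrow> ennreal"
  have T_meas[measurable]: "T F \<in> borel_measurable M" if [measurable]: "F \<in> borel_measurable M" for F
    unfolding T by measurable
  \<comment> \<open>Tonelli's theorem: the operator with the transposed kernel is the adjoint of
    \<open>T\<close>.\<close>
  have dual: "(\<integral>\<^sup>+x. F x * T F' x \<partial>M) = (\<integral>\<^sup>+y. F' y * (\<integral>\<^sup>+x. k x y * F x \<partial>M) \<partial>M)"
    if [measurable]: "F \<in> borel_measurable M" "F' \<in> borel_measurable M" for F F'
  proof -
    have "(\<integral>\<^sup>+x. F x * T F' x \<partial>M) = (\<integral>\<^sup>+x. \<integral>\<^sup>+y. F x * (k x y * F' y) \<partial>M \<partial>M)"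
      unfolding T by (intro nn_integral_cong nn_integral_cmult[symmetric]) measurable
    also have "\<dots> = (\<integral>\<^sup>+y. \<integral>\<^sup>+x. F x * (k x y * F' y) \<partial>M \<partial>M)"
      by (rule Fubini'[symmetric]) measurable
    also have "\<dots> = (\<integral>\<^sup>+y. \<integral>\<^sup>+x. F' y * (k x y * F x) \<partial>M \<partial>M)"
      by (simp add: mult_ac)
    also have "\<dots> = (\<integral>\<^sup>+y. F' y * (\<integral>\<^sup>+x. k x y * F x \<partial>M) \<partial>M)"
      by (intro nn_integral_cong nn_integral_cmult) measurable
    finally show ?thesis .
  qed
  \<comment> \<open>The left side is the quadratic form of \<open>T\<close> composed with its
    adjoint, whose kernel is estimated by \<open>comp\<close>. The kernel and its transpose have the
    same quadratic form, whence the factor \<open>2 * c\<close>.\<close>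
  have dual_norm: "Q (\<lambda>y. \<integral>\<^sup>+x. k x y * F x \<partial>M) \<le> ennreal (2 * c) * (\<integral>\<^sup>+x. F x * T F x \<partial>M)"
    if [measurable]: "F \<in> borel_measurable M" for F
  proof -
    have "Q (\<lambda>y. \<integral>\<^sup>+x. k x y * F x \<partial>M) = (\<integral>\<^sup>+w. (\<integral>\<^sup>+x. k x w * F x \<partial>M) * (\<integral>\<^sup>+y. k y w * F y \<partial>M) \<partial>M)"
      by (simp add: Q_def power2_eq_square)
    also have "\<dots> = (\<integral>\<^sup>+x. F x * T (\<lambda>w. \<integral>\<^sup>+y. k y w * F y \<partial>M) x \<partial>M)"
      by (subst dual) (auto simp: mult.commute)
    also have "\<dots> = (\<integral>\<^sup>+x. F x * (\<integral>\<^sup>+y. F y * (\<integral>\<^sup>+w. k x w * k y w \<partial>M) \<partial>M) \<partial>M)"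
    proof (intro nn_integral_cong arg_cong[where f="(*) _"])
      fix x assume [measurable]: "x \<in> space M"
      have "T (\<lambda>w. \<integral>\<^sup>+y. k y w * F y \<partial>M) x = (\<integral>\<^sup>+w. \<integral>\<^sup>+y. k x w * (k y w * F y) \<partial>M \<partial>M)"
        unfolding T by (intro nn_integral_cong nn_integral_cmult[symmetric]) measurable
      also have "\<dots> = (\<integral>\<^sup>+y. \<integral>\<^sup>+w. k x w * (k y w * F y) \<partial>M \<partial>M)"
        by (rule Fubini') measurable
      also have "\<dots> = (\<integral>\<^sup>+y. \<integral>\<^sup>+w. F y * (k x w * k y w) \<partial>M \<partial>M)"
        by (simp add: mult_ac)
      also have "\<dots> = (\<integral>\<^sup>+y. F y * (\<integral>\<^sup>+w. k x w * k y w \<partial>M) \<partial>M)"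
        by (intro nn_integral_cong nn_integral_cmult) measurable
      finally show "T (\<lambda>w. \<integral>\<^sup>+y. k y w * F y \<partial>M) x = (\<integral>\<^sup>+y. F y * (\<integral>\<^sup>+w. k x w * k y w \<partial>M) \<partial>M)" .
    qed
    also have "\<dots> \<le> (\<integral>\<^sup>+x. F x * (\<integral>\<^sup>+y. F y * (ennreal c * (k x y + k y x)) \<partial>M) \<partial>M)"
      by (intro nn_integral_mono mult_left_mono comp) auto
    also have "\<dots> = (\<integral>\<^sup>+x. ennreal c * (F x * T F x) + ennreal c * (F x * (\<integral>\<^sup>+y. k y x * F y \<partial>M)) \<partial>M)"
    proof (intro nn_integral_cong)
      fix x assume [measurable]: "x \<in> space M"
      have "(\<integral>\<^sup>+y. F y * (ennreal c * (k x y + k y x)) \<partial>M) =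
            (\<integral>\<^sup>+y. ennreal c * (k x y * F y) + ennreal c * (k y x * F y) \<partial>M)"
        by (intro nn_integral_cong) (simp add: algebra_simps)
      also have "\<dots> = ennreal c * T F x + ennreal c * (\<integral>\<^sup>+y. k y x * F y \<partial>M)"
        unfolding T by (simp add: nn_integral_add nn_integral_cmult)
      finally show "F x * (\<integral>\<^sup>+y. F y * (ennreal c * (k x y + k y x)) \<partial>M) =
          ennreal c * (F x * T F x) + ennreal c * (F x * (\<integral>\<^sup>+y. k y x * F y \<partial>M))"
        by (simp add: algebra_simps)
    qed
    also have "\<dots> = ennreal c * (\<integral>\<^sup>+x. F x * T F x \<partial>M) + ennreal c * (\<integral>\<^sup>+x. F x * (\<integral>\<^sup>+y. k y x * F y \<partial>M) \<partial>M)"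
      by (simp add: nn_integral_add nn_integral_cmult)
    also have "\<dots> = ennreal (2 * c) * (\<integral>\<^sup>+x. F x * T F x \<partial>M)"
    proof -
      have "ennreal (2 * c) = ennreal c + ennreal c"
        unfolding mult_2 using c by (intro ennreal_plus) auto
      then show ?thesis by (simp only: dual[OF that that] distrib_right)
    qed
    finally show ?thesis .
  qed
  \<comment> \<open>The admissible bounds for the squared operator norm; restricting to finite
    \<open>Q F\<close> keeps every quantity below a real number.\<close>
  define A where "A = {K::real. 0 \<le> K \<and> (\<forall>F\<in>borel_measurable M. Q F < \<infinity> \<longrightarrow> Q (T F) \<le> ennreal K * Q F)}"
  \<comment> \<open>Two applications of Cauchy-Schwarz. With \<open>t = Q (T F)\<close> and
    \<open>q = Q F\<close>, duality gives \<open>t\<^sup>2 \<le> q * 2 * c * i\<close>, where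
    \<open>i\<close> pairs \<open>T F\<close> with its image under \<open>T\<close>; the bound
    \<open>K\<close>, applied to \<open>T F\<close>, gives
    \<open>i \<le> sqrt K * t\<close>.\<close>
  have step: "2 * c * sqrt K \<in> A" if "K \<in> A" for K
    unfolding A_def mem_Collect_eq
  proof safe
    show "0 \<le> 2 * c * sqrt K" using that c by (simp add: A_def)
  next
    fix F assume F[measurable]: "F \<in> borel_measurable M" and fin: "Q F < \<infinity>"
    have K: "0 \<le> K" "\<And>F. F \<in> borel_measurable M \<Longrightarrow> Q F < \<infinity> \<Longrightarrow> Q (T F) \<le> ennreal K * Q F"
      using that by (auto simp: A_def)
    obtain q where q: "Q F = ennreal q" "0 \<le> q" using fin by (cases "Q F") auto
    have "Q (T F) \<le> ennreal (K * q)" using K(2)[OF F fin] q K(1) by (simp add: ennreal_mult)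
    then have fin': "Q (T F) < \<infinity>" using le_less_trans[OF _ ennreal_less_top] by auto
    then obtain t where t: "Q (T F) = ennreal t" "0 \<le> t" by (cases "Q (T F)") auto
    define I where "I = (\<integral>\<^sup>+x. T F x * T (T F) x \<partial>M)"
    have "I\<^sup>2 \<le> Q (T F) * Q (T (T F))"
      unfolding I_def Q_def by (rule Cauchy_Schwarz_nn_integral) measurable
    also have "\<dots> \<le> Q (T F) * (ennreal K * Q (T F))"
      by (intro mult_left_mono K(2) fin') auto
    also have "\<dots> = ennreal (K * t\<^sup>2)"
      using t K(1) by (simp add: ennreal_mult power2_eq_square mult_ac)
    finally have I2: "I\<^sup>2 \<le> ennreal (K * t\<^sup>2)" .
    have "I\<^sup>2 < \<infinity>" using le_less_trans[OF I2 ennreal_less_top] by simp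
    then have "I \<noteq> \<infinity>" by (auto simp: power2_eq_square)
    then obtain i where i: "I = ennreal i" "0 \<le> i" by (cases I) auto
    have i2: "i\<^sup>2 \<le> K * t\<^sup>2"
      using I2 i t K(1) by (simp add: ennreal_power ennreal_le_iff)
    have "Q (T F) = (\<integral>\<^sup>+x. T F x * T F x \<partial>M)" by (simp add: Q_def power2_eq_square)
    also have "\<dots> = (\<integral>\<^sup>+y. F y * (\<integral>\<^sup>+x. k x y * T F x \<partial>M) \<partial>M)"
      by (rule dual) measurable
    finally have "(Q (T F))\<^sup>2 = (\<integral>\<^sup>+y. F y * (\<integral>\<^sup>+x. k x y * T F x \<partial>M) \<partial>M)\<^sup>2" by simp
    also have "\<dots> \<le> Q F * Q (\<lambda>y. \<integral>\<^sup>+x. k x y * T F x \<partial>M)"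
      unfolding Q_def by (rule Cauchy_Schwarz_nn_integral) measurable
    also have "\<dots> \<le> Q F * (ennreal (2 * c) * I)"
      unfolding I_def by (intro mult_left_mono dual_norm) auto
    also have "\<dots> = ennreal (q * (2 * c * i))" using q i c by (simp add: ennreal_mult)
    finally have "(Q (T F))\<^sup>2 \<le> ennreal (q * (2 * c * i))" .
    then have t2: "t\<^sup>2 \<le> q * (2 * c * i)"
      using t q i c by (simp add: ennreal_power ennreal_le_iff)
    have "i \<le> sqrt K * t"
      using real_le_rsqrt[OF i2] t by (simp add: real_sqrt_mult)
    then have "q * (2 * c * i) \<le> q * (2 * c * (sqrt K * t))"
      using q c by (intro mult_left_mono) auto
    with t2 have "t * t \<le> (2 * c * sqrt K * q) * t"
      by (simp add: power2_eq_square mult_ac)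
    then have "t \<le> 2 * c * sqrt K * q"
      using t c K(1) q by (cases "t = 0") auto
    then show "Q (T F) \<le> ennreal (2 * c * sqrt K) * Q F"
      using t q c K(1) by (simp add: ennreal_mult[symmetric])
  qed
  have ne: "A \<noteq> {}"
  proof -
    define m where "m = measure M (space M)"
    have m: "emeasure M (space M) = ennreal m" "0 \<le> m" by (simp_all add: m_def emeasure_eq_measure)
    define K where "K = \<bar>B\<bar>\<^sup>2 * m * m"
    have "Q (T F) \<le> ennreal K * Q F" if [measurable]: "F \<in> borel_measurable M" for F
    proof -
      have "(T F x)\<^sup>2 \<le> ennreal (\<bar>B\<bar>\<^sup>2 * m) * Q F" if "x \<in> space M" for x
      proof -
        have "k x y * F y \<le> ennreal \<bar>B\<bar> * F y" if "y \<in> space M" for y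
          using B[OF \<open>x \<in> space M\<close> that] by (intro mult_right_mono) (auto elim: order_trans intro: ennreal_leI)
        then have "T F x \<le> (\<integral>\<^sup>+y. ennreal \<bar>B\<bar> * F y \<partial>M)"
          unfolding T by (intro nn_integral_mono)
        then have "(T F x)\<^sup>2 \<le> (\<integral>\<^sup>+y. ennreal \<bar>B\<bar> * F y \<partial>M)\<^sup>2" by (intro power_mono) auto
        also have "\<dots> \<le> (\<integral>\<^sup>+y. (ennreal \<bar>B\<bar>)\<^sup>2 \<partial>M) * Q F"
          unfolding Q_def by (rule Cauchy_Schwarz_nn_integral) measurable
        also have "\<dots> = ennreal (\<bar>B\<bar>\<^sup>2 * m) * Q F"
          using m by (simp add: ennreal_power ennreal_mult)
        finally show ?thesis .
      qed
      then have "Q (T F) \<le> (\<integral>\<^sup>+x. ennreal (\<bar>B\<bar>\<^sup>2 * m) * Q F \<partial>M)"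
        by (subst Q_def) (intro nn_integral_mono)
      also have "\<dots> = ennreal K * Q F"
        using m by (simp add: K_def ennreal_mult mult_ac)
      finally show ?thesis .
    qed
    moreover have "0 \<le> K" using m by (simp add: K_def)
    ultimately show ?thesis by (auto simp: A_def)
  qed
  have bdd: "bdd_below A" by (intro bdd_belowI[of _ 0]) (auto simp: A_def)
  \<comment> \<open>The map sending \<open>K\<close> to \<open>2 * c * sqrt K\<close> preserves
    \<open>A\<close> and has fixed point \<open>4 * c\<^sup>2\<close>. Above that point it decreases
    its argument strictly, so a larger infimum would be undercut.\<close>
  have "Inf A \<le> 4 * c\<^sup>2"
  proof (rule ccontr)
    assume "\<not> ?thesis"
    then have I: "4 * c\<^sup>2 < Inf A" by simp
    then have pos: "0 < Inf A" using c by (meson less_trans mult_pos_pos zero_less_numeral zero_less_power)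
    have "Inf A < (Inf A)\<^sup>2 / (4 * c\<^sup>2)"
      using I pos c by (simp add: power2_eq_square field_simps)
    then obtain K where K: "K \<in> A" "K < (Inf A)\<^sup>2 / (4 * c\<^sup>2)"
      using cInf_less_iff[OF ne bdd] by blast
    have "Inf A \<le> 2 * c * sqrt K" by (rule cInf_lower[OF step[OF K(1)] bdd])
    also have "2 * c * sqrt K < 2 * c * sqrt ((Inf A)\<^sup>2 / (4 * c\<^sup>2))"
      using K c by simp
    also have "\<dots> = Inf A"
    proof -
      have "(Inf A)\<^sup>2 / (4 * c\<^sup>2) = (Inf A / (2 * c))\<^sup>2" by (simp add: power_divide power_mult_distrib)
      then show ?thesis using c pos by (simp add: real_sqrt_abs)
    qed
    finally show False by simp
  qed
  \<comment> \<open>The added 1 leaves room to pick an actual element of \<open>A\<close> near the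
    infimum.\<close>
  then have "Inf A < 4 * c\<^sup>2 + 1" by simp
  then obtain K where K: "K \<in> A" "K < 4 * c\<^sup>2 + 1" using cInf_less_iff[OF ne bdd] by blast
  have "Q (T G) \<le> ennreal (4 * c\<^sup>2 + 1) * Q G"
  proof (cases "Q G < \<infinity>")
    case True
    then have "Q (T G) \<le> ennreal K * Q G" using K(1) by (auto simp: A_def)
    also have "\<dots> \<le> ennreal (4 * c\<^sup>2 + 1) * Q G" using K(2) by (intro mult_right_mono ennreal_leI) auto
    finally show ?thesis .
  next
    case False
    then have "Q G = \<infinity>" by (simp add: not_less top_unique)
    moreover have "0 < 4 * c\<^sup>2 + 1" by (simp add: add_nonneg_pos)
    ultimately have "ennreal (4 * c\<^sup>2 + 1) * Q G = \<infinity>" by (simp add: ennreal_mult_top)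
    then show ?thesis by simp
  qed
  then show ?thesis by (simp add: Q_def)
qed

text \<open>As a function of \<open>w\<close> on the circle, the first factor is the real part of
  \<open>(1 + cnj a * w) / (1 - cnj a * w)\<close>, which is holomorphic past the closed disk. The
  Poisson formula therefore evaluates it at the second centre.\<close>

lemma poisson_semigroup:
  assumes z: "norm z = 1" "norm z' = 1" and r: "0 \<le> r" "r < 1" "0 \<le> r'" "r' < 1"
  shows "(\<integral>w. poisson (of_real r * z) w * poisson (of_real r' * z') w \<partial>circle) =
           2 * pi * poisson (of_real (r * r') * z) z'"
proof -
  define a where "a = of_real r * z"
  define a' where "a' = of_real r' * z'"
  have a: "norm a < 1" "norm a = r" "norm a' < 1" using z r by (auto simp: a_def a'_def norm_mult)
  define S where "S = (if r = 0 then 2 else 1 / r)"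
  have S: "1 < S" using r by (auto simp: S_def)
  define k where "k w = (1 + cnj a * w) / (1 - cnj a * w)" for w
  have nz: "1 - cnj a * w \<noteq> 0" if "norm w < S" for w
  proof
    assume "1 - cnj a * w = 0"
    then have "norm (cnj a * w) = 1" by simp
    with that a r show False by (auto simp: S_def norm_mult field_simps split: if_splits)
  qed
  have k: "k holomorphic_on ball 0 S"
    unfolding k_def using nz by (auto intro!: holomorphic_intros)
  have Rek: "Re (k w) = poisson a w" if "norm w = 1" for w
  proof -
    have "k w = cnj (herglotz_kernel a w)" by (simp add: k_def herglotz_kernel_def)
    then show ?thesis using Re_herglotz_kernel[OF that, of a] by simp
  qed
  have "continuous_on (sphere 0 1) k"
    by (rule continuous_on_subset[OF holomorphic_on_imp_continuous_on[OF k]]) (use S in auto)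
  then have "integrable circle (\<lambda>w. k w * of_real (poisson a' w))"
    using a by (intro integrable_circle_continuous continuous_intros continuous_poisson)
  from integral_Re[OF this]
  have "(\<integral>w. Re (k w * of_real (poisson a' w)) \<partial>circle) = Re (2 * pi * k a')"
    by (simp only: poisson_circle[OF k S a(3)])
  also have "(\<integral>w. Re (k w * of_real (poisson a' w)) \<partial>circle) = (\<integral>w. poisson a w * poisson a' w \<partial>circle)"
    by (intro Bochner_Integration.integral_cong) (auto simp: Rek)
  also have "k a' = cnj (herglotz_kernel (of_real (r * r') * z) z')"
    by (simp add: k_def herglotz_kernel_def a_def a'_def mult_ac)
  also have "Re (2 * pi * cnj (herglotz_kernel (of_real (r * r') * z) z')) = 2 * pi * Re (herglotz_kernel (of_real (r * r') * z) z')"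
    by simp
  also have "\<dots> = 2 * pi * poisson (of_real (r * r') * z) z'"
    using z by (simp only: Re_herglotz_kernel)
  finally show ?thesis unfolding a_def a'_def .
qed

lemma poisson_commute:
  "norm z = 1 \<Longrightarrow> norm z' = 1 \<Longrightarrow> poisson (of_real r * z) z' = poisson (of_real r * z') z"
  using norm_one_minus[of "of_real r * z'" z] by (simp add: poisson_def norm_mult mult_ac)

text \<open>The product \<open>t = r * r'\<close> lies between \<open>r * r\<close> and
  \<open>r\<close>. Hence the numerator grows by a factor of at most 2, and
  \<open>r - t \<le> 1 - t \<le> norm (1 - t * x)\<close> shows that the distance in the denominator
  shrinks by a factor of at most 2. Squaring the latter gives 8 in total.\<close>

lemma poisson_prod_le_aux:
  assumes z: "norm z = 1" "norm z' = 1" and r: "0 \<le> r" "r \<le> r'" "r' < 1"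
  shows "poisson (of_real (r * r') * z) z' \<le> 8 * poisson (of_real r * z) z'"
proof -
  define x where "x = cnj z * z'"
  have x: "norm x = 1" using z by (simp add: x_def norm_mult)
  define t where "t = r * r'"
  have rr: "r < 1" using r by simp
  have t: "0 \<le> t" "t \<le> r" "r * r \<le> t" 
    using r by (auto simp: t_def mult_left_le intro!: mult_left_mono)
  have t1: "t < 1" using t rr by simp
  have n: "norm (1 - of_real s * x) > 0" "1 - s \<le> norm (1 - of_real s * x)" if "0 \<le> s" "s < 1" for s :: real
  proof -
    show "1 - s \<le> norm (1 - of_real s * x)"
      using norm_triangle_ineq2[of 1 "of_real s * x"] x that by (simp add: norm_mult)
    with that show "norm (1 - of_real s * x) > 0" by linarith
  qed
  have p: "poisson (of_real s * z) z' = (1 - s\<^sup>2) / (norm (1 - of_real s * x))\<^sup>2" if "0 \<le> s" for s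
    using z that by (simp add: poisson_def x_def norm_mult mult_ac)
  have "r - t \<le> 1 - t" using rr by simp
  have le: "norm (1 - of_real r * x) \<le> 2 * norm (1 - of_real t * x)"
  proof -
    have "1 - of_real r * x = (1 - of_real t * x) - of_real (r - t) * x" by (simp add: algebra_simps)
    then have "norm (1 - of_real r * x) \<le> norm (1 - of_real t * x) + norm (of_real (r - t) * x)"
      by (metis norm_triangle_ineq4)
    also have "norm (of_real (r - t) * x) = r - t"
      using t x by (simp add: norm_mult flip: of_real_diff)
    also have "r - t \<le> norm (1 - of_real t * x)"
      using n(2)[OF t(1) t1] rr by simp
    finally show ?thesis by simp
  qed
  have num: "1 - t\<^sup>2 \<le> 2 * (1 - r\<^sup>2)"
  proof -
    have "(r * r)\<^sup>2 \<le> t\<^sup>2" using t by (intro power_mono) auto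
    moreover have "0 \<le> (1 - r\<^sup>2)\<^sup>2" by simp
    ultimately show ?thesis by (simp add: power2_eq_square algebra_simps)
  qed
  have "poisson (of_real t * z) z' = (1 - t\<^sup>2) / (norm (1 - of_real t * x))\<^sup>2" by (rule p[OF t(1)])
  also have "\<dots> \<le> (2 * (1 - r\<^sup>2)) / (norm (1 - of_real r * x) / 2)\<^sup>2"
  proof (rule frac_le)
    show "0 \<le> 2 * (1 - r\<^sup>2)" using r rr by (simp add: abs_square_le_1)
    show "0 < (norm (1 - of_real r * x) / 2)\<^sup>2" using n(1)[of r] r rr by simp
    show "(norm (1 - of_real r * x) / 2)\<^sup>2 \<le> (norm (1 - of_real t * x))\<^sup>2"
      using le by (intro power_mono) auto
  qed (rule num)
  also have "\<dots> = 8 * poisson (of_real r * z) z'" by (simp add: p[OF r(1)] power_divide)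
  finally show ?thesis by (simp add: t_def)
qed

text \<open>The kernel with the smaller radius controls the product. Which of the two is smaller
  varies with the points, so both appear; this symmetric sum is the form demanded by the operator
  bound.\<close>

lemma poisson_prod_le:
  assumes z: "norm z = 1" "norm z' = 1" and r: "0 \<le> r" "r < 1" "0 \<le> r'" "r' < 1"
  shows "poisson (of_real (r * r') * z) z' \<le> 8 * (poisson (of_real r * z) z' + poisson (of_real r' * z') z)"
proof -
  have pos: "0 \<le> poisson (of_real r * z) z'" "0 \<le> poisson (of_real r' * z') z"
    using z r by (auto intro!: less_imp_le poisson_pos simp: norm_mult)
  show ?thesis
  proof (cases "r \<le> r'")
    case True
    from poisson_prod_le_aux[OF z r(1) True r(4)] pos show ?thesis by simp
  next
    case False
    then have "poisson (of_real (r' * r) * z') z \<le> 8 * poisson (of_real r' * z') z"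
      using z r by (intro poisson_prod_le_aux) auto
    moreover have "poisson (of_real (r * r') * z) z' = poisson (of_real (r' * r) * z') z"
      using poisson_commute[OF z, of "r * r'"] by (simp add: mult.commute)
    ultimately show ?thesis using pos by simp
  qed
qed

text \<open>A uniform bound for radii away from 1; it supplies the crude constant \<open>B\<close>
  of the operator bound.\<close>

lemma poisson_le:
  assumes "norm w = 1" "norm a \<le> \<rho>" "\<rho> < 1"
  shows "poisson a w \<le> 1 / (1 - \<rho>)\<^sup>2"
  unfolding poisson_def
proof (rule frac_le)
  have "1 - norm a \<le> norm (1 - cnj a * w)"
    using norm_triangle_ineq2[of 1 "cnj a * w"] assms by (simp add: norm_mult)
  then show "(1 - \<rho>)\<^sup>2 \<le> (norm (1 - cnj a * w))\<^sup>2"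
    using assms by (intro power_mono) auto
qed (use assms in auto)

lemma nn_integral_circle: "(\<integral>\<^sup>+z. f z \<partial>circle) = (\<integral>\<^sup>+z. f z \<partial>circle0)"
  by (simp add: circle_eq nn_integral_completion)

lemma nn_integral_circle_continuous:
  fixes f :: "complex \<Rightarrow> real"
  assumes "continuous_on (sphere 0 1) f" "\<And>z. norm z = 1 \<Longrightarrow> 0 \<le> f z"
  shows "(\<integral>\<^sup>+z. ennreal (f z) \<partial>circle) = ennreal (\<integral>z. f z \<partial>circle)"
  using assms by (intro nn_integral_eq_integral integrable_circle_continuous) auto

lemma poisson_measurable [measurable]: "case_prod poisson \<in> borel_measurable (borel \<Otimes>\<^sub>M borel)"
proof -
  have [measurable]: "cnj \<in> borel_measurable borel"
    by (intro borel_measurable_continuous_onI continuous_intros)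
  show ?thesis unfolding poisson_def by measurable
qed

lemma id_circle0_measurable [measurable]: "(\<lambda>z. z) \<in> borel_measurable circle0"
  by (intro continuous_measurable_circle0 continuous_intros)

text \<open>The linearised maximal operator: the radius is a function of the point. The semigroup
  law and the product estimate make its kernel almost reproducing with \<open>c = 8\<close>, and
  \<open>257 = 4 * 8 * 8 + 1\<close>. The bound \<open>\<rho>\<close> keeps the kernel bounded
  without entering the constant.\<close>

lemma poisson_selection_L2_bound:
  fixes r :: "complex \<Rightarrow> real" and G :: "complex \<Rightarrow> ennreal"
  assumes r[measurable]: "r \<in> borel_measurable circle0"
    and r0: "\<And>z. norm z = 1 \<Longrightarrow> 0 \<le> r z \<and> r z \<le> \<rho>" and \<rho>: "\<rho> < 1"
    and G[measurable]: "G \<in> borel_measurable circle0"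
  shows "(\<integral>\<^sup>+z. (\<integral>\<^sup>+w. ennreal (poisson (of_real (r z) * z) w / (2 * pi)) * G w \<partial>circle)\<^sup>2 \<partial>circle)
            \<le> 257 * (\<integral>\<^sup>+z. (G z)\<^sup>2 \<partial>circle)"
proof -
  define k where "k z w = ennreal (poisson (of_real (r z) * z) w / (2 * pi))" for z w
  have nr: "norm (of_real (r z) * z) = r z" "r z < 1" if "norm z = 1" for z
    using r0[OF that] \<rho> that by (auto simp: norm_mult)
  have pos: "0 \<le> poisson (of_real (r z) * z) w" if "norm z = 1" "norm w = 1" for z w
    using nr[OF that(1)] that by (intro less_imp_le poisson_pos) auto
  have "(\<integral>\<^sup>+z. (\<integral>\<^sup>+w. k z w * G w \<partial>circle0)\<^sup>2 \<partial>circle0) \<le> ennreal (4 * 8\<^sup>2 + 1) * (\<integral>\<^sup>+z. (G z)\<^sup>2 \<partial>circle0)"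
  proof (rule kernel_operator_L2_bound[where k=k and T="\<lambda>G z. \<integral>\<^sup>+w. k z w * G w \<partial>circle0" and B="1 / (1 - \<rho>)\<^sup>2 / (2 * pi)"])
    show "case_prod k \<in> borel_measurable (circle0 \<Otimes>\<^sub>M circle0)" unfolding k_def by measurable
    show "k z w \<le> ennreal (1 / (1 - \<rho>)\<^sup>2 / (2 * pi))" if "z \<in> space circle0" "w \<in> space circle0" for z w
      unfolding k_def using that nr[of z] r0[of z] \<rho>
      by (intro ennreal_leI divide_right_mono poisson_le) auto
    show "(\<integral>\<^sup>+w. k z w * k z' w \<partial>circle0) \<le> ennreal 8 * (k z z' + k z' z)"
      if "z \<in> space circle0" "z' \<in> space circle0" for z z'
    proof -
      have z: "norm z = 1" "norm z' = 1" using that by auto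
      have rz: "0 \<le> r z" "r z < 1" "0 \<le> r z'" "r z' < 1" using nr z r0[of z] r0[of z'] by auto
      let ?p = "\<lambda>w. poisson (of_real (r z) * z) w * poisson (of_real (r z') * z') w"
      have "(\<integral>\<^sup>+w. k z w * k z' w \<partial>circle0) = (\<integral>\<^sup>+w. ennreal (?p w / (4 * pi\<^sup>2)) \<partial>circle)"
        unfolding nn_integral_circle k_def
      proof (intro nn_integral_cong)
        fix w assume "w \<in> space circle0"
        then have "0 \<le> poisson (of_real (r z) * z) w" "0 \<le> poisson (of_real (r z') * z') w"
          using z by (auto intro!: pos)
        then show "ennreal (poisson (of_real (r z) * z) w / (2 * pi)) * ennreal (poisson (of_real (r z') * z') w / (2 * pi)) = ennreal (?p w / (4 * pi\<^sup>2))"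
          by (simp add: ennreal_mult[symmetric] power2_eq_square)
      qed
      also have "\<dots> = ennreal (\<integral>w. ?p w / (4 * pi\<^sup>2) \<partial>circle)"
        using z nr by (intro nn_integral_circle_continuous continuous_intros continuous_poisson)
           (auto intro!: divide_nonneg_nonneg mult_nonneg_nonneg pos)
      also have "(\<integral>w. ?p w / (4 * pi\<^sup>2) \<partial>circle) = poisson (of_real (r z * r z') * z) z' / (2 * pi)"
        using poisson_semigroup[OF z rz] by (simp add: power2_eq_square)
      also have "\<dots> \<le> 8 * (poisson (of_real (r z) * z) z' / (2 * pi) + poisson (of_real (r z') * z') z / (2 * pi))"
        using poisson_prod_le[OF z rz] by (simp add: field_simps)
      also have "ennreal \<dots> = ennreal 8 * (k z z' + k z' z)"
      proof -
        have "ennreal (8 * (x + y)) = ennreal 8 * (ennreal x + ennreal y)" if "0 \<le> x" "0 \<le> y" for x y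
          using that by (simp only: ennreal_mult ennreal_plus add_nonneg_nonneg zero_le_numeral)
        then show ?thesis unfolding k_def using z pos by (simp only: divide_nonneg_nonneg pi_ge_zero mult_nonneg_nonneg zero_le_numeral)
      qed
      finally show ?thesis by (simp add: ennreal_leI)
    qed
  qed (auto simp: finite_measure_circle0)
  then show ?thesis unfolding k_def nn_integral_circle by simp
qed

lemma H2_radial_selection_bound:
  fixes f :: "complex \<Rightarrow> complex"
  assumes f: "f holomorphic_on ball 0 1"
    and C: "\<And>r. 0 < r \<Longrightarrow> r < 1 \<Longrightarrow> (\<integral>\<^sup>+z. ennreal ((norm (f (of_real r * z)))\<^sup>2) \<partial>circle) \<le> C"
    and r[measurable]: "r \<in> borel_measurable circle0"
    and r0: "\<And>z. norm z = 1 \<Longrightarrow> 0 < r z \<and> r z \<le> \<rho>" and \<rho>: "\<rho> < 1"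
  shows "(\<integral>\<^sup>+z. ennreal ((norm (f (of_real (r z) * z)))\<^sup>2) \<partial>circle) \<le> 257 * C"
proof -
  \<comment> \<open>The dilation by \<open>s\<close> is holomorphic past the closed disk, and
    relative to it the selected radius is \<open>r z / s\<close>, still bounded away from 1. The
    \<open>max 0\<close> makes \<open>s\<close> positive.\<close>
  define s where "s = (1 + max 0 \<rho>) / 2"
  have s: "0 < s" "s < 1" "\<rho> < s" using \<rho> by (auto simp: s_def)
  define F where "F z = f (of_real s * z)" for z
  have F: "F holomorphic_on ball 0 (1 / s)"
    unfolding F_def
    by (rule holomorphic_on_compose_gen[OF _ f, unfolded o_def])
       (use s in \<open>auto intro!: holomorphic_intros simp: norm_mult field_simps\<close>)
  have contF: "continuous_on (sphere 0 1) F"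
    unfolding F_def using taylor_on_circle(3)[OF f, of s] s by simp
  define G where "G z = ennreal (norm (F z))" for z
  have [measurable]: "G \<in> borel_measurable circle0"
    unfolding G_def using continuous_measurable_circle0[OF contF] by measurable
  have q: "norm (of_real (r z / s) * z) = r z / s" "r z / s \<le> \<rho> / s" "0 \<le> r z / s" "\<rho> / s < 1" "r z / s < 1"
    if "norm z = 1" for z
    using r0[OF that] s that by (auto simp: norm_mult norm_divide divide_right_mono)
  have dom: "ennreal (norm (f (of_real (r z) * z))) \<le>
      (\<integral>\<^sup>+w. ennreal (poisson (of_real (r z / s) * z) w / (2 * pi)) * G w \<partial>circle)"
    if z: "norm z = 1" for z
  proof -
    define a where "a = of_real (r z / s) * z"
    have a: "norm a < 1" using q[OF z] by (simp add: a_def)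
    have 1: "1 < 1 / s" using s by simp
    have fa: "f (of_real (r z) * z) = F a" using s by (simp add: F_def a_def)
    have "2 * pi * norm (F a) = norm (2 * pi * F a)" by (simp add: norm_mult)
    also have "\<dots> = norm (\<integral>w. F w * of_real (poisson a w) \<partial>circle)"
      by (simp only: poisson_circle[OF F 1 a])
    also have "\<dots> \<le> (\<integral>w. norm (F w * of_real (poisson a w)) \<partial>circle)" by (rule integral_norm_bound)
    also have "\<dots> = (\<integral>w. norm (F w) * poisson a w \<partial>circle)"
      using poisson_pos[OF a] by (intro Bochner_Integration.integral_cong) (auto simp: norm_mult less_imp_le)
    finally have "norm (F a) \<le> (\<integral>w. norm (F w) * poisson a w \<partial>circle) / (2 * pi)"
      by (simp add: field_simps)
    also have "\<dots> = (\<integral>w. norm (F w) * poisson a w / (2 * pi) \<partial>circle)" by simp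
    also have "ennreal \<dots> = (\<integral>\<^sup>+w. ennreal (norm (F w) * poisson a w / (2 * pi)) \<partial>circle)"
      using a poisson_pos[OF a]
      by (intro nn_integral_circle_continuous[symmetric] continuous_intros continuous_poisson contF)
         (auto simp: less_imp_le)
    also have "\<dots> = (\<integral>\<^sup>+w. ennreal (poisson a w / (2 * pi)) * G w \<partial>circle)"
      using poisson_pos[OF a]
      by (intro nn_integral_cong) (auto simp: G_def ennreal_mult[symmetric] less_imp_le mult_ac)
    finally show ?thesis by (simp add: fa a_def ennreal_leI)
  qed
  have "(\<integral>\<^sup>+z. ennreal ((norm (f (of_real (r z) * z)))\<^sup>2) \<partial>circle) \<le>
     (\<integral>\<^sup>+z. (\<integral>\<^sup>+w. ennreal (poisson (of_real (r z / s) * z) w / (2 * pi)) * G w \<partial>circle)\<^sup>2 \<partial>circle)"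
  proof (rule nn_integral_mono)
    fix z assume "z \<in> space circle"
    then have z: "norm z = 1" by simp
    have "ennreal ((norm (f (of_real (r z) * z)))\<^sup>2) = (ennreal (norm (f (of_real (r z) * z))))\<^sup>2"
      by (simp add: ennreal_power)
    also have "\<dots> \<le> (\<integral>\<^sup>+w. ennreal (poisson (of_real (r z / s) * z) w / (2 * pi)) * G w \<partial>circle)\<^sup>2"
      using dom[OF z] by (intro power_mono) auto
    finally show "ennreal ((norm (f (of_real (r z) * z)))\<^sup>2) \<le>
       (\<integral>\<^sup>+w. ennreal (poisson (of_real (r z / s) * z) w / (2 * pi)) * G w \<partial>circle)\<^sup>2" .
  qed
  also have "\<dots> \<le> 257 * (\<integral>\<^sup>+z. (G z)\<^sup>2 \<partial>circle)"
    by (rule poisson_selection_L2_bound[where \<rho>="\<rho> / s"]) (use q s in \<open>auto simp: divide_less_eq_1\<close>)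
  also have "(\<integral>\<^sup>+z. (G z)\<^sup>2 \<partial>circle) = (\<integral>\<^sup>+z. ennreal ((norm (f (of_real s * z)))\<^sup>2) \<partial>circle)"
    by (simp add: G_def F_def ennreal_power)
  also have "\<dots> \<le> C" by (rule C) (use s in auto)
  finally show ?thesis by (simp add: mult_left_mono)
qed

text \<open>Induction on the finite set: the new radius replaces the current choice where it gives a
  larger value. Measurability of the composed function is carried along because it makes the set of
  replacement measurable.\<close>

lemma radial_selection_exists:
  assumes f: "f holomorphic_on ball 0 1" and R: "finite R" "R \<noteq> {}" "R \<subseteq> {0<..<1}"
  shows "\<exists>r. r \<in> borel_measurable circle0 \<and> (\<lambda>z. f (of_real (r z) * z)) \<in> borel_measurable circle0 \<and>
     (\<forall>z. r z \<in> R) \<and> (\<forall>z \<rho>. norm z = 1 \<longrightarrow> \<rho> \<in> R \<longrightarrow> norm (f (of_real \<rho> * z)) \<le> norm (f (of_real (r z) * z)))"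
  using R
proof (induction R rule: finite_ne_induct)
  case (singleton \<rho>)
  have "(\<lambda>z. f (of_real \<rho> * z)) \<in> borel_measurable circle0"
    using singleton by (intro continuous_measurable_circle0 taylor_on_circle(3)[OF f]) auto
  then show ?case by (intro exI[of _ "\<lambda>_. \<rho>"]) auto
next
  case (insert \<rho> R)
  then have "R \<subseteq> {0<..<1}" by auto
  from insert.IH[OF this] obtain r where r: "r \<in> borel_measurable circle0" "(\<lambda>z. f (of_real (r z) * z)) \<in> borel_measurable circle0"
     "\<And>z. r z \<in> R" "\<And>z \<rho>. norm z = 1 \<Longrightarrow> \<rho> \<in> R \<Longrightarrow> norm (f (of_real \<rho> * z)) \<le> norm (f (of_real (r z) * z))"
    by blast
  have m: "(\<lambda>z. f (of_real \<rho> * z)) \<in> borel_measurable circle0"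
    using insert by (intro continuous_measurable_circle0 taylor_on_circle(3)[OF f]) auto
  note [measurable] = r(1,2) m
  define r' where "r' z = (if norm (f (of_real \<rho> * z)) \<le> norm (f (of_real (r z) * z)) then r z else \<rho>)" for z
  have eq: "(\<lambda>z. f (of_real (r' z) * z)) =
    (\<lambda>z. if norm (f (of_real \<rho> * z)) \<le> norm (f (of_real (r z) * z)) then f (of_real (r z) * z) else f (of_real \<rho> * z))"
    by (auto simp: r'_def)
  show ?case
  proof (intro exI[of _ r'] conjI allI impI)
    show "r' \<in> borel_measurable circle0" unfolding r'_def by measurable
    show "(\<lambda>z. f (of_real (r' z) * z)) \<in> borel_measurable circle0" unfolding eq by measurable
    show "r' z \<in> insert \<rho> R" for z using r(3) by (auto simp: r'_def)
    show "norm (f (of_real \<rho>' * z)) \<le> norm (f (of_real (r' z) * z))" if "norm z = 1" "\<rho>' \<in> insert \<rho> R" for z \<rho>'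
      using r(4)[of z \<rho>'] that by (auto simp: r'_def)
  qed
qed

text \<open>The supremum over rational radii is an increasing limit of finite suprema. Each of these
  is realised by a measurable selection and so obeys one and the same bound. Continuity inside the
  disk extends the domination to all radii.\<close>

theorem radial_maximal_function:
  fixes f :: "complex \<Rightarrow> complex"
  assumes f: "f holomorphic_on ball 0 1"
    and C: "\<And>r. 0 < r \<Longrightarrow> r < 1 \<Longrightarrow> (\<integral>\<^sup>+z. ennreal ((norm (f (of_real r * z)))\<^sup>2) \<partial>circle) \<le> C"
  obtains M where "M \<in> borel_measurable circle" "(\<integral>\<^sup>+z. M z \<partial>circle) \<le> 257 * C"
    "\<And>r z. norm z = 1 \<Longrightarrow> 0 < r \<Longrightarrow> r < 1 \<Longrightarrow> ennreal ((norm (f (of_real r * z)))\<^sup>2) \<le> M z"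
proof -
  define D :: "real set" where "D = \<rat> \<inter> {0<..<1}"
  have D: "countable D" "D \<noteq> {}"
    using Rats_dense_in_real[of 0 1] by (auto simp: D_def intro: countable_rat countable_subset)
  define e where "e = from_nat_into D"
  have e: "e n \<in> D" "range e = D" for n
    using D by (auto simp: e_def from_nat_into range_from_nat_into)
  have e01: "0 < e n" "e n < 1" for n using e(1)[of n] by (auto simp: D_def)
  define F where "F n z = ennreal ((norm (f (of_real (e n) * z)))\<^sup>2)" for n z
  have Fm[measurable]: "F n \<in> borel_measurable circle" for n
  proof -
    have [measurable]: "(\<lambda>z. f (of_real (e n) * z)) \<in> borel_measurable circle"
      using e01[of n] by (intro continuous_measurable_circle taylor_on_circle(3)[OF f]) auto
    show ?thesis unfolding F_def by measurable
  qed
  define P where "P n z = (SUP i\<in>{..n}. F i z)" for n z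
  have Pm[measurable]: "P n \<in> borel_measurable circle" for n
    unfolding P_def by measurable
  define M where "M z = (SUP n. P n z)" for z
  have Pint: "(\<integral>\<^sup>+z. P n z \<partial>circle) \<le> 257 * C" for n
  proof -
    have "finite (e ` {..n})" "e ` {..n} \<noteq> {}" "e ` {..n} \<subseteq> {0<..<1}" using e01 by auto
    from radial_selection_exists[OF f this] obtain r where
      r: "r \<in> borel_measurable circle0" "\<And>z. r z \<in> e ` {..n}"
         "\<And>z \<rho>. norm z = 1 \<Longrightarrow> \<rho> \<in> e ` {..n} \<Longrightarrow> norm (f (of_real \<rho> * z)) \<le> norm (f (of_real (r z) * z))"
      by blast
    define \<rho> where "\<rho> = Max (e ` {..n})"
    have \<rho>: "r z \<le> \<rho>" "0 < r z" for z using r(2)[of z] e01 by (auto simp: \<rho>_def)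
    have \<rho>1: "\<rho> < 1" using e01 by (auto simp: \<rho>_def)
    have "(\<integral>\<^sup>+z. P n z \<partial>circle) \<le> (\<integral>\<^sup>+z. ennreal ((norm (f (of_real (r z) * z)))\<^sup>2) \<partial>circle)"
      unfolding P_def F_def
      by (intro nn_integral_mono SUP_least ennreal_leI power_mono r(3)) auto
    also have "\<dots> \<le> 257 * C"
      by (rule H2_radial_selection_bound[OF f C r(1) _ \<rho>1]) (use \<rho> in auto)
    finally show ?thesis .
  qed
  have "incseq P"
    unfolding P_def incseq_def le_fun_def by (auto intro!: SUP_subset_mono)
  then have "(\<integral>\<^sup>+z. M z \<partial>circle) = (SUP n. \<integral>\<^sup>+z. P n z \<partial>circle)"
    unfolding M_def by (intro nn_integral_monotone_convergence_SUP) auto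
  also have "\<dots> \<le> 257 * C" by (intro SUP_least Pint)
  finally have int: "(\<integral>\<^sup>+z. M z \<partial>circle) \<le> 257 * C" .
  have dom: "ennreal ((norm (f (of_real r * z)))\<^sup>2) \<le> M z" if z: "norm z = 1" and r: "0 < r" "r < 1" for r z
  proof -
    have dD: "ennreal ((norm (f (of_real q * z)))\<^sup>2) \<le> M z" if "q \<in> D" for q
    proof -
      from that e(2) obtain n where n: "q = e n" by auto
      have "F n z \<le> P n z" unfolding P_def by (intro SUP_upper) auto
      also have "P n z \<le> M z" unfolding M_def by (intro SUP_upper) auto
      finally show ?thesis by (simp add: F_def n)
    qed
    \<comment> \<open>The rational radii approach \<open>r\<close> from below, which keeps them
      inside the unit interval.\<close>
    have "\<forall>n. \<exists>q. q \<in> D \<and> dist q r < 1 / real (Suc n)"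
    proof
      fix n
      obtain q where "q \<in> \<rat>" "max 0 (r - 1 / real (Suc n)) < q" "q < r"
        using Rats_dense_in_real[of "max 0 (r - 1 / real (Suc n))" r] r by auto
      then show "\<exists>q. q \<in> D \<and> dist q r < 1 / real (Suc n)"
        using r by (intro exI[of _ q]) (auto simp: D_def dist_real_def)
    qed
    from choice[OF this] obtain q where q: "\<And>n. q n \<in> D" "\<And>n. dist (q n) r < 1 / real (Suc n)"
      by blast
    have "q \<longlonglongrightarrow> r"
    proof (subst tendsto_dist_iff, rule tendsto_sandwich[where f="\<lambda>_. 0"])
      show "(\<lambda>n. 1 / real (Suc n)) \<longlonglongrightarrow> 0" by (rule LIMSEQ_Suc[OF lim_1_over_n])
      show "\<forall>\<^sub>F n in sequentially. dist (q n) r \<le> 1 / real (Suc n)"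
        using q(2) by (intro always_eventually allI less_imp_le)
    qed simp_all
    then have "(\<lambda>n. of_real (q n) * z) \<longlonglongrightarrow> of_real r * z" by (intro tendsto_intros)
    moreover have "of_real r * z \<in> ball 0 1" using z r by (simp add: norm_mult)
    then have "isCont f (of_real r * z)"
      using holomorphic_on_imp_continuous_on[OF f] continuous_on_eq_continuous_at[OF open_ball] by blast
    ultimately have "(\<lambda>n. f (of_real (q n) * z)) \<longlonglongrightarrow> f (of_real r * z)"
      by (rule isCont_tendsto_compose[rotated])
    then have "(\<lambda>n. ennreal ((norm (f (of_real (q n) * z)))\<^sup>2)) \<longlonglongrightarrow> ennreal ((norm (f (of_real r * z)))\<^sup>2)"
      by (intro tendsto_intros tendsto_ennrealI)
    then show ?thesis
      by (rule LIMSEQ_le_const2) (use dD q(1) in auto)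
  qed
  have "M \<in> borel_measurable circle" unfolding M_def by measurable
  from that[OF this int dom] show thesis .
qed

section \<open>Radial limits\<close>

text \<open>The offset 2 keeps every radius strictly between 0 and 1. The sequence turns radial
  limits into sequential ones, as measurability and dominated convergence require.\<close>

definition radii :: "nat \<Rightarrow> real" where "radii n = 1 - 1 / (real n + 2)"

lemma radii: "0 < radii n" "radii n < 1"
  by (auto simp: radii_def field_simps)

lemma radii_at_left: "filterlim radii (at_left 1) sequentially"
  unfolding filterlim_at
proof
  have "(\<lambda>n. 1 / (real n + 2)) \<longlonglongrightarrow> 0"
    using LIMSEQ_ignore_initial_segment[OF lim_1_over_n, of 2] by (simp add: add.commute)
  from tendsto_diff[OF tendsto_const this, of 1] show "radii \<longlonglongrightarrow> 1"
    unfolding radii_def by simp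
qed (auto simp: radii less_imp_neq intro!: always_eventually)

lemma parseval:
  fixes f :: "complex \<Rightarrow> complex"
  assumes f: "\<And>z. norm z < 1 \<Longrightarrow> (\<lambda>n. a n * z ^ n) sums f z" and r: "0 \<le> r" "r < 1"
  shows "(\<lambda>n. (norm (a n))\<^sup>2 * r ^ (2 * n)) sums ((\<integral>z. (norm (f (of_real r * z)))\<^sup>2 \<partial>circle) / (2 * pi))"
proof -
  have hol: "f holomorphic_on ball 0 1"
    by (rule power_series_holomorphic[of 0 1 a]) (use f in auto)
  define s where "s = (1 + r) / 2"
  have s: "r < s" "s < 1" "0 < s" using r by (auto simp: s_def)
  have "summable (\<lambda>n. a n * (of_real s) ^ n)" using f[of "of_real s"] s by (auto simp: sums_iff)
  from powser_insidea[OF this, of "of_real r"] have sm: "summable (\<lambda>n. norm (a n * of_real r ^ n))"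
    using s r by simp
  have sums: "(\<lambda>n. (a n * of_real r ^ n) * z ^ n) sums f (of_real r * z)" if "norm z = 1" for z
    using f[of "of_real r * z"] that r by (simp add: norm_mult power_mult_distrib mult.assoc)
  have "(\<lambda>n. (a n * of_real r ^ n) * cnj (a n * of_real r ^ n)) sums
          ((\<integral>z. f (of_real r * z) * cnj (f (of_real r * z)) \<partial>circle) / (2 * pi))"
    by (rule integral_circle_inner[OF taylor_on_circle(3)[OF hol r] sm sm sums sums])
  also have "(\<integral>z. f (of_real r * z) * cnj (f (of_real r * z)) \<partial>circle) =
      (\<integral>z. complex_of_real ((norm (f (of_real r * z)))\<^sup>2) \<partial>circle)"
    by (simp only: complex_norm_square)
  also have "\<dots> / (2 * pi) = complex_of_real ((\<integral>z. (norm (f (of_real r * z)))\<^sup>2 \<partial>circle) / (2 * pi))"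
    by (simp only: integral_complex_of_real of_real_divide of_real_mult of_real_numeral)
  also have "(\<lambda>n. (a n * of_real r ^ n) * cnj (a n * of_real r ^ n)) =
     (\<lambda>n. complex_of_real ((norm (a n))\<^sup>2 * r ^ (2 * n)))"
    by (simp only: complex_norm_square[symmetric])
       (simp add: fun_eq_iff norm_mult norm_power power_mult_distrib power_mult[symmetric] mult.commute abs_of_nonneg[OF r(1)])
  finally show ?thesis by (simp only: sums_of_real_iff)
qed

lemma nn_integral_norm_square:
  assumes f: "f holomorphic_on ball 0 1" and r: "0 \<le> r" "r < 1"
  shows "(\<integral>\<^sup>+z. ennreal ((norm (f (of_real r * z)))\<^sup>2) \<partial>circle) = ennreal (\<integral>z. (norm (f (of_real r * z)))\<^sup>2 \<partial>circle)"
  by (intro nn_integral_circle_continuous continuous_intros taylor_on_circle(3)[OF f r]) auto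

text \<open>Taylor polynomials have radial limits everywhere, so only the oscillation of the
  remainders matters. Their maximal functions have integrals tending to 0, which leaves no
  oscillation in almost every direction.\<close>

theorem radial_limit_exists:
  fixes f :: "complex \<Rightarrow> complex" and C :: real
  assumes f: "f holomorphic_on ball 0 1"
    and C: "\<And>r. 0 < r \<Longrightarrow> r < 1 \<Longrightarrow> (\<integral>\<^sup>+z. ennreal ((norm (f (of_real r * z)))\<^sup>2) \<partial>circle) \<le> ennreal C"
  shows "AE z in circle. \<exists>l. ((\<lambda>r. f (of_real r * z)) \<longlongrightarrow> l) (at_left 1)"
proof -
  define a where "a n = (deriv ^^ n) f 0 / fact n" for n
  have sums: "(\<lambda>n. a n * z ^ n) sums f z" if "norm z < 1" for z
    using holomorphic_power_series[OF f, of z] that by (simp add: a_def)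
  \<comment> \<open>\<open>ennreal C\<close> is 0 for negative \<open>C\<close>, hence the absolute
    value.\<close>
  have I: "(\<integral>z. (norm (f (of_real r * z)))\<^sup>2 \<partial>circle) \<le> \<bar>C\<bar>" if "0 < r" "r < 1" for r
    using C[OF that] nn_integral_norm_square[OF f, of r] that by (simp add: ennreal_le_iff2) argo
  \<comment> \<open>In a finite sum the radius may tend to 1 in Parseval's identity. This makes the
    squared coefficients summable, so that their tails \<open>\<epsilon> N\<close> tend to
    0.\<close>
  have partial: "(\<Sum>n<N. (norm (a n))\<^sup>2) \<le> \<bar>C\<bar> / (2 * pi)" for N
  proof (rule tendsto_upperbound)
    have "(radii \<longlongrightarrow> 1) sequentially" using radii_at_left by (simp add: filterlim_at)
    then have "(\<lambda>k. \<Sum>n<N. (norm (a n))\<^sup>2 * radii k ^ (2 * n)) \<longlonglongrightarrow> (\<Sum>n<N. (norm (a n))\<^sup>2 * 1 ^ (2 * n))"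
      by (intro tendsto_intros)
    then show "(\<lambda>k. \<Sum>n<N. (norm (a n))\<^sup>2 * radii k ^ (2 * n)) \<longlonglongrightarrow> (\<Sum>n<N. (norm (a n))\<^sup>2)" by simp
    show "\<forall>\<^sub>F k in sequentially. (\<Sum>n<N. (norm (a n))\<^sup>2 * radii k ^ (2 * n)) \<le> \<bar>C\<bar> / (2 * pi)"
    proof (intro always_eventually allI)
      fix k
      have p: "(\<lambda>n. (norm (a n))\<^sup>2 * radii k ^ (2 * n)) sums ((\<integral>z. (norm (f (of_real (radii k) * z)))\<^sup>2 \<partial>circle) / (2 * pi))"
        by (rule parseval[OF sums]) (use radii[of k] in auto)
      have "(\<Sum>n<N. (norm (a n))\<^sup>2 * radii k ^ (2 * n)) \<le> (\<Sum>n. (norm (a n))\<^sup>2 * radii k ^ (2 * n))"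
        using p radii[of k] by (intro sum_le_suminf) (auto simp: sums_iff)
      also have "\<dots> \<le> \<bar>C\<bar> / (2 * pi)"
        using p I[of "radii k"] radii[of k] by (auto simp: sums_iff intro!: divide_right_mono)
      finally show "(\<Sum>n<N. (norm (a n))\<^sup>2 * radii k ^ (2 * n)) \<le> \<bar>C\<bar> / (2 * pi)" .
    qed
  qed simp
  have summ: "summable (\<lambda>n. (norm (a n))\<^sup>2)"
    by (rule summableI_nonneg_bounded[OF _ partial]) simp
  define \<epsilon> where "\<epsilon> N = (\<Sum>n. (norm (a n))\<^sup>2) - (\<Sum>n<N. (norm (a n))\<^sup>2)" for N
  have \<epsilon>: "\<epsilon> \<longlonglongrightarrow> 0"
    using tendsto_diff[OF tendsto_const summable_LIMSEQ[OF summ], of "\<Sum>n. (norm (a n))\<^sup>2"] by (simp add: \<epsilon>_def[abs_def])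
  define p where "p N z = (\<Sum>n<N. a n * z ^ n)" for N z
  define q where "q N z = f z - p N z" for N z
  have qsums: "(\<lambda>n. (if n < N then 0 else a n) * z ^ n) sums q N z" if "norm z < 1" for N z
  proof -
    have "(\<lambda>n. a n * z ^ n - (if n \<in> {..<N} then a n * z ^ n else 0)) sums (f z - (\<Sum>n\<in>{..<N}. a n * z ^ n))"
      by (intro sums_diff sums that sums_If_finite_set) simp
    also have "(\<lambda>n. a n * z ^ n - (if n \<in> {..<N} then a n * z ^ n else 0)) = (\<lambda>n. (if n < N then 0 else a n) * z ^ n)"
      by auto
    finally show ?thesis by (simp add: q_def p_def)
  qed
  have qhol: "q N holomorphic_on ball 0 1" for N
    unfolding q_def p_def by (intro holomorphic_intros f)
  have qint: "(\<integral>\<^sup>+z. ennreal ((norm (q N (of_real r * z)))\<^sup>2) \<partial>circle) \<le> ennreal (2 * pi * \<epsilon> N)" if r: "0 < r" "r < 1" for N r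
  proof -
    have s1: "(\<lambda>n. (norm (a n))\<^sup>2 - (if n \<in> {..<N} then (norm (a n))\<^sup>2 else 0)) sums \<epsilon> N"
      unfolding \<epsilon>_def by (intro sums_diff summable_sums[OF summ] sums_If_finite_set) simp
    have s2: "(\<lambda>n. (norm (if n < N then 0 else a n))\<^sup>2 * r ^ (2 * n)) sums ((\<integral>z. (norm (q N (of_real r * z)))\<^sup>2 \<partial>circle) / (2 * pi))"
      by (rule parseval[OF qsums]) (use r in auto)
    have "(norm (if n < N then 0 else a n))\<^sup>2 * r ^ (2 * n) \<le> (norm (a n))\<^sup>2 - (if n \<in> {..<N} then (norm (a n))\<^sup>2 else 0)" for n
      using r by (auto intro!: mult_left_le power_le_one)
    then have "(\<integral>z. (norm (q N (of_real r * z)))\<^sup>2 \<partial>circle) / (2 * pi) \<le> \<epsilon> N"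
      by (rule sums_le[OF _ s2 s1])
    then have "(\<integral>z. (norm (q N (of_real r * z)))\<^sup>2 \<partial>circle) \<le> 2 * pi * \<epsilon> N" by (simp add: field_simps)
    then show ?thesis using nn_integral_norm_square[OF qhol] r by (simp add: ennreal_leI)
  qed
  have "\<exists>M. M \<in> borel_measurable circle \<and> (\<integral>\<^sup>+z. M z \<partial>circle) \<le> 257 * ennreal (2 * pi * \<epsilon> N) \<and>
    (\<forall>r z. norm z = 1 \<longrightarrow> 0 < r \<longrightarrow> r < 1 \<longrightarrow> ennreal ((norm (q N (of_real r * z)))\<^sup>2) \<le> M z)" for N
    by (rule radial_maximal_function[OF qhol qint, of N]) auto
  then obtain M where M: "\<And>N. M N \<in> borel_measurable circle" "\<And>N. (\<integral>\<^sup>+z. M N z \<partial>circle) \<le> 257 * ennreal (2 * pi * \<epsilon> N)"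
    "\<And>N r z. norm z = 1 \<Longrightarrow> 0 < r \<Longrightarrow> r < 1 \<Longrightarrow> ennreal ((norm (q N (of_real r * z)))\<^sup>2) \<le> M N z"
    by metis
  note [measurable] = M(1)
  \<comment> \<open>The infimum over \<open>N\<close> has integral 0. Hence at almost every point
    some remainder is as small as desired along the whole radius.\<close>
  have "(\<integral>\<^sup>+z. (INF N. M N z) \<partial>circle) \<le> 257 * ennreal (2 * pi * \<epsilon> N)" for N
    by (rule order.trans[OF nn_integral_mono M(2)]) (auto intro: INF_lower)
  moreover have "(\<lambda>N. 257 * ennreal (2 * pi * \<epsilon> N)) \<longlonglongrightarrow> 257 * ennreal (2 * pi * 0)"
    by (intro tendsto_intros tendsto_ennrealI ennreal_tendsto_cmult \<epsilon>) auto
  ultimately have "(\<integral>\<^sup>+z. (INF N. M N z) \<partial>circle) \<le> 257 * ennreal (2 * pi * 0)"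
    by (intro LIMSEQ_le_const) auto
  then have "(\<integral>\<^sup>+z. (INF N. M N z) \<partial>circle) = 0" by simp
  then have "AE z in circle. (INF N. M N z) = 0"
    by (subst (asm) nn_integral_0_iff_AE) auto
  moreover have "AE z in circle. norm z = 1" by (rule AE_I2) simp
  ultimately show ?thesis
  proof eventually_elim
    case (elim z)
    have near: "\<exists>c. eventually (\<lambda>r. norm (f (of_real r * z) - c) < e) (at_left 1)" if e: "0 < e" for e
    proof -
      have "(INF N. M N z) < ennreal ((e/2)\<^sup>2)" using elim e by simp
      then obtain N where "M N z < ennreal ((e/2)\<^sup>2)" by (auto simp: INF_less_iff)
      then have qe: "norm (q N (of_real r * z)) < e/2" if "0 < r" "r < 1" for r
      proof -
        have "ennreal ((norm (q N (of_real r * z)))\<^sup>2) < ennreal ((e/2)\<^sup>2)"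
          using M(3)[of z r N] elim that \<open>M N z < _\<close> by (auto intro: le_less_trans)
        then have "(norm (q N (of_real r * z)))\<^sup>2 < (e/2)\<^sup>2" by (simp add: ennreal_less_iff)
        then show ?thesis using e by (intro power2_less_imp_less[of _ "e/2"]) auto
      qed
      have "((\<lambda>r. p N (of_real r * z)) \<longlongrightarrow> p N (of_real 1 * z)) (at_left 1)"
        unfolding p_def by (intro tendsto_intros)
      then have "eventually (\<lambda>r. dist (p N (of_real r * z)) (p N (of_real 1 * z)) < e/2) (at_left 1)"
        using e by (intro tendstoD) auto
      moreover have "eventually (\<lambda>r::real. r \<in> {0<..<1}) (at_left 1)"
        by (rule eventually_at_left_real) simp
      ultimately have "eventually (\<lambda>r. norm (f (of_real r * z) - p N (of_real 1 * z)) < e) (at_left 1)"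
      proof eventually_elim
        case (elim r)
        then have "norm (q N (of_real r * z)) < e/2" by (intro qe) auto
        moreover have "f (of_real r * z) - p N (of_real 1 * z) = q N (of_real r * z) + (p N (of_real r * z) - p N (of_real 1 * z))"
          by (simp add: q_def)
        then have "norm (f (of_real r * z) - p N (of_real 1 * z)) \<le>
            norm (q N (of_real r * z)) + norm (p N (of_real r * z) - p N (of_real 1 * z))"
          by (simp only: norm_triangle_ineq)
        ultimately show ?case using elim(1) unfolding dist_norm by linarith
      qed
      then show ?thesis by blast
    qed
    \<comment> \<open>Being eventually within any given distance of some constant is the Cauchy
      criterion for the filter of radii tending to 1.\<close>
    have "cauchy_filter (filtermap (\<lambda>r. f (of_real r * z)) (at_left 1))"
      unfolding cauchy_filter_metric_filtermap
    proof safe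
      fix e :: real assume "0 < e"
      then obtain c where c: "eventually (\<lambda>r. norm (f (of_real r * z) - c) < e/2) (at_left 1)"
        using near[of "e/2"] by auto
      show "\<exists>P. eventually P (at_left 1) \<and> (\<forall>x y. P x \<and> P y \<longrightarrow> dist (f (of_real x * z)) (f (of_real y * z)) < e)"
        by (intro exI[of _ "\<lambda>r. norm (f (of_real r * z) - c) < e/2"] conjI c)
           (auto simp: dist_norm[symmetric] intro: dist_triangle_half_l)
    qed
    then have "\<exists>l. filtermap (\<lambda>r. f (of_real r * z)) (at_left 1) \<le> nhds l"
      by (rule cauchy_filter_complete_converges[OF _ complete_UNIV]) (simp_all add: filtermap_bot_iff)
    then show ?case by (auto simp: filterlim_def)
  qed
qed

section \<open>Integrable majorants and boundary functions in the Hardy space\<close>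

lemma H2_disk_dominated:
  assumes "H2_disk f F"
  obtains W where "integrable circle W" "\<And>z. 0 \<le> W z"
    "AE z in circle. \<forall>r. 0 < r \<longrightarrow> r < 1 \<longrightarrow> (norm (f (of_real r * z)))\<^sup>2 \<le> W z"
proof -
  from assms obtain C :: real where f: "f holomorphic_on ball 0 1" and
    C: "\<And>r. 0 < r \<Longrightarrow> r < 1 \<Longrightarrow> (\<integral>\<^sup>+ z. ennreal ((norm (f (complex_of_real r * z)))\<^sup>2) \<partial>circle) \<le> ennreal C"
    unfolding H2_disk_def by blast
  obtain M where M[measurable]: "M \<in> borel_measurable circle" and Mint: "(\<integral>\<^sup>+z. M z \<partial>circle) \<le> 257 * ennreal C"
    and dom: "\<And>r z. norm z = 1 \<Longrightarrow> 0 < r \<Longrightarrow> r < 1 \<Longrightarrow> ennreal ((norm (f (of_real r * z)))\<^sup>2) \<le> M z"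
    using radial_maximal_function[OF f C] by blast
  have "257 * ennreal C < \<infinity>" by (simp add: ennreal_mult_less_top)
  with Mint have fin: "(\<integral>\<^sup>+z. M z \<partial>circle) < \<infinity>" by (rule le_less_trans)
  then have "(\<integral>\<^sup>+z. M z \<partial>circle) \<noteq> \<infinity>" by simp
  \<comment> \<open>A finite integral allows the value infinity only on a null set. There
    \<open>enn2real\<close> drops to 0, which is why the domination is asserted almost
    everywhere.\<close>
  from nn_integral_PInf_AE[OF M this] have ae: "AE z in circle. M z \<noteq> \<infinity>" .
  show thesis
  proof (rule that[of "\<lambda>z. enn2real (M z)"])
    have "(\<integral>\<^sup>+z. ennreal (enn2real (M z)) \<partial>circle) = (\<integral>\<^sup>+z. M z \<partial>circle)"
      using ae by (intro nn_integral_cong_AE) (auto elim!: eventually_mono simp: less_top)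
    with fin show "integrable circle (\<lambda>z. enn2real (M z))"
      by (intro integrableI_nonneg) auto
    show "AE z in circle. \<forall>r. 0 < r \<longrightarrow> r < 1 \<longrightarrow> (norm (f (of_real r * z)))\<^sup>2 \<le> enn2real (M z)"
      using ae AE_space
    proof eventually_elim
      case (elim z)
      show ?case
      proof (intro allI impI)
        fix r :: real assume "0 < r" "r < 1"
        then have "ennreal ((norm (f (of_real r * z)))\<^sup>2) \<le> M z" using elim dom by simp
        then have "enn2real (ennreal ((norm (f (of_real r * z)))\<^sup>2)) \<le> enn2real (M z)"
          using elim by (intro enn2real_mono) (auto simp: less_top)
        then show "(norm (f (of_real r * z)))\<^sup>2 \<le> enn2real (M z)" by simp
      qed
    qed
  qed simp
qed

lemma H2_disk_radii:
  assumes "inner_radial_limit f F"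
  shows "AE z in circle. (\<lambda>n. f (of_real (radii n) * z)) \<longlonglongrightarrow> F z"
  using assms unfolding inner_radial_limit_def
  by eventually_elim (rule filterlim_compose[OF _ radii_at_left])

lemma holomorphic_radii_measurable:
  assumes "f holomorphic_on ball 0 1"
  shows "(\<lambda>z. f (of_real (radii n) * z)) \<in> borel_measurable circle"
  using radii[of n] by (intro continuous_measurable_circle taylor_on_circle(3)[OF assms]) auto

text \<open>Square integrability of the boundary function follows from the bound on circle means by
  Fatou's lemma along \<open>radii\<close>.\<close>

lemma H2_diskI:
  assumes f: "f holomorphic_on ball 0 1"
    and C: "\<And>r. 0 < r \<Longrightarrow> r < 1 \<Longrightarrow> (\<integral>\<^sup>+ z. ennreal ((norm (f (complex_of_real r * z)))\<^sup>2) \<partial>circle) \<le> ennreal C"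
    and F[measurable]: "F \<in> borel_measurable circle" and lim: "inner_radial_limit f F"
  shows "H2_disk f F"
proof -
  note [measurable] = holomorphic_radii_measurable[OF f]
  have "(\<integral>\<^sup>+z. ennreal ((norm (F z))\<^sup>2) \<partial>circle) = (\<integral>\<^sup>+z. liminf (\<lambda>n. ennreal ((norm (f (of_real (radii n) * z)))\<^sup>2)) \<partial>circle)"
  proof (rule nn_integral_cong_AE)
    show "AE z in circle. ennreal ((norm (F z))\<^sup>2) = liminf (\<lambda>n. ennreal ((norm (f (of_real (radii n) * z)))\<^sup>2))"
      using H2_disk_radii[OF lim]
    proof eventually_elim
      case (elim z)
      then have "(\<lambda>n. ennreal ((norm (f (of_real (radii n) * z)))\<^sup>2)) \<longlonglongrightarrow> ennreal ((norm (F z))\<^sup>2)"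
        by (intro tendsto_intros tendsto_ennrealI)
      then show ?case using lim_imp_Liminf[OF sequentially_bot] by metis
    qed
  qed
  also have "\<dots> \<le> liminf (\<lambda>n. \<integral>\<^sup>+z. ennreal ((norm (f (of_real (radii n) * z)))\<^sup>2) \<partial>circle)"
    by (rule nn_integral_liminf) measurable
  also have "\<dots> \<le> liminf (\<lambda>n. ennreal C)"
    by (intro Liminf_mono always_eventually allI C radii)
  also have "\<dots> = ennreal C" by (simp add: Liminf_const)
  finally have "(\<integral>\<^sup>+z. ennreal ((norm (F z))\<^sup>2) \<partial>circle) < \<infinity>"
    using le_less_trans[OF _ ennreal_less_top] by auto
  then have "integrable circle (\<lambda>z. (norm (F z))\<^sup>2)"
    by (intro integrableI_nonneg) auto
  then show ?thesis
    unfolding H2_disk_def L2_circle_def using f C lim F by blast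
qed

text \<open>The boundary function is defined along a sequence, since a sequential limit of
  measurable functions is measurable; existence of the full radial limit then identifies the two.
  Where the sequence diverges, \<open>lim\<close> has an arbitrary value.\<close>

lemma H2_disk_boundary_exists:
  assumes f: "f holomorphic_on ball 0 1"
    and C: "\<And>r. 0 < r \<Longrightarrow> r < 1 \<Longrightarrow> (\<integral>\<^sup>+ z. ennreal ((norm (f (complex_of_real r * z)))\<^sup>2) \<partial>circle) \<le> ennreal C"
  shows "\<exists>F. H2_disk f F"
proof -
  define F where "F z = lim (\<lambda>n. f (of_real (radii n) * z))" for z
  have "F \<in> borel_measurable circle"
    unfolding F_def by (intro borel_measurable_lim_metric holomorphic_radii_measurable f)
  moreover have "AE z in circle. \<exists>l. ((\<lambda>r. f (of_real r * z)) \<longlongrightarrow> l) (at_left 1)"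
    by (rule radial_limit_exists[OF f C])
  then have "inner_radial_limit f F"
    unfolding inner_radial_limit_def
  proof eventually_elim
    case (elim z)
    then obtain l where l: "((\<lambda>r. f (of_real r * z)) \<longlongrightarrow> l) (at_left 1)" by blast
    then have "(\<lambda>n. f (of_real (radii n) * z)) \<longlonglongrightarrow> l" by (rule filterlim_compose[OF _ radii_at_left])
    then have "F z = l" unfolding F_def by (rule limI)
    with l show ?case by simp
  qed
  ultimately show ?thesis using H2_diskI[OF f C] by blast
qed

section \<open>Poisson integrals of continuous functions as majorants\<close>

text \<open>Away from \<open>z\<close> a continuous \<open>v\<close> satisfies \<open>\<bar>v w - v z\<bar> \<le> \<epsilon> + K * (norm (w - z))\<^sup>2\<close>, and the Poisson
  integral of \<open>(norm (w - z))\<^sup>2\<close> is explicit.\<close>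

lemma poisson_approximate_identity:
  assumes v: "continuous_on (sphere 0 1) v" and \<epsilon>: "0 < \<epsilon>"
  obtains K where "0 \<le> K"
    "\<And>r z. norm z = 1 \<Longrightarrow> 0 \<le> r \<Longrightarrow> r < 1 \<Longrightarrow> \<bar>Re (herglotz v (of_real r * z)) - v z\<bar> \<le> \<epsilon> + K * (1 - r)"
proof -
  have "uniformly_continuous_on (sphere 0 1) v"
    by (intro compact_uniformly_continuous v compact_sphere)
  then obtain \<delta> where \<delta>: "0 < \<delta>" "\<And>w z. norm w = 1 \<Longrightarrow> norm z = 1 \<Longrightarrow> dist w z < \<delta> \<Longrightarrow> dist (v w) (v z) < \<epsilon>"
    using \<epsilon> unfolding uniformly_continuous_on_def by (metis mem_sphere_0)
  have "bounded (v ` sphere 0 1)"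
    by (intro compact_imp_bounded compact_continuous_image v compact_sphere)
  then obtain B where "\<forall>y\<in>v ` sphere 0 1. norm y \<le> B" unfolding bounded_iff by blast
  then have B: "\<bar>v z\<bar> \<le> B" if "norm z = 1" for z using that by auto
  have B0: "0 \<le> B" using B[of 1] by simp
  \<comment> \<open>Chosen so that at distance at least \<open>\<delta>\<close> the quadratic term
    alone reaches the oscillation bound \<open>2 * B\<close>.\<close>
  define L where "L = 2 * B / \<delta>\<^sup>2"
  have L0: "0 \<le> L" using B0 by (simp add: L_def)
  have pw: "\<bar>v w - v z\<bar> \<le> \<epsilon> + L * (norm (w - z))\<^sup>2" if "norm w = 1" "norm z = 1" for w z
  proof (cases "dist w z < \<delta>")
    case True
    then have "\<bar>v w - v z\<bar> < \<epsilon>" using \<delta>(2) that by (simp add: dist_real_def)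
    moreover have "0 \<le> L * (norm (w - z))\<^sup>2" using L0 by simp
    ultimately show ?thesis by simp
  next
    case False
    then have "\<delta>\<^sup>2 \<le> (norm (w - z))\<^sup>2" using \<delta>(1) by (intro power_mono) (auto simp: dist_norm)
    then have "L * \<delta>\<^sup>2 \<le> L * (norm (w - z))\<^sup>2" by (intro mult_left_mono L0)
    moreover have "L * \<delta>\<^sup>2 = 2 * B" using \<delta>(1) by (simp add: L_def)
    moreover have "\<bar>v w - v z\<bar> \<le> 2 * B" using B[OF that(1)] B[OF that(2)] by simp
    ultimately show ?thesis using \<epsilon> by simp
  qed
  show thesis
  proof (rule that[of "2 * L"])
    show "0 \<le> 2 * L" using L0 by simp
    fix r :: real and z :: complex assume z: "norm z = 1" and r: "0 \<le> r" "r < 1"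
    define a where "a = of_real r * z"
    have a: "norm a < 1" using z r by (simp add: a_def norm_mult)
    note contP = continuous_poisson[OF a]
    have iP: "integrable circle (\<lambda>w. g w * poisson a w)" if "continuous_on (sphere 0 1) g" for g
      by (intro integrable_circle_continuous continuous_intros contP that)
    have m1: "(\<integral>w. w * of_real (poisson a w) \<partial>circle) = 2 * pi * a"
      using poisson_circle[of "\<lambda>w. w" 2 a] a by (simp add: holomorphic_intros)
    have "integrable circle (\<lambda>w. cnj z * (w * of_real (poisson a w)))"
      by (intro integrable_circle_continuous continuous_intros contP)
    from integral_Re[OF this]
    have "(\<integral>w. Re (cnj z * (w * of_real (poisson a w))) \<partial>circle) = Re (cnj z * (2 * pi * a))"
      by (simp only: Bochner_Integration.integral_mult_right_zero m1)
    also have "cnj z * (2 * pi * a) = of_real (2 * pi * r) * (z * cnj z)" by (simp add: a_def)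
    also have "z * cnj z = 1" using z by (simp add: complex_norm_square[symmetric])
    finally have m2: "(\<integral>w. Re (cnj z * w) * poisson a w \<partial>circle) = 2 * pi * r"
      by (simp add: mult.assoc[symmetric])
    \<comment> \<open>On the circle the squared distance is \<open>2 - 2 * Re (cnj z * w)\<close>,
      and the Poisson mean of the real part is \<open>r\<close>.\<close>
    have m3: "(\<integral>w. (norm (w - z))\<^sup>2 * poisson a w \<partial>circle) = 2 * pi * (2 * (1 - r))"
    proof -
      have nw: "(norm (w - z))\<^sup>2 = 2 - 2 * Re (cnj z * w)" if "norm w = 1" for w
      proof -
        have "(norm (w - z))\<^sup>2 = (norm w)\<^sup>2 + (norm z)\<^sup>2 - 2 * Re (cnj z * w)"
          unfolding cmod_power2 by (simp add: power2_eq_square algebra_simps)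
        then show ?thesis using that z by simp
      qed
      have "(\<integral>w. (norm (w - z))\<^sup>2 * poisson a w \<partial>circle) = (\<integral>w. 2 * poisson a w - 2 * (Re (cnj z * w) * poisson a w) \<partial>circle)"
      proof (intro Bochner_Integration.integral_cong refl)
        fix w assume "w \<in> space circle"
        then show "(norm (w - z))\<^sup>2 * poisson a w = 2 * poisson a w - 2 * (Re (cnj z * w) * poisson a w)"
          by (subst nw) (simp_all only: space_circle mem_sphere_0 left_diff_distrib mult.assoc)
      qed
      also have "\<dots> = 2 * (2 * pi) - 2 * (2 * pi * r)"
      proof -
        have "integrable circle (\<lambda>w. Re (cnj z * w) * poisson a w)" by (intro iP continuous_intros)
        moreover have "integrable circle (poisson a)" by (intro integrable_circle_continuous contP)
        ultimately show ?thesis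
          by (simp only: Bochner_Integration.integral_diff integrable_mult_right
            Bochner_Integration.integral_mult_right_zero integral_poisson[OF a] m2)
      qed
      finally show ?thesis by (simp add: algebra_simps)
    qed
    have "Re (herglotz v a) - v z = (\<integral>w. (v w - v z) * poisson a w \<partial>circle) / (2 * pi)"
    proof -
      have "(\<integral>w. (v w - v z) * poisson a w \<partial>circle) = (\<integral>w. v w * poisson a w \<partial>circle) - v z * (2 * pi)"
        using iP[OF v] iP[of "\<lambda>_. v z"]
        by (simp add: left_diff_distrib integral_poisson[OF a])
      then show ?thesis using a v by (simp add: Re_herglotz integrable_circle_continuous field_simps)
    qed
    moreover have "\<bar>\<integral>w. (v w - v z) * poisson a w \<partial>circle\<bar> \<le> (\<integral>w. (\<epsilon> + L * (norm (w - z))\<^sup>2) * poisson a w \<partial>circle)"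
    proof (rule order.trans[OF integral_abs_bound], rule integral_mono)
      show "\<bar>(v w - v z) * poisson a w\<bar> \<le> (\<epsilon> + L * (norm (w - z))\<^sup>2) * poisson a w" if "w \<in> space circle" for w
        using pw[of w z] z that poisson_pos[OF a, of w] by (auto simp: abs_mult intro!: mult_right_mono)
    qed (auto intro!: iP continuous_intros integrable_circle_continuous contP v)
    moreover have "(\<integral>w. (\<epsilon> + L * (norm (w - z))\<^sup>2) * poisson a w \<partial>circle) = \<epsilon> * (2 * pi) + L * (2 * pi * (2 * (1 - r)))"
    proof -
      have "(\<integral>w. (\<epsilon> + L * (norm (w - z))\<^sup>2) * poisson a w \<partial>circle) =
         (\<integral>w. \<epsilon> * poisson a w + L * ((norm (w - z))\<^sup>2 * poisson a w) \<partial>circle)"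
        by (simp add: algebra_simps)
      also have "\<dots> = \<epsilon> * (2 * pi) + L * (2 * pi * (2 * (1 - r)))"
      proof -
        have "integrable circle (\<lambda>w. (norm (w - z))\<^sup>2 * poisson a w)" by (intro iP continuous_intros)
        moreover have "integrable circle (poisson a)" by (intro integrable_circle_continuous contP)
        ultimately show ?thesis
          by (simp only: Bochner_Integration.integral_add integrable_mult_right
            Bochner_Integration.integral_mult_right_zero integral_poisson[OF a] m3)
      qed
      finally show ?thesis .
    qed
    ultimately have "\<bar>Re (herglotz v a) - v z\<bar> \<le> (\<epsilon> * (2 * pi) + L * (2 * pi * (2 * (1 - r)))) / (2 * pi)"
      by (simp add: abs_divide divide_right_mono)
    also have "\<dots> = \<epsilon> + 2 * L * (1 - r)" by (simp add: field_simps)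
    finally show "\<bar>Re (herglotz v (of_real r * z)) - v z\<bar> \<le> \<epsilon> + 2 * L * (1 - r)" by (simp add: a_def)
  qed
qed

text \<open>Maximum principle for \<open>k\<close> times the exponential of minus a dilated Herglotz
  integral. The dilation makes that factor holomorphic past the closed disk, at the cost of an error
  that vanishes as \<open>r\<close> tends to 1 and then \<open>\<epsilon>\<close> to 0. The
  logarithm stays on the side of the majorant, so zeros of \<open>k\<close> are harmless.\<close>

lemma norm_le_exp_herglotz:
  fixes k :: "complex \<Rightarrow> complex"
  assumes k: "k holomorphic_on ball 0 R" and R: "1 < R"
    and v: "continuous_on (sphere 0 1) v"
    and le: "\<And>w. norm w = 1 \<Longrightarrow> norm (k w) \<le> exp (v w)" and z: "norm z < 1"
  shows "norm (k z) \<le> exp (Re (herglotz v z))"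
proof -
  note H = holomorphic_herglotz[OF integrable_circle_continuous[OF v]]
  have *: "norm (k z) \<le> exp (2 * \<epsilon> + Re (herglotz v z))" if \<epsilon>: "0 < \<epsilon>" for \<epsilon>
  proof -
    obtain K where K: "0 \<le> K" "\<And>r z. norm z = 1 \<Longrightarrow> 0 \<le> r \<Longrightarrow> r < 1 \<Longrightarrow> \<bar>Re (herglotz v (of_real r * z)) - v z\<bar> \<le> \<epsilon> + K * (1 - r)"
      using poisson_approximate_identity[OF v \<epsilon>] by blast
    have bd: "norm (k z) \<le> exp (\<epsilon> + K * (1 - r) + Re (herglotz v (of_real r * z)))" if r: "0 < r" "r < 1" for r
    proof -
      define F where "F w = k w * exp (- herglotz v (of_real r * w))" for w
      have hF: "F holomorphic_on ball 0 (min R (1 / r))"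
        unfolding F_def
      proof (intro holomorphic_intros)
        show "(\<lambda>w. herglotz v (of_real r * w)) holomorphic_on ball 0 (min R (1 / r))"
          by (rule holomorphic_on_compose_gen[OF _ H, unfolded o_def])
             (use r in \<open>auto intro!: holomorphic_intros simp: norm_mult field_simps\<close>)
      qed (use k in \<open>auto elim: holomorphic_on_subset\<close>)
      have sub: "cball 0 1 \<subseteq> ball (0::complex) (min R (1 / r))" proof -
        have "1 < min R (1 / r)" using R r by auto
        then show ?thesis by auto
      qed
      have "norm (F z) \<le> exp (\<epsilon> + K * (1 - r))"
      proof (rule maximum_modulus_frontier[of F "cball 0 1"])
        show "F holomorphic_on interior (cball 0 1)"
          using hF sub by (auto elim!: holomorphic_on_subset)
        show "continuous_on (closure (cball 0 1)) F"
          using holomorphic_on_imp_continuous_on[OF holomorphic_on_subset[OF hF sub]] by simp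
        fix w :: complex assume "w \<in> frontier (cball 0 1)"
        then have w: "norm w = 1" by simp
        have "norm (F w) = norm (k w) * exp (- Re (herglotz v (of_real r * w)))"
          by (simp add: F_def norm_mult)
        also have "\<dots> \<le> exp (v w) * exp (- Re (herglotz v (of_real r * w)))"
          by (intro mult_right_mono le w) simp
        also have "\<dots> = exp (v w - Re (herglotz v (of_real r * w)))" by (simp add: exp_diff exp_minus field_simps)
        also have "\<dots> \<le> exp (\<epsilon> + K * (1 - r))"
          using K(2)[OF w, of r] r by simp
        finally show "norm (F w) \<le> exp (\<epsilon> + K * (1 - r))" .
      qed (use z in auto)
      then have "norm (F z) * exp (Re (herglotz v (of_real r * z))) \<le> exp (\<epsilon> + K * (1 - r)) * exp (Re (herglotz v (of_real r * z)))"
        by (intro mult_right_mono) auto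
      moreover have "norm (F z) * exp (Re (herglotz v (of_real r * z))) = norm (k z)"
        by (simp add: F_def norm_mult mult.assoc flip: exp_add)
      ultimately show ?thesis by (simp add: exp_add)
    qed
    have rl: "radii \<longlonglongrightarrow> 1" using radii_at_left by (simp add: filterlim_at)
    have "isCont (herglotz v) z"
      using holomorphic_on_imp_continuous_on[OF H] continuous_on_eq_continuous_at[OF open_ball] z
      by (metis mem_ball_0)
    moreover have "(\<lambda>n. of_real (radii n) * z) \<longlonglongrightarrow> of_real 1 * z" by (intro tendsto_intros rl)
    ultimately have "(\<lambda>n. herglotz v (of_real (radii n) * z)) \<longlonglongrightarrow> herglotz v z"
      using isCont_tendsto_compose by fastforce
    then have "(\<lambda>n. exp (\<epsilon> + K * (1 - radii n) + Re (herglotz v (of_real (radii n) * z)))) \<longlonglongrightarrow> exp (\<epsilon> + K * (1 - 1) + Re (herglotz v z))"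
      by (intro tendsto_intros rl)
    then have "norm (k z) \<le> exp (\<epsilon> + K * (1 - 1) + Re (herglotz v z))"
      by (rule LIMSEQ_le_const) (use bd radii in auto)
    then show ?thesis using \<epsilon> by (auto elim: order.trans)
  qed
  have "((\<lambda>\<epsilon>. exp (2 * \<epsilon> + Re (herglotz v z))) \<longlongrightarrow> exp (2 * 0 + Re (herglotz v z))) (at_right 0)"
    by (intro tendsto_intros)
  then have "norm (k z) \<le> exp (2 * 0 + Re (herglotz v z))"
    by (rule tendsto_lowerbound) (auto simp: eventually_at_filter * intro!: always_eventually)
  then show ?thesis by simp
qed

section \<open>Outer functions\<close>

text \<open>Cauchy-Schwarz. The norm of a pair is its Euclidean length, the notation for row lengths
  from here on. For determinant 1 the lengths of the two rows have product at least 1.\<close>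

lemma det_le_norm_mult:
  fixes f1 f2 g1 g2 :: complex
  shows "norm (f1 * g2 - f2 * g1) \<le> norm (f1, f2) * norm (g1, g2)"
proof -
  have "norm (f1 * g2 - f2 * g1) \<le> norm f1 * norm g2 + norm f2 * norm g1"
    by (metis norm_mult norm_triangle_ineq4)
  also have "\<dots> \<le> sqrt (((norm f1)\<^sup>2 + (norm f2)\<^sup>2) * ((norm g1)\<^sup>2 + (norm g2)\<^sup>2))"
  proof (rule real_le_rsqrt)
    have "0 \<le> (norm f1 * norm g1 - norm f2 * norm g2)\<^sup>2" by simp
    then show "(norm f1 * norm g2 + norm f2 * norm g1)\<^sup>2 \<le> ((norm f1)\<^sup>2 + (norm f2)\<^sup>2) * ((norm g1)\<^sup>2 + (norm g2)\<^sup>2)"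
      by (simp add: power2_eq_square algebra_simps)
  qed
  finally show ?thesis by (simp add: norm_Pair real_sqrt_mult)
qed

text \<open>Project the row onto its own direction at \<open>z\<close>: the scalar function
  \<open>k\<close> equals the length of the row at \<open>z\<close> and is at most that length on
  the circle, so the scalar estimate applies.\<close>

lemma norm_row_le_exp_herglotz:
  fixes f1 f2 :: "complex \<Rightarrow> complex"
  assumes f1: "f1 holomorphic_on ball 0 1" and f2: "f2 holomorphic_on ball 0 1"
    and nz: "\<And>z. norm z < 1 \<Longrightarrow> (f1 z, f2 z) \<noteq> 0" and s: "0 < s" "s < 1" and z: "norm z < 1"
  shows "norm (f1 (of_real s * z), f2 (of_real s * z)) \<le>
           exp (Re (herglotz (\<lambda>w. ln (norm (f1 (of_real s * w), f2 (of_real s * w)))) z))"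
proof -
  define N where "N w = norm (f1 (of_real s * w), f2 (of_real s * w))" for w
  define \<alpha> where "\<alpha> = cnj (f1 (of_real s * z)) / N z"
  define \<beta> where "\<beta> = cnj (f2 (of_real s * z)) / N z"
  define k where "k w = \<alpha> * f1 (of_real s * w) + \<beta> * f2 (of_real s * w)" for w
  have Nz: "0 < N w" if "norm w \<le> 1" for w
  proof -
    have "s * norm w \<le> s * 1" using s that by (intro mult_left_mono) auto
    then have "s * norm w < 1" using s by linarith
    then have "norm (of_real s * w) < 1" using s by (simp add: norm_mult)
    then show ?thesis using nz by (simp add: N_def)
  qed
  have zz: "of_real (norm x) * of_real (norm x) = cnj x * x" for x
    by (metis complex_norm_square mult.commute of_real_mult power2_eq_square)
  have NN: "N w * N w = norm (f1 (of_real s * w)) * norm (f1 (of_real s * w)) + norm (f2 (of_real s * w)) * norm (f2 (of_real s * w))" for w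
    by (simp add: N_def norm_Pair flip: power2_eq_square)
  have comp: "(\<lambda>w. f (of_real s * w)) holomorphic_on ball 0 (1 / s)" if "f holomorphic_on ball 0 1" for f
    by (rule holomorphic_on_compose_gen[OF _ that, unfolded o_def])
       (use s in \<open>auto intro!: holomorphic_intros simp: norm_mult field_simps\<close>)
  have kh: "k holomorphic_on ball 0 (1 / s)"
    unfolding k_def by (intro holomorphic_intros comp f1 f2)
  have cont: "continuous_on (sphere 0 1) (\<lambda>w. ln (N w))"
  proof (intro continuous_intros)
    show "continuous_on (sphere 0 1) N"
      unfolding N_def by (intro continuous_intros taylor_on_circle(3)[OF f1] taylor_on_circle(3)[OF f2]) (use s in auto)
  qed (use Nz in \<open>auto simp: less_imp_neq[THEN not_sym]\<close>)
  have "norm (k z) \<le> exp (Re (herglotz (\<lambda>w. ln (N w)) z))"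
  proof (rule norm_le_exp_herglotz[OF kh _ cont _ z])
    show "1 < 1 / s" using s by simp
    fix w :: complex assume w: "norm w = 1"
    \<comment> \<open>The sign and the reversed order of the row turn the difference of products in
      the determinant inequality into the pairing \<open>k\<close>.\<close>
    have "norm (\<alpha>, - \<beta>) = N z / N z"
      using Nz[of z] z unfolding \<alpha>_def \<beta>_def N_def norm_Pair
      by (simp add: norm_divide power_divide real_sqrt_divide flip: add_divide_distrib)
    then have 1: "norm (\<alpha>, - \<beta>) = 1" using Nz[of z] z by simp
    have "norm (k w) = norm (\<alpha> * f1 (of_real s * w) - (- \<beta>) * f2 (of_real s * w))" by (simp add: k_def)
    also have "\<dots> \<le> norm (\<alpha>, - \<beta>) * norm (f2 (of_real s * w), f1 (of_real s * w))"
      by (rule det_le_norm_mult)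
    also have "\<dots> = N w" unfolding 1 by (simp add: N_def norm_Pair add.commute)
    also have "\<dots> = exp (ln (N w))" using Nz[of w] w by simp
    finally show "norm (k w) \<le> exp (ln (N w))" .
  qed
  also have "k z = of_real (N z)"
  proof -
    have "k z = (cnj (f1 (of_real s * z)) * f1 (of_real s * z) + cnj (f2 (of_real s * z)) * f2 (of_real s * z)) / N z"
      by (simp add: k_def \<alpha>_def \<beta>_def add_divide_distrib)
    also have "\<dots> = of_real (N z * N z) / N z" unfolding NN by (simp add: zz)
    finally show ?thesis using Nz[of z] z by simp
  qed
  finally show ?thesis using Nz[of z] z by (simp add: N_def)
qed

text \<open>Integrate the tangent line bound \<open>exp t * (1 + y - t) \<le> exp y\<close> at the Poisson mean \<open>t\<close>.\<close>

lemma exp_herglotz_le: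
  assumes h: "integrable circle h" and eh: "integrable circle (\<lambda>w. exp (h w))" and z: "norm z < 1"
  shows "exp (Re (herglotz h z)) \<le> Re (herglotz (\<lambda>w. exp (h w)) z)"
proof -
  define t where "t = Re (herglotz h z)"
  have iP: "integrable circle (\<lambda>w. g w * poisson z w)" if "integrable circle g" for g
    by (intro integrable_circle_mult_continuous that continuous_poisson z)
  have t: "(\<integral>w. h w * poisson z w \<partial>circle) = 2 * pi * t"
    unfolding t_def using Re_herglotz[OF h z] by simp
  have "(\<integral>w. (exp t * (1 - t) + exp t * h w) * poisson z w \<partial>circle) =
     (\<integral>w. (exp t * (1 - t)) * poisson z w + exp t * (h w * poisson z w) \<partial>circle)"
    by (simp add: algebra_simps)
  also have "\<dots> = exp t * (1 - t) * (2 * pi) + exp t * (2 * pi * t)"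
    using iP[OF h] iP[of "\<lambda>_. 1"]
    by (subst Bochner_Integration.integral_add) (auto simp: t integral_poisson[OF z])
  also have "\<dots> = exp t * (2 * pi)" by (simp add: algebra_simps)
  finally have "exp t * (2 * pi) = (\<integral>w. (exp t * (1 - t) + exp t * h w) * poisson z w \<partial>circle)" ..
  also have "\<dots> \<le> (\<integral>w. exp (h w) * poisson z w \<partial>circle)"
  proof (rule integral_mono)
    fix w assume "w \<in> space circle"
    then have "0 \<le> poisson z w" using poisson_pos[OF z, of w] by simp
    moreover have "exp t * (1 - t) + exp t * h w \<le> exp (h w)"
    proof -
      have "exp t * (1 + (h w - t)) \<le> exp t * exp (h w - t)" by (intro mult_left_mono exp_ge_add_one_self) auto
      then show ?thesis by (simp add: exp_diff algebra_simps)
    qed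
    ultimately show "(exp t * (1 - t) + exp t * h w) * poisson z w \<le> exp (h w) * poisson z w"
      by (intro mult_right_mono)
  qed (auto intro!: iP eh h)
  finally have "exp t \<le> (\<integral>w. exp (h w) * poisson z w \<partial>circle) / (2 * pi)"
    by (simp only: pos_le_divide_eq pi_gt_zero zero_less_mult_iff zero_less_numeral simp_thms)
  then show ?thesis by (simp add: Re_herglotz[OF eh z] t_def)
qed

lemma herglotz_cong_AE:
  assumes "AE w in circle. h w = h' w" "h \<in> borel_measurable circle" "h' \<in> borel_measurable circle" "norm z < 1"
  shows "herglotz h z = herglotz h' z"
proof -
  note [measurable] = assms(2,3) continuous_measurable_circle[OF continuous_herglotz_kernel[OF assms(4)]]
  have "(\<integral>w. of_real (h w) * herglotz_kernel z w \<partial>circle) = (\<integral>w. of_real (h' w) * herglotz_kernel z w \<partial>circle)"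
    by (rule integral_cong_AE) (use assms(1) in \<open>auto elim!: eventually_mono\<close>)
  then show ?thesis by (simp add: herglotz_def)
qed

text \<open>The upper bound is \<open>ln x \<le> x\<close>, the lower one
  \<open>- ln x \<le> ln y \<le> y\<close>. Majorants of two rows with determinant 1 thereby bound
  the logarithm of the first row on both sides.\<close>

lemma abs_ln_le:
  fixes x y :: real
  assumes "0 < x" "1 \<le> x * y"
  shows "\<bar>ln x\<bar> \<le> x + y"
proof -
  have y: "0 < y" using assms by (metis less_le_trans zero_less_mult_pos zero_less_one)
  have "ln x \<le> x" using ln_le_minus_one[OF assms(1)] by simp
  moreover have "- ln x \<le> ln y" using assms y ln_mult[of x y] ln_ge_zero[of "x * y"] by simp
  moreover have "ln y \<le> y" using ln_le_minus_one[OF y] by simp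
  ultimately show ?thesis using assms y by (simp add: abs_if)
qed

text \<open>The second row \<open>(g1, g2)\<close> bounds \<open>norm (f1, f2)\<close> from below, which makes the logarithms
  uniformly integrable and excludes a common inner factor of \<open>f1\<close> and \<open>f2\<close>.\<close>

theorem outer_function_of_row:
  fixes f1 f2 g1 g2 F1 F2 G1 G2 :: "complex \<Rightarrow> complex"
  assumes f: "H2_disk f1 F1" "H2_disk f2 F2" and g: "H2_disk g1 G1" "H2_disk g2 G2"
    and det: "\<And>z. norm z < 1 \<Longrightarrow> f1 z * g2 z - f2 z * g1 z = 1"
  defines "h \<equiv> \<lambda>z. ln (norm (F1 z, F2 z))"
  shows "integrable circle h"
    and "\<And>z. norm z < 1 \<Longrightarrow> norm (f1 z, f2 z) \<le> norm (exp (herglotz h z))"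
    and "\<exists>B. H2_disk (\<lambda>z. exp (herglotz h z)) B \<and> (AE z in circle. B z \<noteq> 0 \<and> norm (B z) = norm (F1 z, F2 z))"
proof -
  have hol: "f1 holomorphic_on ball 0 1" "f2 holomorphic_on ball 0 1" "g1 holomorphic_on ball 0 1" "g2 holomorphic_on ball 0 1"
    using f g by (auto simp: H2_disk_def)
  have [measurable]: "F1 \<in> borel_measurable circle" "F2 \<in> borel_measurable circle"
    "G1 \<in> borel_measurable circle" "G2 \<in> borel_measurable circle"
    using f g by (auto simp: H2_disk_def L2_circle_def)
  have L2: "integrable circle (\<lambda>z. (norm (F1 z))\<^sup>2)" "integrable circle (\<lambda>z. (norm (F2 z))\<^sup>2)"
    using f by (auto simp: H2_disk_def L2_circle_def)
  have rl: "radii \<longlonglongrightarrow> 1" using radii_at_left by (simp add: filterlim_at)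
  note [measurable] = hol[THEN holomorphic_radii_measurable]
  define fn where "fn n z = norm (f1 (of_real (radii n) * z), f2 (of_real (radii n) * z))" for n z
  define gn where "gn n z = norm (g1 (of_real (radii n) * z), g2 (of_real (radii n) * z))" for n z
  have [measurable]: "fn n \<in> borel_measurable circle" for n unfolding fn_def norm_Pair by measurable
  have h_meas[measurable]: "h \<in> borel_measurable circle" unfolding h_def norm_Pair by measurable
  have rz: "norm (of_real (radii n) * z) < 1" if "norm z \<le> 1" for n and z :: complex
  proof -
    have "radii n * norm z \<le> radii n * 1" using radii[of n] that by (intro mult_left_mono) auto
    then have "radii n * norm z < 1" using radii[of n] by linarith
    then show ?thesis using radii[of n] by (simp add: norm_mult)
  qed
  have prod: "1 \<le> norm (f1 z, f2 z) * norm (g1 z, g2 z)" if "norm z < 1" for z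
    using det_le_norm_mult[of "f1 z" "g2 z" "f2 z" "g1 z"] det[OF that] by simp
  have fg: "1 \<le> fn n z * gn n z" "0 < fn n z" if "norm z = 1" for n z
  proof -
    show "1 \<le> fn n z * gn n z" unfolding fn_def gn_def using rz[of z n] that by (intro prod) simp
    then have "fn n z \<noteq> 0" by auto
    then show "0 < fn n z" by (simp add: fn_def)
  qed
  obtain W1 where W1: "integrable circle W1" "\<And>z. 0 \<le> W1 z"
    "AE z in circle. \<forall>r. 0 < r \<longrightarrow> r < 1 \<longrightarrow> (norm (f1 (of_real r * z)))\<^sup>2 \<le> W1 z"
    using H2_disk_dominated[OF f(1)] by blast
  obtain W2 where W2: "integrable circle W2" "\<And>z. 0 \<le> W2 z"
    "AE z in circle. \<forall>r. 0 < r \<longrightarrow> r < 1 \<longrightarrow> (norm (f2 (of_real r * z)))\<^sup>2 \<le> W2 z"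
    using H2_disk_dominated[OF f(2)] by blast
  obtain W3 where W3: "integrable circle W3" "\<And>z. 0 \<le> W3 z"
    "AE z in circle. \<forall>r. 0 < r \<longrightarrow> r < 1 \<longrightarrow> (norm (g1 (of_real r * z)))\<^sup>2 \<le> W3 z"
    using H2_disk_dominated[OF g(1)] by blast
  obtain W4 where W4: "integrable circle W4" "\<And>z. 0 \<le> W4 z"
    "AE z in circle. \<forall>r. 0 < r \<longrightarrow> r < 1 \<longrightarrow> (norm (g2 (of_real r * z)))\<^sup>2 \<le> W4 z"
    using H2_disk_dominated[OF g(2)] by blast
  have le1: "x \<le> 1 + x\<^sup>2" for x :: real
    using zero_le_power2[of "x - 1/2"] by (simp add: power2_eq_square algebra_simps)
  define D where "D z = (1 + W1 z + W2 z) + (1 + W3 z + W4 z)" for z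
  have D: "integrable circle D" unfolding D_def using W1 W2 W3 W4 by simp
  have fgD: "AE z in circle. \<forall>n. fn n z \<le> 1 + W1 z + W2 z \<and> gn n z \<le> 1 + W3 z + W4 z"
    using W1(3) W2(3) W3(3) W4(3)
  proof eventually_elim
    case (elim z)
    show ?case
    proof
      fix n
      have "(fn n z)\<^sup>2 \<le> W1 z + W2 z" "(gn n z)\<^sup>2 \<le> W3 z + W4 z"
        using elim radii[of n] by (auto simp: fn_def gn_def norm_Pair intro!: add_mono)
      then show "fn n z \<le> 1 + W1 z + W2 z \<and> gn n z \<le> 1 + W3 z + W4 z"
        using le1[of "fn n z"] le1[of "gn n z"] by linarith
    qed
  qed
  have circ: "AE z in circle. norm z = 1" by (rule AE_I2) simp
  have lnD: "AE z in circle. \<bar>ln (fn n z)\<bar> \<le> D z" for n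
    using fgD circ
  proof eventually_elim
    case (elim z)
    then have "fn n z \<le> 1 + W1 z + W2 z" "gn n z \<le> 1 + W3 z + W4 z" by auto
    with abs_ln_le[OF fg(2,1)[OF elim(2), of n]] show ?case by (simp add: D_def)
  qed
  note lims = H2_disk_radii[of f1 F1] H2_disk_radii[of f2 F2] H2_disk_radii[of g1 G1] H2_disk_radii[of g2 G2]
  have lim_fg: "AE z in circle. (\<lambda>n. fn n z) \<longlonglongrightarrow> norm (F1 z, F2 z) \<and> norm (F1 z, F2 z) \<noteq> 0"
    using lims(1)[OF H2_disk_def[THEN iffD1, OF f(1), THEN conjunct2, THEN conjunct2, THEN conjunct2]]
      lims(2)[OF H2_disk_def[THEN iffD1, OF f(2), THEN conjunct2, THEN conjunct2, THEN conjunct2]]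
      lims(3)[OF H2_disk_def[THEN iffD1, OF g(1), THEN conjunct2, THEN conjunct2, THEN conjunct2]]
      lims(4)[OF H2_disk_def[THEN iffD1, OF g(2), THEN conjunct2, THEN conjunct2, THEN conjunct2]] circ
  proof eventually_elim
    case (elim z)
    have f': "(\<lambda>n. fn n z) \<longlonglongrightarrow> norm (F1 z, F2 z)" unfolding fn_def by (intro tendsto_intros elim)
    have g': "(\<lambda>n. gn n z) \<longlonglongrightarrow> norm (G1 z, G2 z)" unfolding gn_def by (intro tendsto_intros elim)
    \<comment> \<open>The lower bound survives in the limit, so the boundary row vanishes at most on
      a null set.\<close>
    have "1 \<le> norm (F1 z, F2 z) * norm (G1 z, G2 z)"
      by (rule LIMSEQ_le_const[OF tendsto_mult[OF f' g']]) (use fg(1) elim in auto)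
    then have "norm (F1 z, F2 z) \<noteq> 0" by auto
    with f' show ?case by blast
  qed
  have lim_h: "AE z in circle. (\<lambda>n. ln (fn n z)) \<longlonglongrightarrow> h z"
    using lim_fg unfolding h_def by eventually_elim (auto intro!: tendsto_ln)
  show h: "integrable circle h"
    by (rule integrable_dominated_convergence[OF h_meas _ D lim_h])
       (use lnD in \<open>auto intro!: borel_measurable_ln\<close>)
  note Hh = holomorphic_herglotz[OF h]
  have iln: "integrable circle (\<lambda>z. ln (fn n z))" for n
    by (rule Bochner_Integration.integrable_bound[OF D]) (use lnD[of n] in \<open>auto elim!: eventually_mono\<close>)
  have nz: "(f1 z, f2 z) \<noteq> 0" if "norm z < 1" for z
    using det[OF that] by (auto simp: zero_prod_def)
  show fE: "norm (f1 z, f2 z) \<le> norm (exp (herglotz h z))" if z: "norm z < 1" for z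
  proof -
    have cont: "isCont f1 z" "isCont f2 z"
      using hol[THEN holomorphic_on_imp_continuous_on] continuous_on_eq_continuous_at[OF open_ball] z
      by (metis mem_ball_0)+
    have zl: "(\<lambda>n. of_real (radii n) * z) \<longlonglongrightarrow> z"
      using tendsto_mult[OF tendsto_of_real[OF rl] tendsto_const[of z]] by simp
    have lhs: "(\<lambda>n. fn n z) \<longlonglongrightarrow> norm (f1 z, f2 z)"
      unfolding fn_def
      by (intro tendsto_intros isCont_tendsto_compose[OF cont(1) zl] isCont_tendsto_compose[OF cont(2) zl])
    note [measurable] = continuous_measurable_circle[OF continuous_poisson[OF z]]
    \<comment> \<open>The majorant \<open>D\<close> is the same for all \<open>n\<close>, so the
      Poisson integrals of the interior logarithms converge to that of the boundary
      logarithm.\<close>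
    have "(\<lambda>n. \<integral>w. ln (fn n w) * poisson z w \<partial>circle) \<longlonglongrightarrow> (\<integral>w. h w * poisson z w \<partial>circle)"
    proof (rule integral_dominated_convergence)
      show "integrable circle (\<lambda>w. D w * poisson z w)"
        by (intro integrable_circle_mult_continuous continuous_poisson z D)
      show "AE w in circle. (\<lambda>n. ln (fn n w) * poisson z w) \<longlonglongrightarrow> h w * poisson z w"
        using lim_h by eventually_elim (intro tendsto_intros)
      show "AE w in circle. norm (ln (fn n w) * poisson z w) \<le> D w * poisson z w" for n
        using lnD[of n] circ
      proof eventually_elim
        case (elim w)
        then show ?case using poisson_pos[OF z, of w] by (auto simp: abs_mult intro!: mult_right_mono)
      qed
    qed measurable
    then have "(\<lambda>n. exp ((\<integral>w. ln (fn n w) * poisson z w \<partial>circle) / (2 * pi))) \<longlonglongrightarrow> exp ((\<integral>w. h w * poisson z w \<partial>circle) / (2 * pi))"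
      by (intro tendsto_intros) auto
    moreover have "fn n z \<le> exp ((\<integral>w. ln (fn n w) * poisson z w \<partial>circle) / (2 * pi))" for n
      using norm_row_le_exp_herglotz[OF hol(1,2) nz radii z, of n] Re_herglotz[OF iln z, of n] by (simp add: fn_def)
    ultimately have "norm (f1 z, f2 z) \<le> exp ((\<integral>w. h w * poisson z w \<partial>circle) / (2 * pi))"
      by (intro LIMSEQ_le[OF lhs]) auto
    then show ?thesis by (simp add: Re_herglotz[OF h z])
  qed
  define E where "E z = exp (herglotz h z)" for z
  have holE: "E holomorphic_on ball 0 1" unfolding E_def by (intro holomorphic_intros Hh)
  define w2 where "w2 z = (norm (F1 z))\<^sup>2 + (norm (F2 z))\<^sup>2" for z
  have w2: "integrable circle w2" unfolding w2_def using L2 by simp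
  have w2e: "AE z in circle. w2 z = exp (2 * h z)"
    using lim_fg
  proof eventually_elim
    case (elim z)
    then have "0 < norm (F1 z, F2 z)" by simp
    then have "exp (2 * h z) = (norm (F1 z, F2 z))\<^sup>2" unfolding h_def by (simp add: exp_double)
    then show ?case by (simp add: w2_def norm_Pair)
  qed
  have ie: "integrable circle (\<lambda>z. exp (2 * h z))"
    using integrable_cong_AE_imp[OF w2 _ w2e] by (auto simp: eq_commute)
  \<comment> \<open>Jensen's inequality bounds the squared modulus of \<open>E\<close> by the
    Poisson integral of \<open>exp (2 * h)\<close>, which has the same mean over every circle.
    Almost everywhere \<open>exp (2 * h)\<close> is the squared length of the boundary row, which is
    integrable.\<close>
  have bdE: "(\<integral>\<^sup>+z. ennreal ((norm (E (of_real r * z)))\<^sup>2) \<partial>circle) \<le> ennreal (\<integral>z. exp (2 * h z) \<partial>circle)"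
    if r: "0 < r" "r < 1" for r
  proof -
    have rr: "norm (of_real r * z) < 1" if "norm z = 1" for z :: complex
      using that r by (simp add: norm_mult)
    note T = taylor_on_circle(3)[OF holomorphic_herglotz[OF ie], of r]
    have "(norm (E (of_real r * z)))\<^sup>2 \<le> Re (herglotz (\<lambda>w. exp (2 * h w)) (of_real r * z))" if "norm z = 1" for z
    proof -
      have "(norm (E (of_real r * z)))\<^sup>2 = exp (Re (herglotz (\<lambda>w. 2 * h w) (of_real r * z)))"
        by (simp add: E_def Re_herglotz[OF _ rr[OF that]] h mult.assoc exp_double[symmetric])
      also have "\<dots> \<le> Re (herglotz (\<lambda>w. exp (2 * h w)) (of_real r * z))"
        by (rule exp_herglotz_le) (use h ie rr[OF that] in auto)
      finally show ?thesis .
    qed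
    then have "(\<integral>z. (norm (E (of_real r * z)))\<^sup>2 \<partial>circle) \<le> (\<integral>z. Re (herglotz (\<lambda>w. exp (2 * h w)) (of_real r * z)) \<partial>circle)"
      using r by (intro integral_mono integrable_circle_continuous continuous_intros T taylor_on_circle(3)[OF holE]) auto
    also have "\<dots> = (\<integral>z. exp (2 * h z) \<partial>circle)" by (rule mean_value_herglotz[OF ie]) (use r in auto)
    finally show ?thesis using nn_integral_norm_square[OF holE, of r] r by (simp add: ennreal_leI)
  qed
  obtain B where B: "H2_disk E B" using H2_disk_boundary_exists[OF holE bdE] by blast
  have [measurable]: "B \<in> borel_measurable circle" using B by (auto simp: H2_disk_def L2_circle_def)
  obtain W where W: "integrable circle W" "\<And>z. 0 \<le> W z"
    "AE z in circle. \<forall>r. 0 < r \<longrightarrow> r < 1 \<longrightarrow> (norm (E (of_real r * z)))\<^sup>2 \<le> W z"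
    using H2_disk_dominated[OF B] by blast
  have limE: "AE z in circle. (\<lambda>n. E (of_real (radii n) * z)) \<longlonglongrightarrow> B z"
    using B by (intro H2_disk_radii) (auto simp: H2_disk_def)
  have ge: "AE z in circle. norm (F1 z, F2 z) \<le> norm (B z) \<and> norm (F1 z, F2 z) \<noteq> 0"
    using limE lim_fg circ
  proof eventually_elim
    case (elim z)
    have "fn n z \<le> norm (E (of_real (radii n) * z))" for n
      unfolding fn_def E_def using rz[of z n] elim by (intro fE) auto
    then have "norm (F1 z, F2 z) \<le> norm (B z)"
      using elim by (intro LIMSEQ_le[OF conjunct1[OF elim(2)] tendsto_norm[OF elim(1)]]) auto
    with elim show ?case by auto
  qed
  define lE where "lE n z = ln (norm (E (of_real (radii n) * z)))" for n z
  have lE: "lE n z = Re (herglotz h (of_real (radii n) * z))" for n z by (simp add: lE_def E_def)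
  have [measurable]: "lE n \<in> borel_measurable circle" for n
    unfolding lE_def using holomorphic_radii_measurable[OF holE, of n] by measurable
  have liml: "AE z in circle. (\<lambda>n. lE n z) \<longlonglongrightarrow> ln (norm (B z))"
    using limE ge unfolding lE_def by eventually_elim (auto intro!: tendsto_intros)
  have iD: "integrable circle (\<lambda>z. 1 + W z + (1 + W3 z + W4 z))" using W W3 W4 by simp
  \<comment> \<open>Above, the maximal function of \<open>E\<close> serves; below,
    \<open>norm E\<close> dominates the first row, whose length times that of the second is at least
    1.\<close>
  have dom: "AE z in circle. norm (lE n z) \<le> 1 + W z + (1 + W3 z + W4 z)" for n
    using W(3) fgD circ
  proof eventually_elim
    case (elim z)
    let ?x = "norm (E (of_real (radii n) * z))"
    have x0: "0 < ?x" by (simp add: E_def)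
    have "fn n z \<le> ?x"
      unfolding fn_def E_def using rz[of z n] elim by (intro fE) auto
    then have "fn n z * gn n z \<le> ?x * gn n z" by (intro mult_right_mono) (auto simp: gn_def)
    then have "1 \<le> ?x * gn n z" using fg(1)[of z n] elim by simp
    from abs_ln_le[OF x0 this] have "\<bar>lE n z\<bar> \<le> ?x + gn n z" by (simp add: lE_def)
    moreover have "?x\<^sup>2 \<le> W z" using elim radii[of n] by auto
    moreover have "gn n z \<le> 1 + W3 z + W4 z" using elim by auto
    ultimately show ?case using le1[of ?x] by simp
  qed
  have lnB_meas: "(\<lambda>z. ln (norm (B z))) \<in> borel_measurable circle" by measurable
  have lE_meas: "lE n \<in> borel_measurable circle" for n by measurable
  note dc = lnB_meas lE_meas iD liml dom
  have iB: "integrable circle (\<lambda>z. ln (norm (B z)))"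
    by (rule integrable_dominated_convergence[OF dc])
  have "(\<lambda>n. \<integral>z. lE n z \<partial>circle) \<longlonglongrightarrow> (\<integral>z. ln (norm (B z)) \<partial>circle)"
    by (rule integral_dominated_convergence[OF dc])
  moreover have "(\<integral>z. lE n z \<partial>circle) = (\<integral>z. h z \<partial>circle)" for n
    unfolding lE by (rule mean_value_herglotz[OF h]) (use radii[of n] in auto)
  ultimately have eqI: "(\<integral>z. ln (norm (B z)) \<partial>circle) = (\<integral>z. h z \<partial>circle)"
    by (simp add: LIMSEQ_const_iff)
  have nn: "AE z in circle. 0 \<le> ln (norm (B z)) - h z"
    using ge
  proof eventually_elim
    case (elim z)
    then have "0 < norm (F1 z, F2 z)" by simp
    with elim have "ln (norm (F1 z, F2 z)) \<le> ln (norm (B z))" by (intro ln_mono) auto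
    then show ?case by (simp add: h_def)
  qed
  have "(\<integral>z. ln (norm (B z)) - h z \<partial>circle) = 0" using iB h eqI by simp
  then have "AE z in circle. ln (norm (B z)) - h z = 0"
    using integral_nonneg_eq_0_iff_AE[OF Bochner_Integration.integrable_diff[OF iB h] nn] by simp
  with ge have "AE z in circle. B z \<noteq> 0 \<and> norm (B z) = norm (F1 z, F2 z)"
  proof eventually_elim
    case (elim z)
    then have 1: "0 < norm (F1 z, F2 z)" by simp
    with elim have 2: "0 < norm (B z)" by linarith
    have "ln (norm (B z)) = ln (norm (F1 z, F2 z))" using elim by (simp add: h_def)
    then have "norm (B z) = norm (F1 z, F2 z)" using 1 2 by (simp add: ln_inj_iff)
    with 2 show ?case by auto
  qed
  with B show "\<exists>B. H2_disk (\<lambda>z. exp (herglotz h z)) B \<and> (AE z in circle. B z \<noteq> 0 \<and> norm (B z) = norm (F1 z, F2 z))"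
    unfolding E_def by blast
qed

section \<open>Matrices in \<open>SU(2)\<close>\<close>

no_notation fps_nth (infixl "$" 75)

lemma mat2_nth [simp]:
  "mat2 p q r s $ 1 $ 1 = p" "mat2 p q r s $ 1 $ 2 = q"
  "mat2 p q r s $ 2 $ 1 = r" "mat2 p q r s $ 2 $ 2 = s"
  by (simp_all add: mat2_def)

lemma mat22_eq_iff:
  fixes A B :: mat22
  shows "A = B \<longleftrightarrow> A $ 1 $ 1 = B $ 1 $ 1 \<and> A $ 1 $ 2 = B $ 1 $ 2 \<and> A $ 2 $ 1 = B $ 2 $ 1 \<and> A $ 2 $ 2 = B $ 2 $ 2"
  unfolding vec_eq_iff forall_2 by blast

lemma mat22_mult_nth: "((A :: mat22) ** B) $ i $ j = A $ i $ 1 * B $ 1 $ j + A $ i $ 2 * B $ 2 $ j"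
  by (simp add: matrix_matrix_mult_def sum_2)

lemma mat1_nth [simp]: "(mat 1 :: mat22) $ 1 $ 1 = 1" "(mat 1 :: mat22) $ 1 $ 2 = 0"
  "(mat 1 :: mat22) $ 2 $ 1 = 0" "(mat 1 :: mat22) $ 2 $ 2 = 1"
  by (simp_all add: mat_def)

lemma adj_nth [simp]: "adj A $ i $ j = cnj (A $ j $ i)"
  by (simp add: adj_def)

lemma adj_adj [simp]: "adj (adj A) = A"
  by (simp add: mat22_eq_iff)

lemma adj_mult: "adj (A ** B) = adj B ** adj A"
  by (simp add: mat22_eq_iff mat22_mult_nth mult.commute)

lemma det_adj: "det (adj A) = cnj (det A)"
  by (simp add: det_2 mult.commute)

lemma adj_diag2: "adj (diag2 x) = diag2 (cnj x)"
  by (simp add: mat22_eq_iff diag2_def)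

lemma SU2_iff:
  "A \<in> SU2 \<longleftrightarrow> A $ 2 $ 1 = - cnj (A $ 1 $ 2) \<and> A $ 2 $ 2 = cnj (A $ 1 $ 1) \<and> (norm (A $ 1 $ 1))\<^sup>2 + (norm (A $ 1 $ 2))\<^sup>2 = 1"
proof
  assume A: "A \<in> SU2"
  define a b c d where "a = A $ 1 $ 1" and "b = A $ 1 $ 2" and "c = A $ 2 $ 1" and "d = A $ 2 $ 2"
  note abcd = a_def[symmetric] b_def[symmetric] c_def[symmetric] d_def[symmetric]
  have det: "a * d - b * c = 1" and "adj A ** A = mat 1" using A by (auto simp: SU2_def det_2 abcd)
  then have o: "cnj a * a + cnj c * c = 1" "cnj a * b + cnj c * d = 0" "cnj b * a + cnj d * c = 0" "cnj b * b + cnj d * d = 1"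
    by (simp_all add: mat22_eq_iff mat22_mult_nth abcd)
  \<comment> \<open>The orthogonality relations and determinant 1 force \<open>adj A\<close> to be
    the adjugate of \<open>A\<close>. The identities for \<open>d\<close> and \<open>c\<close> are
    arranged so that these relations can be substituted.\<close>
  have "d = cnj a * (a * d - b * c) + c * (cnj a * b + cnj c * d) + d * (1 - (cnj a * a + cnj c * c))" by (simp add: algebra_simps)
  also have "\<dots> = cnj a" unfolding det o by simp
  finally have d: "d = cnj a" .
  have "c = c * (cnj b * b + cnj d * d)" using o by simp
  also have "\<dots> = - cnj b * (a * d - b * c) + d * (cnj b * a + cnj d * c)" by (simp add: algebra_simps)
  also have "\<dots> = - cnj b" unfolding det o by simp
  finally have c: "c = - cnj b" .
  have "complex_of_real ((norm a)\<^sup>2 + (norm b)\<^sup>2) = a * d - b * c"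
    unfolding of_real_add complex_norm_square by (simp add: c d)
  with det have "(norm a)\<^sup>2 + (norm b)\<^sup>2 = 1" by (metis of_real_eq_1_iff)
  with c d show "A $ 2 $ 1 = - cnj (A $ 1 $ 2) \<and> A $ 2 $ 2 = cnj (A $ 1 $ 1) \<and> (norm (A $ 1 $ 1))\<^sup>2 + (norm (A $ 1 $ 2))\<^sup>2 = 1"
    by (simp add: abcd)
next
  assume A: "A $ 2 $ 1 = - cnj (A $ 1 $ 2) \<and> A $ 2 $ 2 = cnj (A $ 1 $ 1) \<and> (norm (A $ 1 $ 1))\<^sup>2 + (norm (A $ 1 $ 2))\<^sup>2 = 1"
  then have "complex_of_real ((norm (A $ 1 $ 1))\<^sup>2 + (norm (A $ 1 $ 2))\<^sup>2) = 1" by simp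
  then have "A $ 1 $ 1 * cnj (A $ 1 $ 1) + A $ 1 $ 2 * cnj (A $ 1 $ 2) = 1"
    unfolding of_real_add complex_norm_square .
  with A show "A \<in> SU2"
    by (simp add: SU2_def mat22_eq_iff mat22_mult_nth det_2 algebra_simps)
qed

lemma SU2_adj_mult: "A \<in> SU2 \<Longrightarrow> adj A ** A = mat 1"
  by (simp add: SU2_def)

lemma SU2_mult_adj: "A \<in> SU2 \<Longrightarrow> A ** adj A = mat 1"
  using matrix_left_right_inverse[of "adj A" A] by (simp add: SU2_def)

lemma SU2_adj: "A \<in> SU2 \<Longrightarrow> adj A \<in> SU2"
  using SU2_mult_adj[of A] by (simp add: SU2_def det_adj)

lemma SU2_mult: "A \<in> SU2 \<Longrightarrow> B \<in> SU2 \<Longrightarrow> A ** B \<in> SU2"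
  by (auto simp: SU2_def adj_mult det_mul) (metis matrix_mul_assoc matrix_mul_lid)

lemma SU2_matrix_inv:
  assumes "A \<in> SU2"
  shows "matrix_inv A = adj A"
  unfolding matrix_inv_def
proof (rule some_equality)
  show "A ** adj A = mat 1 \<and> adj A ** A = mat 1"
    using assms by (simp add: SU2_adj_mult SU2_mult_adj)
  fix B assume "A ** B = mat 1 \<and> B ** A = mat 1"
  then show "B = adj A"
    using SU2_adj_mult[OF assms] by (metis matrix_mul_assoc matrix_mul_lid matrix_mul_rid)
qed

lemma continuous_adj: "continuous_on UNIV adj"
  unfolding adj_def by (intro continuous_intros)

lemma SU2_loop_adj:
  assumes "SU2_loop k"
  shows "SU2_loop (\<lambda>z. adj (k z))"
  using assms borel_measurable_continuous_on[OF continuous_adj, of k circle] SU2_adj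
  by (auto simp: SU2_loop_def)

lemma mat2_measurable:
  assumes [measurable]: "p \<in> borel_measurable M" "q \<in> borel_measurable M" "r \<in> borel_measurable M" "s \<in> borel_measurable M"
  shows "(\<lambda>z. mat2 (p z) (q z) (r z) (s z)) \<in> borel_measurable M"
proof -
  have eq: "mat2 a b c d = (\<chi> i j. if i = 1 then if j = 1 then a else b else if j = 1 then c else d)" for a b c d
    by (simp add: mat22_eq_iff)
  have "continuous_on UNIV (\<lambda>x. mat2 (fst x) (fst (snd x)) (fst (snd (snd x))) (snd (snd (snd x))))"
    unfolding eq
  proof (intro continuous_on_vec_lambda)
    fix i j :: 2
    show "continuous_on UNIV (\<lambda>x::complex \<times> complex \<times> complex \<times> complex. if i = 1 then if j = 1 then fst x else fst (snd x) else if j = 1 then fst (snd (snd x)) else snd (snd (snd x)))"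
      by (cases "i = 1"; cases "j = 1") (auto intro!: continuous_intros)
  qed
  from borel_measurable_continuous_on[OF this, of "\<lambda>z. (p z, q z, r z, s z)" M]
  show ?thesis by simp
qed

text \<open>The identity is a junk value, for the null set on which boundary values fail to be unit vectors.\<close>

definition SU2_of_row :: "complex \<Rightarrow> complex \<Rightarrow> mat22" where
  "SU2_of_row a b = (if (norm a)\<^sup>2 + (norm b)\<^sup>2 = 1 then mat2 a b (- cnj b) (cnj a) else mat 1)"

lemma SU2_of_row: "SU2_of_row a b \<in> SU2"
  by (simp add: SU2_of_row_def SU2_iff)

lemma SU2_loop_of_row:
  assumes [measurable]: "a \<in> borel_measurable circle" "b \<in> borel_measurable circle"
  shows "SU2_loop (\<lambda>z. SU2_of_row (a z) (b z))"
proof -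
  have [measurable]: "cnj \<in> borel_measurable borel"
    by (intro borel_measurable_continuous_onI continuous_intros)
  have [measurable]: "(\<lambda>z. mat2 (a z) (b z) (- cnj (b z)) (cnj (a z))) \<in> borel_measurable circle"
    by (intro mat2_measurable) measurable
  show ?thesis unfolding SU2_loop_def using SU2_of_row by (auto simp: SU2_of_row_def)
qed

section \<open>Closure properties of \<open>H2_disk\<close> and reflection in the circle\<close>

lemma H2_disk_cmult:
  assumes f: "H2_disk f F"
  shows "H2_disk (\<lambda>z. \<kappa> * f z) (\<lambda>z. \<kappa> * F z)"
proof -
  from f obtain C :: real where C: "\<And>r. 0 < r \<Longrightarrow> r < 1 \<Longrightarrow>
      (\<integral>\<^sup>+ z. ennreal ((norm (f (complex_of_real r * z)))\<^sup>2) \<partial>circle) \<le> ennreal C"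
    unfolding H2_disk_def by blast
  have hol: "f holomorphic_on ball 0 1" using f by (simp add: H2_disk_def)
  have [measurable]: "F \<in> borel_measurable circle" using f by (simp add: H2_disk_def L2_circle_def)
  show ?thesis
  proof (rule H2_diskI[where C="(norm \<kappa>)\<^sup>2 * \<bar>C\<bar>"])
    show "(\<lambda>z. \<kappa> * f z) holomorphic_on ball 0 1" by (intro holomorphic_intros hol)
    fix r :: real assume r: "0 < r" "r < 1"
    have [measurable]: "(\<lambda>z. f (of_real r * z)) \<in> borel_measurable circle"
      using r by (intro continuous_measurable_circle taylor_on_circle(3)[OF hol]) auto
    have "(\<integral>\<^sup>+ z. ennreal ((norm (\<kappa> * f (of_real r * z)))\<^sup>2) \<partial>circle) =
       ennreal ((norm \<kappa>)\<^sup>2) * (\<integral>\<^sup>+ z. ennreal ((norm (f (of_real r * z)))\<^sup>2) \<partial>circle)"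
      by (subst nn_integral_cmult[symmetric]) (auto simp: norm_mult power_mult_distrib ennreal_mult)
    also have "\<dots> \<le> ennreal ((norm \<kappa>)\<^sup>2) * ennreal \<bar>C\<bar>"
      by (intro mult_left_mono order.trans[OF C[OF r]] ennreal_leI) auto
    also have "\<dots> = ennreal ((norm \<kappa>)\<^sup>2 * \<bar>C\<bar>)" by (simp add: ennreal_mult)
    finally show "(\<integral>\<^sup>+ z. ennreal ((norm (\<kappa> * f (of_real r * z)))\<^sup>2) \<partial>circle) \<le> ennreal ((norm \<kappa>)\<^sup>2 * \<bar>C\<bar>)" .
  next
    show "inner_radial_limit (\<lambda>z. \<kappa> * f z) (\<lambda>z. \<kappa> * F z)"
      using f unfolding H2_disk_def inner_radial_limit_def
      by (auto elim!: eventually_mono intro!: tendsto_intros)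
  qed measurable
qed

lemma H2_disk_cong_AE:
  assumes f: "H2_disk f F" and G: "G \<in> borel_measurable circle" and eq: "AE z in circle. F z = G z"
  shows "H2_disk f G"
proof -
  from f obtain C :: real where C: "\<And>r. 0 < r \<Longrightarrow> r < 1 \<Longrightarrow>
      (\<integral>\<^sup>+ z. ennreal ((norm (f (complex_of_real r * z)))\<^sup>2) \<partial>circle) \<le> ennreal C"
    unfolding H2_disk_def by blast
  have "inner_radial_limit f F" "f holomorphic_on ball 0 1" using f by (auto simp: H2_disk_def)
  moreover from this(1) have "inner_radial_limit f G"
    unfolding inner_radial_limit_def using eq by eventually_elim simp
  ultimately show ?thesis by (intro H2_diskI[OF _ C G])
qed

text \<open>Division by a dominating function without zeros leaves a function bounded by 1, so its
  square means are at most the total mass \<open>2 * pi\<close>. Radial limits divide because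
  \<open>E\<close> is nonzero almost everywhere.\<close>

lemma H2_disk_quotient:
  assumes f: "H2_disk f F" and e: "H2_disk e E"
    and nz: "\<And>z. norm z < 1 \<Longrightarrow> e z \<noteq> 0" "AE z in circle. E z \<noteq> 0"
    and le: "\<And>z. norm z < 1 \<Longrightarrow> norm (f z) \<le> norm (e z)"
  shows "H2_disk (\<lambda>z. f z / e z) (\<lambda>z. F z / E z)"
proof (rule H2_diskI[where C="2 * pi"])
  have [measurable]: "F \<in> borel_measurable circle" "E \<in> borel_measurable circle"
    using f e by (auto simp: H2_disk_def L2_circle_def)
  show "(\<lambda>z. f z / e z) holomorphic_on ball 0 1"
    using f e nz(1) by (auto simp: H2_disk_def intro!: holomorphic_intros)
  show "(\<lambda>z. F z / E z) \<in> borel_measurable circle" by measurable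
  fix r :: real assume r: "0 < r" "r < 1"
  have "(\<integral>\<^sup>+ z. ennreal ((norm (f (of_real r * z) / e (of_real r * z)))\<^sup>2) \<partial>circle) \<le> (\<integral>\<^sup>+ z. 1 \<partial>circle)"
  proof (rule nn_integral_mono)
    fix z assume "z \<in> space circle"
    then have "norm (of_real r * z) < 1" using r by (simp add: norm_mult)
    then have "norm (f (of_real r * z) / e (of_real r * z)) \<le> 1"
      using le[of "of_real r * z"] nz(1)[of "of_real r * z"] by (simp add: norm_divide)
    then have "(norm (f (of_real r * z) / e (of_real r * z)))\<^sup>2 \<le> 1" by (simp add: power_le_one)
    then show "ennreal ((norm (f (of_real r * z) / e (of_real r * z)))\<^sup>2) \<le> 1" by simp
  qed
  also have "\<dots> = ennreal (2 * pi)" unfolding nn_integral_circle using emeasure_circle0 by simp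
  finally show "(\<integral>\<^sup>+ z. ennreal ((norm (f (of_real r * z) / e (of_real r * z)))\<^sup>2) \<partial>circle) \<le> ennreal (2 * pi)" .
next
  show "inner_radial_limit (\<lambda>z. f z / e z) (\<lambda>z. F z / E z)"
  proof -
    have "inner_radial_limit f F" "inner_radial_limit e E" using f e by (auto simp: H2_disk_def)
    then show ?thesis
      using nz(2) unfolding inner_radial_limit_def by eventually_elim (rule tendsto_divide)
  qed
qed

lemma cnj_measurable: "F \<in> borel_measurable M \<Longrightarrow> (\<lambda>z. cnj (F z)) \<in> borel_measurable M"
  by (rule borel_measurable_continuous_on[of cnj]) (intro continuous_intros)

lemma inverse_at_right_1: "filterlim (inverse :: real \<Rightarrow> real) (at_right 1) (at_left 1)"
  unfolding filterlim_at
proof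
  have "((inverse :: real \<Rightarrow> real) \<longlongrightarrow> inverse 1) (at_left 1)" by (intro tendsto_intros) auto
  then show "((inverse :: real \<Rightarrow> real) \<longlongrightarrow> 1) (at_left 1)" by simp
  have "eventually (\<lambda>r::real. r \<in> {0<..<1}) (at_left 1)" by (rule eventually_at_left_real) simp
  then show "\<forall>\<^sub>F x::real in at_left 1. inverse x \<in> {1<..} \<and> inverse x \<noteq> 1"
    by eventually_elim (auto simp: one_less_inverse_iff)
qed

text \<open>The map sending \<open>z\<close> to \<open>inverse (cnj z)\<close> fixes the circle and
  exchanges exterior and disk; conjugating the values restores holomorphy. Radius \<open>r\<close>
  becomes \<open>inverse r\<close> in the same direction, so means and limits carry over, and the
  value at infinity moves to 0.\<close>

lemma H2_exterior_reflect:
  assumes "H2_exterior f c F"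
  shows "H2_disk (\<lambda>z. if z = 0 then cnj c else cnj (f (inverse (cnj z)))) (\<lambda>z. cnj (F z))"
proof -
  define \<phi> where "\<phi> w = (if w = 0 then c else f (inverse w))" for w
  have eq: "(\<lambda>z. if z = 0 then cnj c else cnj (f (inverse (cnj z)))) = cnj \<circ> \<phi> \<circ> cnj"
    by (auto simp: \<phi>_def fun_eq_iff)
  from assms obtain C :: real where C: "\<And>r. 1 < r \<Longrightarrow>
      (\<integral>\<^sup>+ z. ennreal ((norm (f (complex_of_real r * z)))\<^sup>2) \<partial>circle) \<le> ennreal C"
    unfolding H2_exterior_def by blast
  have \<phi>: "\<phi> holomorphic_on ball 0 1" and F[measurable]: "F \<in> borel_measurable circle"
    and lim: "outer_radial_limit f F"
    using assms by (auto simp: H2_exterior_def holomorphic_exterior_def L2_circle_def \<phi>_def[abs_def])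
  have val: "(cnj \<circ> \<phi> \<circ> cnj) (of_real r * z) = cnj (f (of_real (inverse r) * z))" if "0 < r" "norm z = 1" for r z
  proof -
    have "z * cnj z = 1" using that by (simp add: complex_norm_square[symmetric])
    then have "inverse (cnj z) = z" by (metis inverse_unique mult.commute)
    moreover have "z \<noteq> 0" using that by auto
    ultimately show ?thesis using that by (simp add: \<phi>_def)
  qed
  show ?thesis unfolding eq
  proof (rule H2_diskI)
    show "cnj \<circ> \<phi> \<circ> cnj holomorphic_on ball 0 1"
    proof (rule holomorphic_on_compose_cnj_cnj)
      have "cnj ` ball 0 1 \<subseteq> ball 0 1" by auto
      then show "\<phi> holomorphic_on cnj ` ball 0 1" by (rule holomorphic_on_subset[OF \<phi>])
    qed simp
    show "(\<lambda>z. cnj (F z)) \<in> borel_measurable circle" by (rule cnj_measurable[OF F])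
    fix r :: real assume r: "0 < r" "r < 1"
    have "(\<integral>\<^sup>+ z. ennreal ((norm ((cnj \<circ> \<phi> \<circ> cnj) (of_real r * z)))\<^sup>2) \<partial>circle) =
       (\<integral>\<^sup>+ z. ennreal ((norm (f (of_real (inverse r) * z)))\<^sup>2) \<partial>circle)"
      using r by (intro nn_integral_cong) (simp del: o_apply add: val)
    also have "\<dots> \<le> ennreal C" using r by (intro C) (simp add: one_less_inverse_iff)
    finally show "(\<integral>\<^sup>+ z. ennreal ((norm ((cnj \<circ> \<phi> \<circ> cnj) (of_real r * z)))\<^sup>2) \<partial>circle) \<le> ennreal C" .
  next
    have circ: "AE z in circle. norm z = 1" by (rule AE_I2) simp
    show "inner_radial_limit (cnj \<circ> \<phi> \<circ> cnj) (\<lambda>z. cnj (F z))"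
      using lim circ unfolding inner_radial_limit_def outer_radial_limit_def
    proof eventually_elim
      case (elim z)
      have "((\<lambda>r. cnj (f (of_real (inverse r) * z))) \<longlongrightarrow> cnj (F z)) (at_left 1)"
        by (intro tendsto_cnj filterlim_compose[OF elim(1) inverse_at_right_1])
      moreover have "eventually (\<lambda>r::real. r \<in> {0<..<1}) (at_left 1)" by (rule eventually_at_left_real) simp
      then have "eventually (\<lambda>r. cnj (f (of_real (inverse r) * z)) = (cnj \<circ> \<phi> \<circ> cnj) (of_real r * z)) (at_left 1)"
        by eventually_elim (use elim val in auto)
      ultimately show ?case by (rule Lim_transform_eventually)
    qed
  qed
qed

text \<open>A continuous logarithm differs from the principal one by a locally constant multiple of \<open>2 * pi * \<i>\<close>.\<close>

lemma continuous_log_limit: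
  fixes \<gamma> :: "real \<Rightarrow> complex"
  assumes cont: "continuous_on {0<..<1} \<gamma>" and lim: "((\<lambda>r. exp (\<gamma> r)) \<longlongrightarrow> B) (at_left 1)" and B: "B \<noteq> 0"
  shows "\<exists>L. (\<gamma> \<longlongrightarrow> L) (at_left 1) \<and> exp L = B"
proof -
  obtain b where b: "exp b = B" using B exp_Ln by blast
  define \<delta> where "\<delta> r = exp (\<gamma> r - b)" for r
  have "((\<lambda>r. exp (\<gamma> r) / exp b) \<longlongrightarrow> B / exp b) (at_left 1)" using B b by (intro tendsto_intros lim) auto
  then have \<delta>: "(\<delta> \<longlongrightarrow> 1) (at_left 1)" using b B by (simp add: \<delta>_def[abs_def] exp_diff)
  have "eventually (\<lambda>r. dist (\<delta> r) 1 < 1) (at_left 1)" using \<delta> by (rule tendstoD) simp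
  moreover have "eventually (\<lambda>r::real. r \<in> {0<..<1}) (at_left 1)" by (rule eventually_at_left_real) simp
  ultimately have "eventually (\<lambda>r. dist (\<delta> r) 1 < 1 \<and> r \<in> {0<..<1}) (at_left 1)" by eventually_elim simp
  then obtain r0 where r0: "r0 < 1" "\<And>r. r0 < r \<Longrightarrow> r < 1 \<Longrightarrow> dist (\<delta> r) 1 < 1 \<and> r \<in> {0<..<1}"
    unfolding eventually_at_left_field by blast
  \<comment> \<open>Within distance 1 of 1 the function \<open>\<delta>\<close> avoids the branch
    cut, so \<open>Ln\<close> is continuous along it.\<close>
  have pos: "\<delta> r \<notin> \<real>\<^sub>\<le>\<^sub>0" if "r0 < r" "r < 1" for r
  proof
    assume "\<delta> r \<in> \<real>\<^sub>\<le>\<^sub>0"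
    then have "1 \<le> Re (1 - \<delta> r)" by (auto simp: complex_nonpos_Reals_iff)
    also have "\<dots> \<le> norm (1 - \<delta> r)" by (rule complex_Re_le_cmod)
    finally show False using r0(2)[OF that] by (simp add: dist_norm norm_minus_commute)
  qed
  define \<nu> where "\<nu> r = \<gamma> r - b - Ln (\<delta> r)" for r
  have "\<nu> constant_on {r0<..<1}"
  proof (rule continuous_discrete_range_constant)
    have sub: "{r0<..<1} \<subseteq> {0<..<1}" using r0(2) by auto
    then show "continuous_on {r0<..<1} \<nu>"
      unfolding \<nu>_def using pos unfolding \<delta>_def
      by (intro continuous_intros continuous_on_subset[OF cont]) auto
    have e1: "exp (\<nu> r) = 1" for r
      by (simp add: \<nu>_def exp_diff[of "\<gamma> r - b"] \<delta>_def)
    show "\<exists>e>0. \<forall>y. y \<in> {r0<..<1} \<and> \<nu> y \<noteq> \<nu> x \<longrightarrow> e \<le> norm (\<nu> y - \<nu> x)" for x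
    proof (intro exI[of _ "2 * pi"] conjI allI impI)
      fix y assume ne: "y \<in> {r0<..<1} \<and> \<nu> y \<noteq> \<nu> x"
      obtain m n :: int where "Re (\<nu> x) = 0" "Im (\<nu> x) = of_int (2 * m) * pi" "Re (\<nu> y) = 0" "Im (\<nu> y) = of_int (2 * n) * pi"
        using e1[of x] e1[of y] unfolding exp_eq_1 by blast
      then have d: "Im (\<nu> y - \<nu> x) = 2 * pi * of_int (n - m)" and "n \<noteq> m"
        using ne by (auto simp: algebra_simps complex_eq_iff)
      then have "1 \<le> \<bar>real_of_int (n - m)\<bar>" by linarith
      then have "2 * pi \<le> \<bar>Im (\<nu> y - \<nu> x)\<bar>" unfolding d abs_mult by simp
      also have "\<dots> \<le> norm (\<nu> y - \<nu> x)" by (rule abs_Im_le_cmod)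
      finally show "2 * pi \<le> norm (\<nu> y - \<nu> x)" .
    qed simp
  qed simp
  then obtain c where c: "\<And>r. r0 < r \<Longrightarrow> r < 1 \<Longrightarrow> \<nu> r = c" by (auto simp: constant_on_def)
  have "((\<lambda>r. c + b + Ln (\<delta> r)) \<longlongrightarrow> c + b + Ln 1) (at_left 1)"
    by (intro tendsto_intros \<delta>) auto
  moreover have "eventually (\<lambda>r. r \<in> {r0<..<1}) (at_left 1)" using r0(1) by (rule eventually_at_left_real)
  then have "eventually (\<lambda>r. c + b + Ln (\<delta> r) = \<gamma> r) (at_left 1)"
    by eventually_elim (use c in \<open>auto simp: \<nu>_def algebra_simps\<close>)
  ultimately have L: "(\<gamma> \<longlongrightarrow> c + b + Ln 1) (at_left 1)" by (rule Lim_transform_eventually)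
  then have "((\<lambda>r. exp (\<gamma> r)) \<longlongrightarrow> exp (c + b + Ln 1)) (at_left 1)" by (intro tendsto_intros)
  then have "exp (c + b + Ln 1) = B" using lim by (intro tendsto_unique[OF trivial_limit_at_left_real])
  with L show ?thesis by blast
qed

section \<open>Root subgroup factorization\<close>

text \<open>Eliminating the first row of \<open>U\<close> from \<open>g\<close> by means of the
  first column of \<open>adj V\<close> leaves, since the determinant is 1, the second row of
  \<open>U\<close> divided by \<open>m0 * a0\<close>. The combination has the length of that column
  because \<open>g\<close> is unitary.\<close>

lemma triangular_row_norm:
  fixes g V U :: mat22 and a0 :: real
  assumes g: "g \<in> SU2" and V: "det V = 1" and m0: "norm m0 = 1" and a0: "0 < a0"
    and eq: "g = adj V ** diag2 m0 ** diag2 (of_real a0) ** U"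
  shows "norm (U $ 2 $ 2, U $ 2 $ 1) = a0 * norm (V $ 1 $ 1, V $ 1 $ 2)"
proof -
  define p q where "p = g $ 1 $ 1" and "q = g $ 1 $ 2"
  define s t where "s = cnj (V $ 1 $ 1)" and "t = cnj (V $ 1 $ 2)"
  define \<mu> where "\<mu> = m0 * of_real a0"
  have \<mu>: "\<mu> \<noteq> 0" "norm \<mu> = a0" using m0 a0 by (auto simp: \<mu>_def norm_mult)
  have pq: "(norm p)\<^sup>2 + (norm q)\<^sup>2 = 1" and g2: "g $ 2 $ 1 = - cnj q" "g $ 2 $ 2 = cnj p"
    using g unfolding SU2_iff by (auto simp: p_def q_def)
  have "cnj (det V) = 1" using V by simp
  then have det: "s * cnj (V $ 2 $ 2) - cnj (V $ 2 $ 1) * t = 1"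
    by (simp add: det_2 s_def t_def mult.commute)
  have gj: "g $ 1 $ j = s * \<mu> * U $ 1 $ j + cnj (V $ 2 $ 1) * inverse \<mu> * U $ 2 $ j"
    "g $ 2 $ j = t * \<mu> * U $ 1 $ j + cnj (V $ 2 $ 2) * inverse \<mu> * U $ 2 $ j" for j
    by (simp_all add: eq mat22_mult_nth diag2_def s_def t_def \<mu>_def mult_ac)
  have row: "s * g $ 2 $ j - t * g $ 1 $ j = inverse \<mu> * U $ 2 $ j" for j
  proof -
    have "s * g $ 2 $ j - t * g $ 1 $ j = (s * cnj (V $ 2 $ 2) - cnj (V $ 2 $ 1) * t) * (inverse \<mu> * U $ 2 $ j)"
      unfolding gj by (simp add: algebra_simps)
    then show ?thesis by (simp add: det)
  qed
  \<comment> \<open>The vector \<open>(-t, s)\<close> is multiplied by a matrix of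
    \<open>SU2\<close> shape; the cross terms of the two squares cancel.\<close>
  have id: "(norm (- s * cnj q - t * p))\<^sup>2 + (norm (s * cnj p - t * q))\<^sup>2 = ((norm s)\<^sup>2 + (norm t)\<^sup>2) * ((norm p)\<^sup>2 + (norm q)\<^sup>2)"
  proof -
    have "complex_of_real ((norm (- s * cnj q - t * p))\<^sup>2 + (norm (s * cnj p - t * q))\<^sup>2) =
          complex_of_real (((norm s)\<^sup>2 + (norm t)\<^sup>2) * ((norm p)\<^sup>2 + (norm q)\<^sup>2))"
      unfolding of_real_add of_real_mult complex_norm_square by (simp add: algebra_simps)
    then show ?thesis by (simp only: of_real_eq_iff)
  qed
  have "(norm (inverse \<mu> * U $ 2 $ 1))\<^sup>2 + (norm (inverse \<mu> * U $ 2 $ 2))\<^sup>2 = (norm s)\<^sup>2 + (norm t)\<^sup>2"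
    using id unfolding pq row[symmetric] g2 p_def[symmetric] q_def[symmetric] by simp
  then have "((norm (U $ 2 $ 1))\<^sup>2 + (norm (U $ 2 $ 2))\<^sup>2) / a0\<^sup>2 = (norm s)\<^sup>2 + (norm t)\<^sup>2"
    by (simp add: norm_mult norm_inverse \<mu>(2) power_mult_distrib power_inverse divide_inverse algebra_simps)
  then have "(norm (U $ 2 $ 2))\<^sup>2 + (norm (U $ 2 $ 1))\<^sup>2 = a0\<^sup>2 * ((norm s)\<^sup>2 + (norm t)\<^sup>2)"
    using a0 by (simp add: field_simps)
  then show ?thesis
    using a0 unfolding norm_Pair by (simp add: real_sqrt_mult s_def t_def)
qed

lemma root_subgroup_pointwise:
  fixes g V U :: mat22 and a0 :: real
  assumes g: "g \<in> SU2" and V: "det V = 1" and U: "det U = 1" and m0: "norm m0 = 1" and a0: "0 < a0"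
    and eq: "g = adj V ** diag2 m0 ** diag2 (of_real a0) ** U"
    and e: "e \<noteq> 0" "norm e = norm (U $ 2 $ 2, U $ 2 $ 1)"
  defines "k1 \<equiv> SU2_of_row (of_real a0 * V $ 1 $ 1 / e) (of_real a0 * V $ 1 $ 2 / e)"
    and "k2 \<equiv> SU2_of_row (cnj (U $ 2 $ 2 / e)) (- cnj (U $ 2 $ 1 / e))"
    and "x \<equiv> m0 * cnj e / e"
  shows "k1 = mat2 (of_real a0 * V $ 1 $ 1 / e) (of_real a0 * V $ 1 $ 2 / e)
                (- cnj (of_real a0 * V $ 1 $ 2 / e)) (cnj (of_real a0 * V $ 1 $ 1 / e))"
    and "k2 = mat2 (cnj (U $ 2 $ 2 / e)) (- cnj (U $ 2 $ 1 / e)) (U $ 2 $ 1 / e) (U $ 2 $ 2 / e)"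
    and "g = adj k1 ** mat2 x 0 0 (inverse x) ** k2"
proof -
  define A B C D where "A = of_real a0 * V $ 1 $ 1 / e" and "B = of_real a0 * V $ 1 $ 2 / e"
    and "C = U $ 2 $ 1 / e" and "D = U $ 2 $ 2 / e"
  have ne: "0 < norm e" using e(1) by simp
  have V2: "(norm e)\<^sup>2 = a0\<^sup>2 * ((norm (V $ 1 $ 1))\<^sup>2 + (norm (V $ 1 $ 2))\<^sup>2)"
    unfolding e(2) triangular_row_norm[OF g V m0 a0 eq] by (simp add: power_mult_distrib norm_Pair)
  have U2: "(norm e)\<^sup>2 = (norm (U $ 2 $ 2))\<^sup>2 + (norm (U $ 2 $ 1))\<^sup>2"
    unfolding e(2) by (simp add: norm_Pair)
  have "(norm A)\<^sup>2 + (norm B)\<^sup>2 = a0\<^sup>2 * ((norm (V $ 1 $ 1))\<^sup>2 + (norm (V $ 1 $ 2))\<^sup>2) / (norm e)\<^sup>2"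
    using a0 by (simp add: A_def B_def norm_divide norm_mult power_divide power_mult_distrib add_divide_distrib algebra_simps)
  also have "\<dots> = 1" unfolding V2[symmetric] using ne by simp
  finally have AB: "(norm A)\<^sup>2 + (norm B)\<^sup>2 = 1" .
  have "(norm C)\<^sup>2 + (norm D)\<^sup>2 = ((norm (U $ 2 $ 2))\<^sup>2 + (norm (U $ 2 $ 1))\<^sup>2) / (norm e)\<^sup>2"
    by (simp add: C_def D_def norm_divide power_divide add_divide_distrib)
  also have "\<dots> = 1" unfolding U2[symmetric] using ne by simp
  finally have CD: "(norm C)\<^sup>2 + (norm D)\<^sup>2 = 1" .
  have k1: "k1 = mat2 A B (- cnj B) (cnj A)"
    using AB unfolding k1_def A_def[symmetric] B_def[symmetric] SU2_of_row_def by simp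
  have k2: "k2 = mat2 (cnj D) (- cnj C) C D"
    using CD unfolding k2_def C_def[symmetric] D_def[symmetric] SU2_of_row_def by (simp add: add.commute)
  show "k1 = mat2 (of_real a0 * V $ 1 $ 1 / e) (of_real a0 * V $ 1 $ 2 / e)
                (- cnj (of_real a0 * V $ 1 $ 2 / e)) (cnj (of_real a0 * V $ 1 $ 1 / e))"
    using k1 unfolding A_def B_def .
  show "k2 = mat2 (cnj (U $ 2 $ 2 / e)) (- cnj (U $ 2 $ 1 / e)) (U $ 2 $ 1 / e) (U $ 2 $ 2 / e)"
    using k2 unfolding C_def D_def .
  have k12: "k1 \<in> SU2" "k2 \<in> SU2" by (simp_all add: k1_def k2_def SU2_of_row)
  have "cnj e \<noteq> 0" using e by simp
  \<comment> \<open>The second row of \<open>k1\<close> annihilates the conjugated first row of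
    \<open>V\<close>, and the second row of \<open>U\<close> is \<open>e\<close> times that of
    \<open>k2\<close>. Both \<open>X\<close> and \<open>Y\<close> are therefore upper triangular,
    with lower right entries given by \<open>det V\<close> and \<open>e\<close>.\<close>
  define X where "X = k1 ** adj V"
  define Y where "Y = U ** adj k2"
  have VA: "V $ 1 $ 1 = e * A / of_real a0" "V $ 1 $ 2 = e * B / of_real a0"
    using e a0 by (simp_all add: A_def B_def)
  have UC: "U $ 2 $ 1 = e * C" "U $ 2 $ 2 = e * D" using e by (simp_all add: C_def D_def)
  have "X $ 2 $ 1 = 0" using a0 by (simp add: X_def k1 mat22_mult_nth VA)
  have "X $ 2 $ 2 = of_real a0 / cnj e * cnj (det V)"
    using e a0 by (simp add: X_def k1 mat22_mult_nth det_2 A_def B_def field_simps)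
  then have X22: "X $ 2 $ 2 = of_real a0 / cnj e" by (simp add: V)
  have Y21: "Y $ 2 $ 1 = 0" by (simp add: Y_def k2 mat22_mult_nth UC)
  have "C * cnj C + D * cnj D = complex_of_real ((norm C)\<^sup>2 + (norm D)\<^sup>2)"
    unfolding of_real_add complex_norm_square ..
  then have "C * cnj C + D * cnj D = 1" unfolding CD by simp
  then have "e * (C * cnj C + D * cnj D) = e" by simp
  then have Y22: "Y $ 2 $ 2 = e" by (simp add: Y_def k2 mat22_mult_nth UC algebra_simps)
  define T where "T = k1 ** g ** adj k2"
  have TXY: "T = X ** diag2 m0 ** diag2 (of_real a0) ** Y"
    by (simp add: T_def X_def Y_def eq matrix_mul_assoc)
  have T21: "T $ 2 $ 1 = 0"
    using \<open>X $ 2 $ 1 = 0\<close> Y21 by (simp add: TXY mat22_mult_nth diag2_def)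
  have T22: "T $ 2 $ 2 = inverse x"
  proof -
    have "T $ 2 $ 2 = (of_real a0 / cnj e) * inverse m0 * inverse (of_real a0) * e"
      using \<open>X $ 2 $ 1 = 0\<close> by (simp add: TXY mat22_mult_nth diag2_def X22 Y22)
    also have "\<dots> = inverse x" using a0 by (simp add: x_def divide_inverse)
    finally show ?thesis .
  qed
  have nx: "norm x = 1" using e(1) m0 by (simp add: x_def norm_mult norm_divide)
  have TS: "T \<in> SU2" unfolding T_def by (intro SU2_mult SU2_adj k12 g)
  \<comment> \<open>The second row of a matrix in \<open>SU2\<close> determines the first, so the
    remaining entries follow from the two just computed.\<close>
  have "T $ 1 $ 1 = cnj (T $ 2 $ 2)" "T $ 1 $ 2 = 0"
    using TS T21 unfolding SU2_iff by auto
  moreover have "cnj (inverse x) = x"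
  proof -
    have "x * cnj x = 1" using nx by (simp add: complex_norm_square[symmetric])
    then show ?thesis by (metis complex_cnj_inverse inverse_inverse_eq inverse_unique)
  qed
  ultimately have T: "T = mat2 x 0 0 (inverse x)"
    using T21 T22 by (simp add: mat22_eq_iff)
  have "adj k1 ** T ** k2 = (adj k1 ** k1) ** g ** (adj k2 ** k2)"
    by (simp add: T_def matrix_mul_assoc)
  also have "\<dots> = g" using k12 by (simp add: SU2_adj_mult)
  finally show "g = adj k1 ** mat2 x 0 0 (inverse x) ** k2" by (simp add: T)
qed

text \<open>The conditions on \<open>u\<close>. The reflected adjoint of \<open>l\<close> satisfies
  the same ones, as taking adjoints turns lower triangular at infinity into upper triangular at
  0.\<close>

definition SL2_H2 :: "(complex \<Rightarrow> mat22) \<Rightarrow> (complex \<Rightarrow> mat22) \<Rightarrow> bool" where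
  "SL2_H2 u ub \<longleftrightarrow> (\<forall>i j. H2_disk (\<lambda>z. u z $ i $ j) (\<lambda>z. ub z $ i $ j)) \<and>
     (\<forall>z\<in>ball 0 1. det (u z) = 1) \<and> u 0 $ 1 $ 1 = 1 \<and> u 0 $ 2 $ 2 = 1 \<and> u 0 $ 2 $ 1 = 0"

lemma SL2_H2_boundary:
  assumes "SL2_H2 u ub"
  shows "AE z in circle. det (ub z) = 1"
proof -
  have lim: "AE z in circle. (\<lambda>n. u (of_real (radii n) * z) $ i $ j) \<longlonglongrightarrow> ub z $ i $ j" for i j
    using assms by (intro H2_disk_radii) (auto simp: SL2_H2_def H2_disk_def)
  have circ: "AE z in circle. norm z = 1" by (rule AE_I2) simp
  show ?thesis
    using lim[of 1 1] lim[of 1 2] lim[of 2 1] lim[of 2 2] circ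
  proof eventually_elim
    case (elim z)
    have "(\<lambda>n. det (u (of_real (radii n) * z))) \<longlonglongrightarrow> det (ub z)"
      unfolding det_2 by (intro tendsto_intros elim)
    moreover have "det (u (of_real (radii n) * z)) = 1" for n
      using assms radii[of n] elim by (simp add: SL2_H2_def norm_mult)
    ultimately show ?case by (simp add: LIMSEQ_const_iff)
  qed
qed

text \<open>The value of the outer function at 0 is real, so dividing by it does not change the
  quotient \<open>cnj (B z) / B z\<close>. An argument of \<open>m0\<close> supplies the constant
  term of the exponent.\<close>

lemma torus_exponent_exists:
  assumes h: "integrable circle h" and B: "H2_disk (\<lambda>z. exp (herglotz h z)) B"
    and nz: "AE z in circle. B z \<noteq> 0" and m0: "norm m0 = 1"
  shows "\<exists>t. torus_exponent t \<and> (AE z in circle. exp (t z) = m0 * cnj (B z) / B z)"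
proof -
  note hol = holomorphic_herglotz[OF h]
  define p where "p z = herglotz h 0 - herglotz h z" for z
  have holp: "p holomorphic_on ball 0 1" unfolding p_def by (intro holomorphic_intros hol)
  define e0 where "e0 = exp (herglotz h 0)"
  have e0: "e0 \<noteq> 0" "cnj e0 = e0" by (simp_all add: e0_def exp_cnj herglotz_0)
  define P where "P z = lim (\<lambda>n. p (of_real (radii n) * z))" for z
  have [measurable]: "P \<in> borel_measurable circle"
    unfolding P_def by (intro borel_measurable_lim_metric holomorphic_radii_measurable holp)
  have circ: "AE z in circle. norm z = 1" by (rule AE_I2) simp
  have limB: "AE z in circle. ((\<lambda>r. exp (herglotz h (of_real r * z))) \<longlongrightarrow> B z) (at_left 1)"
    using B by (simp add: H2_disk_def inner_radial_limit_def)
  have limP: "AE z in circle. ((\<lambda>r. p (of_real r * z)) \<longlongrightarrow> P z) (at_left 1) \<and> exp (- P z) = B z / e0"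
    using limB nz circ
  proof eventually_elim
    case (elim z)
    have "continuous_on {0<..<1} (\<lambda>r. herglotz h (of_real r * z))"
      by (rule continuous_on_compose2[OF holomorphic_on_imp_continuous_on[OF hol]])
         (use elim in \<open>auto intro!: continuous_intros simp: norm_mult\<close>)
    from continuous_log_limit[OF this elim(1,2)] obtain L where
      L: "((\<lambda>r. herglotz h (of_real r * z)) \<longlongrightarrow> L) (at_left 1)" "exp L = B z" by blast
    have pL: "((\<lambda>r. p (of_real r * z)) \<longlongrightarrow> herglotz h 0 - L) (at_left 1)"
      unfolding p_def by (intro tendsto_intros L)
    then have "(\<lambda>n. p (of_real (radii n) * z)) \<longlonglongrightarrow> herglotz h 0 - L"
      by (rule filterlim_compose[OF _ radii_at_left])
    then have "P z = herglotz h 0 - L" unfolding P_def by (rule limI)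
    with pL L show ?case by (simp add: e0_def exp_diff)
  qed
  define \<theta> where "\<theta> = Arg m0"
  have \<theta>: "exp (\<i> * of_real \<theta>) = m0" using m0 unfolding \<theta>_def complex_norm_eq_1_exp_eq .
  \<comment> \<open>Purely imaginary at every point of the circle, also where \<open>P\<close> is an
    arbitrary value of \<open>lim\<close>.\<close>
  define t where "t z = - cnj (P z) + \<i> * of_real \<theta> + P z" for z
  have [measurable]: "(\<lambda>z. cnj (P z)) \<in> borel_measurable circle" by (intro cnj_measurable) measurable
  have "H2_disk (\<lambda>z. exp (- p z)) (\<lambda>z. exp (- P z))"
  proof (rule H2_disk_cong_AE)
    have "exp (- p z) = (1 / e0) * exp (herglotz h z)" for z
      by (simp add: p_def e0_def exp_diff)
    then show "H2_disk (\<lambda>z. exp (- p z)) (\<lambda>z. (1 / e0) * B z)"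
      using H2_disk_cmult[OF B, of "1 / e0"] by simp
    show "(\<lambda>z. exp (- P z)) \<in> borel_measurable circle"
      by (rule borel_measurable_continuous_on[of "\<lambda>w. exp (- w)"]) (auto intro!: continuous_intros)
    show "AE z in circle. 1 / e0 * B z = exp (- P z)"
      using limP by eventually_elim simp
  qed
  moreover have "inner_radial_limit p P"
    unfolding inner_radial_limit_def using limP by eventually_elim simp
  ultimately have "torus_exponent t"
    unfolding torus_exponent_def
    by (intro conjI exI[of _ "\<i> * of_real \<theta>"] exI[of _ p] exI[of _ P]) 
       (auto simp: t_def[abs_def] holp p_def[of 0])
  moreover have "AE z in circle. exp (t z) = m0 * cnj (B z) / B z"
    using limP nz
  proof eventually_elim
    case (elim z)
    have "exp (t z) = exp (- cnj (P z)) * m0 * exp (P z)"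
      by (simp only: t_def exp_add \<theta>)
    also have "exp (- cnj (P z)) = cnj (exp (- P z))" by (simp add: exp_cnj)
    also have "exp (P z) = inverse (exp (- P z))" by (simp add: exp_minus)
    finally show ?case using elim e0 by (simp add: field_simps)
  qed
  ultimately show ?thesis by blast
qed

lemma herglotz_add_const:
  assumes h: "integrable circle h" and z: "norm z < 1"
  shows "Re (herglotz (\<lambda>w. h w + c) z) = Re (herglotz h z) + c"
proof -
  have i: "integrable circle (\<lambda>w. h w * poisson z w)" "integrable circle (poisson z)"
    by (intro integrable_circle_mult_continuous integrable_circle_continuous continuous_poisson z h)+
  have hc: "integrable circle (\<lambda>w. h w + c)" using h by simp
  have "(\<integral>w. (h w + c) * poisson z w \<partial>circle) = (\<integral>w. h w * poisson z w + c * poisson z w \<partial>circle)"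
    by (simp add: algebra_simps)
  also have "\<dots> = (\<integral>w. h w * poisson z w \<partial>circle) + c * (2 * pi)"
    using i by (simp add: integral_poisson[OF z])
  finally show ?thesis unfolding Re_herglotz[OF hc z] Re_herglotz[OF h z] by (simp add: add_divide_distrib)
qed

theorem root_subgroup_factorization:
  fixes g v vb u ub :: "complex \<Rightarrow> mat22" and a0 :: real
  assumes g: "SU2_loop g" and v: "SL2_H2 v vb" and u: "SL2_H2 u ub"
    and m0: "norm m0 = 1" and a0: "0 < a0"
    and eq: "AE z in circle. g z = adj (vb z) ** diag2 m0 ** diag2 (complex_of_real a0) ** ub z"
  shows "\<exists>k1 k2 h. form_I1 k1 \<and> form_II1 k2 \<and> torus_exponent h \<and>
            (AE z in circle. g z = adj (k1 z) ** mat2 (exp (h z)) 0 0 (exp (- h z)) ** k2 z)"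
proof -
  have gS: "AE z in circle. g z \<in> SU2" using g by (intro AE_I2) (simp add: SU2_loop_def)
  have uH: "H2_disk (\<lambda>z. u z $ i $ j) (\<lambda>z. ub z $ i $ j)" and vH: "H2_disk (\<lambda>z. v z $ i $ j) (\<lambda>z. vb z $ i $ j)" for i j
    using u v by (auto simp: SL2_H2_def)
  \<comment> \<open>The second row of \<open>u\<close> is read backwards, which makes it the upper
    row of a determinant equal to 1 with the reversed first row as its completion.\<close>
  have udet: "u z $ 2 $ 2 * u z $ 1 $ 1 - u z $ 2 $ 1 * u z $ 1 $ 2 = 1"
    and vdet: "v z $ 1 $ 1 * v z $ 2 $ 2 - v z $ 1 $ 2 * v z $ 2 $ 1 = 1" if "norm z < 1" for z
    using u v that by (auto simp: SL2_H2_def det_2 algebra_simps)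
  note outU = outer_function_of_row[OF uH uH uH uH]
  note outV = outer_function_of_row[OF vH vH vH vH]
  define hu where "hu z = ln (norm (ub z $ 2 $ 2, ub z $ 2 $ 1))" for z
  define hv where "hv z = ln (norm (vb z $ 1 $ 1, vb z $ 1 $ 2))" for z
  have hu: "integrable circle hu" unfolding hu_def by (rule outU(1)) (rule udet)
  have hv: "integrable circle hv" unfolding hv_def by (rule outV(1)) (rule vdet)
  have uE: "norm (u z $ 2 $ 2, u z $ 2 $ 1) \<le> norm (exp (herglotz hu z))" if "norm z < 1" for z
    unfolding hu_def by (rule outU(2)[OF _ that]) (rule udet)
  have vE: "norm (v z $ 1 $ 1, v z $ 1 $ 2) \<le> norm (exp (herglotz hv z))" if "norm z < 1" for z
    unfolding hv_def by (rule outV(2)[OF _ that]) (rule vdet)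
  obtain B where B: "H2_disk (\<lambda>z. exp (herglotz hu z)) B"
    "AE z in circle. B z \<noteq> 0 \<and> norm (B z) = norm (ub z $ 2 $ 2, ub z $ 2 $ 1)"
  proof -
    have "\<exists>B. H2_disk (\<lambda>z. exp (herglotz hu z)) B \<and> (AE z in circle. B z \<noteq> 0 \<and> norm (B z) = norm (ub z $ 2 $ 2, ub z $ 2 $ 1))"
      unfolding hu_def by (rule outU(3)) (rule udet)
    then show thesis using that by blast
  qed
  have Bnz: "AE z in circle. B z \<noteq> 0" using B(2) by eventually_elim simp
  have rows: "AE z in circle. norm (ub z $ 2 $ 2, ub z $ 2 $ 1) = a0 * norm (vb z $ 1 $ 1, vb z $ 1 $ 2)"
    using gS SL2_H2_boundary[OF v] eq
    by eventually_elim (rule triangular_row_norm[OF _ _ m0 a0])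
  \<comment> \<open>The logarithms of the two row lengths differ by a constant, so the moduli of
    their outer functions differ by the factor \<open>a0\<close> throughout the disk. One outer
    function thus dominates both the row of \<open>u\<close> and \<open>a0\<close> times the row of
    \<open>v\<close>.\<close>
  have "AE z in circle. hu z = hv z + ln a0"
    using rows B(2)
  proof eventually_elim
    case (elim z)
    then have "0 < norm (ub z $ 2 $ 2, ub z $ 2 $ 1)" by (metis norm_le_zero_iff not_le)
    then have "0 < norm (vb z $ 1 $ 1, vb z $ 1 $ 2)" using elim(1) a0 by (simp add: zero_less_mult_iff)
    then show ?case unfolding hu_def hv_def elim(1) using a0 by (simp add: ln_mult)
  qed
  then have herglotzE: "norm (exp (herglotz hu z)) = a0 * norm (exp (herglotz hv z))" if "norm z < 1" for z
  proof -
    have "herglotz hu z = herglotz (\<lambda>w. hv w + ln a0) z"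
      using hu hv that \<open>AE z in circle. hu z = hv z + ln a0\<close> by (intro herglotz_cong_AE) auto
    then have "Re (herglotz hu z) = Re (herglotz hv z) + ln a0" using herglotz_add_const[OF hv that] by simp
    then show ?thesis using a0 by (simp add: exp_add)
  qed
  have vE': "norm (of_real a0 * v z $ 1 $ 1, of_real a0 * v z $ 1 $ 2) \<le> norm (exp (herglotz hu z))" if "norm z < 1" for z
  proof -
    have "norm (of_real a0 * v z $ 1 $ 1, of_real a0 * v z $ 1 $ 2) = a0 * norm (v z $ 1 $ 1, v z $ 1 $ 2)"
      using a0 by (simp add: norm_Pair norm_mult power_mult_distrib real_sqrt_mult flip: distrib_left)
    also have "\<dots> \<le> norm (exp (herglotz hu z))" unfolding herglotzE[OF that] using a0 vE[OF that] by simp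
    finally show ?thesis .
  qed
  have fst_snd: "norm x \<le> norm (x, y)" "norm y \<le> norm (x, y)" for x y :: complex
    using norm_fst_le[of x y] norm_snd_le[of y x] by auto
  have quot: "H2_disk (\<lambda>z. of_real a0 * v z $ 1 $ 1 / exp (herglotz hu z)) (\<lambda>z. of_real a0 * vb z $ 1 $ 1 / B z)"
    "H2_disk (\<lambda>z. of_real a0 * v z $ 1 $ 2 / exp (herglotz hu z)) (\<lambda>z. of_real a0 * vb z $ 1 $ 2 / B z)"
    "H2_disk (\<lambda>z. u z $ 2 $ 1 / exp (herglotz hu z)) (\<lambda>z. ub z $ 2 $ 1 / B z)"
    "H2_disk (\<lambda>z. u z $ 2 $ 2 / exp (herglotz hu z)) (\<lambda>z. ub z $ 2 $ 2 / B z)"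
    using order.trans[OF fst_snd(1) vE'] order.trans[OF fst_snd(2) vE']
      order.trans[OF fst_snd(1) uE] order.trans[OF fst_snd(2) uE]
    by (intro H2_disk_quotient H2_disk_cmult uH vH B(1) Bnz; simp)+
  have meas: "F \<in> borel_measurable circle" if "H2_disk f F" for f F
    using that by (simp add: H2_disk_def L2_circle_def)
  define k1 where "k1 z = SU2_of_row (of_real a0 * vb z $ 1 $ 1 / B z) (of_real a0 * vb z $ 1 $ 2 / B z)" for z
  define k2 where "k2 z = SU2_of_row (cnj (ub z $ 2 $ 2 / B z)) (- cnj (ub z $ 2 $ 1 / B z))" for z
  obtain t where t: "torus_exponent t" "AE z in circle. exp (t z) = m0 * cnj (B z) / B z"
    using torus_exponent_exists[OF hu B(1) Bnz m0] by blast
  have pw: "AE z in circle.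
      k1 z = mat2 (of_real a0 * vb z $ 1 $ 1 / B z) (of_real a0 * vb z $ 1 $ 2 / B z)
                (- cnj (of_real a0 * vb z $ 1 $ 2 / B z)) (cnj (of_real a0 * vb z $ 1 $ 1 / B z)) \<and>
      k2 z = mat2 (cnj (ub z $ 2 $ 2 / B z)) (- cnj (ub z $ 2 $ 1 / B z)) (ub z $ 2 $ 1 / B z) (ub z $ 2 $ 2 / B z) \<and>
      g z = adj (k1 z) ** mat2 (exp (t z)) 0 0 (exp (- t z)) ** k2 z"
    using gS SL2_H2_boundary[OF v] SL2_H2_boundary[OF u] eq B(2) t(2)
  proof eventually_elim
    case (elim z)
    note pt = root_subgroup_pointwise[OF elim(1,2,3) m0 a0 elim(4) conjunct1[OF elim(5)] conjunct2[OF elim(5)]]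
    have "exp (- t z) = inverse (m0 * cnj (B z) / B z)" by (simp only: exp_minus elim(6))
    then show ?case
      using pt unfolding k1_def k2_def elim(6) by (intro conjI) simp_all
  qed
  \<comment> \<open>Positive and real, hence so are the values at 0 of the first entry of
    \<open>k1\<close> and the last entry of \<open>k2\<close>, whose numerators there are
    \<open>a0\<close> and 1.\<close>
  have E0: "exp (herglotz hu 0) = of_real (exp ((\<integral>w. hu w \<partial>circle) / (2 * pi)))"
    by (simp add: herglotz_0 exp_of_real[symmetric])
  have uv0: "v 0 $ 1 $ 1 = 1" "u 0 $ 2 $ 1 = 0" "u 0 $ 2 $ 2 = 1" using u v by (auto simp: SL2_H2_def)
  have "form_I1 k1"
    unfolding form_I1_def
  proof (intro conjI exI)
    show "SU2_loop k1" unfolding k1_def by (intro SU2_loop_of_row meas[OF quot(1)] meas[OF quot(2)])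
    show "\<forall>z\<in>ball 0 1. \<not> (of_real a0 * v z $ 1 $ 1 / exp (herglotz hu z) = 0 \<and> of_real a0 * v z $ 1 $ 2 / exp (herglotz hu z) = 0)"
      using vdet a0 by fastforce
    show "of_real a0 * v 0 $ 1 $ 1 / exp (herglotz hu 0) \<in> \<real>" unfolding E0 uv0 by simp
    show "0 < Re (of_real a0 * v 0 $ 1 $ 1 / exp (herglotz hu 0))" unfolding E0 uv0 using a0 by (simp flip: of_real_divide)
    show "AE z in circle. k1 z = mat2 (of_real a0 * vb z $ 1 $ 1 / B z) (of_real a0 * vb z $ 1 $ 2 / B z)
                (- cnj (of_real a0 * vb z $ 1 $ 2 / B z)) (cnj (of_real a0 * vb z $ 1 $ 1 / B z))"
      using pw by eventually_elim blast
  qed (rule quot)+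
  moreover have "form_II1 k2"
    unfolding form_II1_def
  proof (intro conjI exI)
    have "(\<lambda>z. - cnj (ub z $ 2 $ 1 / B z)) \<in> borel_measurable circle"
      using cnj_measurable[OF meas[OF quot(3)]] by measurable
    then show "SU2_loop k2" unfolding k2_def by (intro SU2_loop_of_row cnj_measurable meas[OF quot(4)])
    show "\<forall>z\<in>ball 0 1. \<not> (u z $ 2 $ 1 / exp (herglotz hu z) = 0 \<and> u z $ 2 $ 2 / exp (herglotz hu z) = 0)"
      using udet by fastforce
    show "u 0 $ 2 $ 1 / exp (herglotz hu 0) = 0" unfolding uv0 by simp
    show "u 0 $ 2 $ 2 / exp (herglotz hu 0) \<in> \<real>" unfolding E0 uv0 by simp
    show "0 < Re (u 0 $ 2 $ 2 / exp (herglotz hu 0))" unfolding E0 uv0 by (simp flip: of_real_divide)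
    show "AE z in circle. k2 z = mat2 (cnj (ub z $ 2 $ 2 / B z)) (- cnj (ub z $ 2 $ 1 / B z)) (ub z $ 2 $ 1 / B z) (ub z $ 2 $ 2 / B z)"
      using pw by eventually_elim blast
  qed (rule quot)+
  moreover have "AE z in circle. g z = adj (k1 z) ** mat2 (exp (t z)) 0 0 (exp (- t z)) ** k2 z"
    using pw by eventually_elim blast
  ultimately show ?thesis using t(1) by blast
qed

text \<open>Reflecting \<open>l\<close> in the circle puts the factorization into a form that is symmetric under \<open>adj\<close>.\<close>

lemma triangular_factorization_disk:
  assumes "has_triangular_factorization g"
  obtains v vb u ub m0 and a0 :: real where "SL2_H2 v vb" "SL2_H2 u ub" "norm m0 = 1" "0 < a0"
    "AE z in circle. g z = adj (vb z) ** diag2 m0 ** diag2 (complex_of_real a0) ** ub z"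
proof -
  from assms obtain l linf lb u ub m0 and a0 :: real where
    l: "\<And>i j. H2_exterior (\<lambda>z. l z $ i $ j) (linf $ i $ j) (\<lambda>z. lb z $ i $ j)"
       "\<And>z. 1 < norm z \<Longrightarrow> det (l z) = 1" "linf $ 1 $ 1 = 1" "linf $ 2 $ 2 = 1" "linf $ 1 $ 2 = 0"
    and u: "SL2_H2 u ub" and m0: "norm m0 = 1" and a0: "0 < a0"
    and eq: "AE z in circle. g z = lb z ** diag2 m0 ** diag2 (complex_of_real a0) ** ub z"
    unfolding has_triangular_factorization_def SL2_H2_def by blast
  define v where "v z = (if z = 0 then adj linf else adj (l (inverse (cnj z))))" for z
  have "det (v z) = 1" if "z \<in> ball 0 1" for z
  proof (cases "z = 0")
    case True
    then show ?thesis using l(3-5) by (simp add: v_def det_adj det_2)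
  next
    case False
    then have "1 < norm (inverse (cnj z))" using that by (simp add: norm_inverse one_less_inverse_iff)
    then show ?thesis using l(2) False by (simp add: v_def det_adj)
  qed
  moreover have "H2_disk (\<lambda>z. v z $ i $ j) (\<lambda>z. adj (lb z) $ i $ j)" for i j
  proof -
    have "(\<lambda>z. v z $ i $ j) = (\<lambda>z. if z = 0 then cnj (linf $ j $ i) else cnj (l (inverse (cnj z)) $ j $ i))"
      by (auto simp: v_def)
    then show ?thesis using H2_exterior_reflect[OF l(1)[of j i]] by simp
  qed
  ultimately have "SL2_H2 v (\<lambda>z. adj (lb z))"
    using l(3-5) unfolding SL2_H2_def by (simp add: v_def)
  then show thesis using u m0 a0 eq by (intro that[of v "\<lambda>z. adj (lb z)" u ub m0 a0]) simp_all
qed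

theorem theorem3p3:
  fixes g :: "complex \<Rightarrow> complex^2^2"
  assumes "SU2_loop g"
    and "has_triangular_factorization g"
  shows "(\<exists>k1 k2 h. form_I1 k1 \<and> form_II1 k2 \<and> torus_exponent h \<and>
            (AE z in circle. g z = adj (k1 z) ** mat2 (exp (h z)) 0 0 (exp (- h z)) ** k2 z)) \<and>
         (\<exists>k1' k2' h'. form_I1 k1' \<and> form_II1 k2' \<and> torus_exponent h' \<and>
            (AE z in circle. matrix_inv (g z) =
               adj (k1' z) ** mat2 (exp (h' z)) 0 0 (exp (- h' z)) ** k2' z))"
proof -
  obtain v vb u ub m0 and a0 :: real where f: "SL2_H2 v vb" "SL2_H2 u ub" "norm m0 = 1" "0 < a0"
    "AE z in circle. g z = adj (vb z) ** diag2 m0 ** diag2 (complex_of_real a0) ** ub z"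
    using triangular_factorization_disk[OF assms(2)] by blast
  \<comment> \<open>Taking adjoints exchanges the roles of \<open>v\<close> and \<open>u\<close> and
    conjugates \<open>m0\<close>. As both factors satisfy the same conditions, this is again a
    factorization of the required form, now for the inverse of \<open>g\<close>.\<close>
  have "AE z in circle. adj (g z) = adj (ub z) ** diag2 (cnj m0) ** diag2 (complex_of_real a0) ** vb z"
    using f(5)
  proof eventually_elim
    case (elim z)
    have "diag2 (complex_of_real a0) ** diag2 (cnj m0) = diag2 (cnj m0) ** diag2 (complex_of_real a0)"
      by (simp add: mat22_eq_iff mat22_mult_nth diag2_def)
    then show ?case
      unfolding elim by (simp add: adj_mult adj_diag2 flip: matrix_mul_assoc)
  qed
  from root_subgroup_factorization[OF SU2_loop_adj[OF assms(1)] f(2,1) _ f(4) this] f(3)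
  obtain k1 k2 h where k: "form_I1 k1" "form_II1 k2" "torus_exponent h"
    "AE z in circle. adj (g z) = adj (k1 z) ** mat2 (exp (h z)) 0 0 (exp (- h z)) ** k2 z"
    by auto
  have "AE z in circle. matrix_inv (g z) = adj (g z)"
    using assms(1) by (intro AE_I2) (simp add: SU2_loop_def SU2_matrix_inv)
  with k(4) have "AE z in circle. matrix_inv (g z) = adj (k1 z) ** mat2 (exp (h z)) 0 0 (exp (- h z)) ** k2 z"
    by eventually_elim simp
  with k root_subgroup_factorization[OF assms(1) f] show ?thesis by blast
qed

end
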